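(* Let $\nu$ be a non-negative Borel measure on $[0,\infty)$ satisfying $$\int_0^\infty\frac{1}{1+\sqrt\lambda}\,d\nu(\lambda)<\infty,$$ and let $$g(x)=x_+^0\int_0^\infty e^{-\pi\lambda x^2}\,d\nu(\lambda)\qquad(x\in\mathbb{R}).$$ Then there exists a unique best approximation $k$ of exponential type $\pi$ for $g$; that is, among all entire functions $K$ of exponential type at most $\pi$ there is a unique one, $K=k$, minimizing $\int_{-\infty}^\infty|g(x)-K(x)|\,dx$. The function $k$ interpolates the values of $g$ at $\mathbb{Z}\setminus\{0\}$ (that is, $k(n)=g(n)$ for all $n\in\mathbb{Z}\setminus\{0\}$), satisfies $$\sin(\pi x)\,\{g(x)-k(x)\}\ge0$$ for all real $x$, and $$\int_{-\infty}^\infty|g(x)-k(x)|\,dx=\int_0^\infty\frac{1}{\pi\lambda}\int_0^1\theta_1\big(0,\,i\lambda^{-1}(1-y^2)\big)\,dy\,d\nu(\lambda).$$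
   Context: An entire function $K$ is of exponential type at most $2\pi\delta$ if for every $\epsilon>0$ there is $C_\epsilon>0$ with $|K(z)|\le C_\epsilon e^{(2\pi\delta+\epsilon)|z|}$ for all $z\in\mathbb{C}$. $x_+^0=\tfrac12(1+\mathrm{sgn}(x))$, i.e. $x_+^0=1$ for $x>0$, $\tfrac12$ for $x=0$, $0$ for $x<0$. Integrals $\int_0^\infty\cdots d\nu$ are over $[0,\infty)$. If $\nu$ is an infinite measure, the formula for $g$ gives $+\infty$ at the single point $x=0$; then the product $\sin(\pi x)\{g(x)-k(x)\}$ is read as $0$ at $x=0$. For $\Im\tau>0$, with $q=e^{\pi i\tau}$ and $q^{a}=e^{\pi i\tau a}$, $\theta_1(z,\tau)=\sum_{n=-\infty}^\infty q^{(n+\frac12)^2}e^{(2n+1)\pi iz}$. The function $\lambda\mapsto\frac{1}{\pi\lambda}\int_0^1\theta_1(0,i\lambda^{-1}(1-y^2))\,dy$, defined for $\lambda>0$, is given at $\lambda=0$ its limiting value $\tfrac12$ (relevant only if $\nu(\{0\})>0$). *)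

theory Defs
  imports "HOL-Analysis.Analysis"
begin

definition exp_type_le :: "real \<Rightarrow> (complex \<Rightarrow> complex) \<Rightarrow> bool" where
  "exp_type_le \<sigma> K \<longleftrightarrow>
     K holomorphic_on UNIV \<and>
     (\<forall>\<epsilon>>0. \<exists>C>0. \<forall>z. cmod (K z) \<le> C * exp ((\<sigma> + \<epsilon>) * cmod z))"

text \<open>The \<open>L\<^sup>1\<close> distance on the real line is taken in \<^typ>\<open>ennreal\<close>, so that competitors \<open>K\<close> for
  which \<open>g - K\<close> is not integrable have distance \<open>\<infinity>\<close>.\<close>

definition L1_dist :: "(real \<Rightarrow> real) \<Rightarrow> (complex \<Rightarrow> complex) \<Rightarrow> ennreal" where
  "L1_dist g K =
     (\<integral>\<^sup>+ x. ennreal (cmod (complex_of_real (g x) - K (complex_of_real x))) \<partial>lborel)"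

definition best_approx :: "real \<Rightarrow> (real \<Rightarrow> real) \<Rightarrow> (complex \<Rightarrow> complex) \<Rightarrow> bool" where
  "best_approx \<sigma> g k \<longleftrightarrow>
     exp_type_le \<sigma> k \<and> (\<forall>K. exp_type_le \<sigma> K \<longrightarrow> L1_dist g k \<le> L1_dist g K)"

definition x_plus_0 :: "real \<Rightarrow> real" where
  "x_plus_0 x = (1 + sgn x) / 2"

text \<open>If \<open>\<nu>\<close> is infinite, the integral diverges at \<open>x = 0\<close> and the Bochner integral returns \<open>0\<close>
  there in place of \<open>\<infinity>\<close>. This single value affects neither \<^const>\<open>L1_dist\<close> nor
  \<open>sin (pi * x) * (g x - k x)\<close>, which is then \<open>0\<close> at \<open>x = 0\<close>.\<close>

definition trunc_gauss :: "real measure \<Rightarrow> real \<Rightarrow> real" where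
  "trunc_gauss \<nu> x = x_plus_0 x * (\<integral>l. exp (- pi * l * x\<^sup>2) \<partial>\<nu>)"

text \<open>Here \<open>q\<close> raised to the power \<open>a\<close> means \<open>exp (pi * \<i> * \<tau> * a)\<close>. The series converges absolutely
  for \<open>Im \<tau> > 0\<close>; this is the function often called \<open>\<theta>\<^sub>2\<close>.\<close>

definition theta1 :: "complex \<Rightarrow> complex \<Rightarrow> complex" where
  "theta1 z \<tau> =
     (\<Sum>\<^sub>\<infinity>n::int. exp (pi * \<i> * \<tau> * (of_int n + 1/2)\<^sup>2) * exp ((2 * of_int n + 1) * pi * \<i> * z))"

text \<open>The value \<open>1/2\<close> is the limit as \<open>l\<close> tends to \<open>0\<close> from the right. The endpoint \<open>y = 1\<close>, where
  the second argument of \<^const>\<open>theta1\<close> is \<open>0\<close>, is a null set.\<close>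

definition theta_mean :: "real \<Rightarrow> complex" where
  "theta_mean l =
     (if l = 0 then 1/2
      else 1 / (pi * l) *
        (LINT y:{0..1}|lborel. theta1 0 (\<i> * complex_of_real (inverse l * (1 - y\<^sup>2)))))"

end

theory Submission
  imports Defs "HOL-Probability.Probability" "HOL-Complex_Analysis.Complex_Analysis" "HOL-Real_Asymp.Real_Asymp"
begin

text \<open>Superposition reduces everything to one Gaussian of parameter \<open>l\<close>. Its candidate is the cardinal
  series \<open>kern\<close> through the values at the nonzero integers, with the coefficient at \<open>0\<close> chosen as
  \<open>\<Sum>n\<ge>1. (- 1) ^ (n - 1) * exp (- \<pi> l n\<^sup>2)\<close>, so that it decays like \<open>1/x\<^sup>2\<close>. Divided by
  \<open>sin (\<pi> x) / \<pi>\<close>, the error becomes a partial fraction series. For \<open>x < 0\<close> its sign follows from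
  the monotonicity of the partial theta function \<open>\<Sum>n. (- 1) ^ n * q ^ n\<^sup>2 * u ^ n\<close> in \<open>u\<close>. For
  \<open>x > 0\<close>, after multiplication by \<open>exp (\<pi> l x\<^sup>2)\<close>, the error is monotone in \<open>l\<close>, because of the
  same fact and of the monotonicity of \<open>\<theta>\<^sub>4\<close>, and at \<open>l = 0\<close> it is explicit.

  An integrable \<open>F\<close> of type \<open>\<pi>\<close> has a Fourier transform supported in \<open>[- \<pi>, \<pi>]\<close>, hence is
  orthogonal to the square wave \<open>sgn (sin (\<pi> x))\<close>, which by the sign of the error is the sign of
  \<open>g - k\<close>; this is extremality. A second extremal function interpolates \<open>g\<close> at the same integers, so
  its difference \<open>F\<close> from \<open>k\<close> vanishes there; then all Fourier coefficients of the transform of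
  \<open>F\<close> but one are zero, the transform is constant on \<open>[- \<pi>, \<pi>]\<close> and continuous, and \<open>F = 0\<close>.
  The minimal distance is the integral of the truncated Gaussian against the square wave, expanded in
  its Fourier series; for \<open>l = 0\<close> it is computed by periodizing the error.\<close>

section \<open>Cardinal series\<close>

text \<open>Two obstacles shape the estimates. At l = 0 all coefficients equal 1 and the cardinal
  series converges only conditionally; since \<nu> may charge the point 0, nothing can rest on
  absolute convergence. Bounds for the series therefore come from alternation and monotonicity, and
  they are linear in the first coefficient. For one Gaussian this coefficient is exp(-pi l), which
  is \<nu>-integrable, so the same bound later serves as majorant for the superposition. Secondly,
  at l = 0 the step function and its approximation are not integrable separately, only their
  difference is, so pairing with the square wave cannot give the distance there. The weight 1/(1 +
  sqrt l) in the hypothesis matches the minimal distance of one Gaussian, which stays bounded for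
  small l and is at most 1/(2 sqrt l). On the Fourier side only weak facts enter: vanishing at and
  beyond the edge of the band, uniqueness of the Fourier coefficients of a continuous function, and
  inversion up to a positive constant.\<close>

lemma alternating_sum_bound:
  fixes b :: "nat \<Rightarrow> complex"
  assumes "M \<le> N"
  shows "2 * cmod (\<Sum>m = M..<N. (- 1) ^ m * b m) \<le> cmod (b M) + cmod (b N) + (\<Sum>m = M..<N. cmod (b m - b (Suc m)))"
proof -
  \<comment> \<open>Summation by parts: the alternating sum is added to its own shift by one index,
    and only two boundary terms and the first differences of \<open>b\<close> survive.\<close>
  have "2 * (\<Sum>m = M..<N. (- 1) ^ m * b m) =
      (- 1) ^ M * b M - (- 1) ^ N * b N + (\<Sum>m = M..<N. (- 1) ^ m * (b m - b (Suc m)))"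
    using assms
  proof (induction N rule: dec_induct)
    case (step n)
    then show ?case by (simp add: algebra_simps)
  qed simp
  then have "2 * cmod (\<Sum>m = M..<N. (- 1) ^ m * b m) =
      cmod ((- 1) ^ M * b M - (- 1) ^ N * b N + (\<Sum>m = M..<N. (- 1) ^ m * (b m - b (Suc m))))"
    by (metis norm_mult norm_numeral)
  also have "\<dots> \<le> cmod ((- 1) ^ M * b M) + cmod ((- 1) ^ N * b N)
      + cmod (\<Sum>m = M..<N. (- 1) ^ m * (b m - b (Suc m)))"
    by (rule order.trans [OF norm_triangle_ineq add_right_mono [OF norm_triangle_ineq4]])
  also have "\<dots> \<le> cmod (b M) + cmod (b N) + (\<Sum>m = M..<N. cmod (b m - b (Suc m)))"
    by (intro add_mono sum_norm_le) (auto simp: norm_mult norm_power)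
  finally show ?thesis .
qed

text \<open>For m \<ge> M the distance |z - m| is at least m/2, so the quotients have total
  variation of order \<open>a M / M\<close>; summation by parts turns this into a bound independent
  of N. Constant \<open>a\<close>, which is the case l = 0, is covered.\<close>

lemma alternating_partial_fraction_tail:
  fixes a :: "nat \<Rightarrow> real" and z :: complex
  assumes a: "\<And>m. 0 \<le> a m" "\<And>m. M \<le> m \<Longrightarrow> a (Suc m) \<le> a m"
    and z: "2 * cmod z \<le> real M" and M: "0 < M" "M \<le> N"
  shows "cmod (\<Sum>m = M..<N. (- 1) ^ m * (of_real (a m) / (z - of_nat m))) \<le> 5 * a M / M"
proof -
  define b where "b m = of_real (a m) / (z - of_nat m)" for m
  have aM: "a m \<le> a M" if "M \<le> m" for m
    using that by (induction m rule: dec_induct) (auto intro: order.trans [OF a(2)])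
  have far: "real m / 2 \<le> cmod (z - of_nat m)" if "M \<le> m" for m
  proof -
    have "real m - cmod z \<le> cmod (z - of_nat m)"
      using norm_triangle_ineq2 [of "of_nat m" z] by (simp add: norm_minus_commute)
    then show ?thesis using z that by linarith
  qed
  have inv: "1 / cmod (z - of_nat m) \<le> 2 / real m" if "M \<le> m" for m
  proof -
    have "0 < real m" using that M by simp
    then show ?thesis using frac_le [of 1 1 "real m / 2" "cmod (z - of_nat m)"] far [OF that] by simp
  qed
  have inv2: "1 / cmod (z - of_nat m) \<le> 2 / real M" if "M \<le> m" for m
    using inv [OF that] that M frac_le [of 2 2 "real M" "real m"] by simp
  have b: "cmod (b m) \<le> 2 * a M / M" if "M \<le> m" for m
    using mult_mono [OF aM [OF that] inv2 [OF that]] a(1) [of M] a(1) [of m]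
    by (simp add: b_def norm_divide mult_ac)
  have "(\<Sum>m = M..<N. cmod (b m - b (Suc m))) \<le>
      (\<Sum>m = M..<N. (a m - a (Suc m)) * (2 / M) + 4 * a M * (1 / m - 1 / Suc m))"
  proof (rule sum_mono)
    fix m assume "m \<in> {M..<N}"
    then have m: "M \<le> m" "M \<le> Suc m" "0 < m" using M by auto
    have nz: "z - of_nat m \<noteq> 0" "z - of_nat (Suc m) \<noteq> 0"
      using far [OF m(1)] far [OF m(2)] m(3) by auto
    \<comment> \<open>Discrete product rule: the variation of \<open>a\<close> and that of 1/(z - m)
      are bounded separately, and both bounds telescope.\<close>
    have "b m - b (Suc m) = of_real (a m - a (Suc m)) * (1 / (z - of_nat m))
        + of_real (a (Suc m)) * (- (1 / (z - of_nat m)) * (1 / (z - of_nat (Suc m))))"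
      using nz by (simp add: b_def divide_simps) (simp add: algebra_simps)
    also have "cmod \<dots> \<le> (a m - a (Suc m)) * (1 / cmod (z - of_nat m))
        + a (Suc m) * (1 / cmod (z - of_nat m) * (1 / cmod (z - of_nat (Suc m))))"
      using a(1) [of "Suc m"] a(2) [OF m(1)]
      by (intro order.trans [OF norm_triangle_ineq] add_mono)
        (auto simp: norm_mult norm_divide simp del: of_real_diff)
    also have "\<dots> \<le> (a m - a (Suc m)) * (2 / M) + a M * (2 / m * (2 / Suc m))"
      using a(2) [OF m(1)] aM [OF m(2)] a(1) [of "Suc m"] inv2 [OF m(1)] inv [OF m(1)] inv [OF m(2)] m
      by (intro add_mono mult_mono) auto
    also have "a M * (2 / m * (2 / Suc m)) = 4 * a M * (1 / m - 1 / Suc m)"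
      using m by (simp add: field_simps)
    finally show "cmod (b m - b (Suc m)) \<le> (a m - a (Suc m)) * (2 / M) + 4 * a M * (1 / m - 1 / Suc m)" .
  qed
  also have "\<dots> = (\<Sum>m = M..<N. a m - a (Suc m)) * (2 / M) + 4 * a M * (\<Sum>m = M..<N. 1 / real m - 1 / real (Suc m))"
    by (simp only: sum.distrib sum_distrib_left sum_distrib_right)
  also have "\<dots> = (a M - a N) * (2 / M) + 4 * a M * (1 / real M - 1 / real N)"
    using M(2) sum_Suc_diff' [of M N "\<lambda>m. - a m"] sum_Suc_diff' [of M N "\<lambda>m. - (1 / real m)"] by simp
  also have "\<dots> \<le> a M * (2 / M) + 4 * a M * (1 / real M)"
    using a(1) M by (intro add_mono mult_mono) (auto simp: field_simps)
  \<comment> \<open>The variation contributes 2 + 4 and the boundary terms 2 + 2; halved, this is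
    the constant 5.\<close>
  finally have "(\<Sum>m = M..<N. cmod (b m - b (Suc m))) \<le> 6 * a M / M" by simp
  then have "2 * cmod (\<Sum>m = M..<N. (- 1) ^ m * b m) \<le> 10 * a M / M"
    using alternating_sum_bound [OF M(2), of b] b [of M] b [OF M(2)] by simp
  then show ?thesis by (simp add: b_def)
qed

lemma norm_sin_le_exp: "cmod (sin z) \<le> exp (cmod z)"
proof -
  have "cmod (exp (\<i> * z) - exp (- (\<i> * z))) \<le> exp (cmod z) + exp (cmod z)"
    using norm_exp [of "\<i> * z"] norm_exp [of "- (\<i> * z)"]
    by (intro order.trans [OF norm_triangle_ineq4] add_mono) (auto simp: norm_mult)
  then show ?thesis by (simp add: sin_exp_eq norm_divide norm_mult)
qed

section \<open>The cardinal sine and its integer translates\<close>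

definition nsinc :: "real \<Rightarrow> real" where
  "nsinc x = (if x = 0 then 1 else sin (pi * x) / (pi * x))"

definition csinc :: "complex \<Rightarrow> complex" where
  "csinc z = (if z = 0 then 1 else sin (of_real pi * z) / (of_real pi * z))"

lemma csinc_of_real: "csinc (of_real x) = of_real (nsinc x)"
  by (simp add: csinc_def nsinc_def flip: sin_of_real)

lemma csinc_of_int: "csinc (of_int n) = (if n = 0 then 1 else 0)"
proof -
  have "sin (of_real pi * of_int n :: complex) = of_real (sin (pi * of_int n))"
    using sin_of_real [of "pi * of_int n", where 'a = complex] by simp
  also have "sin (pi * of_int n) = 0" by (simp add: sin_zero_iff_int2 mult.commute)
  finally show ?thesis by (simp add: csinc_def)
qed

text \<open>All integer translates share the factor sin(pi z)/pi. This is what turns a cardinal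
  series into an alternating partial fraction series.\<close>

lemma csinc_diff_of_nat:
  assumes "z \<noteq> of_nat m"
  shows "csinc (z - of_nat m) = sin (of_real pi * z) / of_real pi * ((- 1) ^ m / (z - of_nat m))"
proof -
  have "sin (of_real pi * (z - of_nat m)) = (- 1) ^ m * sin (of_real pi * z)"
  proof (induction m)
    case (Suc m)
    have "of_real pi * (z - of_nat (Suc m)) = of_real pi * (z - of_nat m) - of_real pi"
      by (simp add: algebra_simps)
    then show ?case using Suc by (simp add: sin_diff flip: sin_of_real cos_of_real)
  qed simp
  then show ?thesis using assms by (simp add: csinc_def)
qed

lemma holomorphic_csinc: "csinc holomorphic_on S"
proof -
  have "deriv (\<lambda>z. sin (of_real pi * z) / of_real pi) 0 = (1 :: complex)"
    by (rule DERIV_imp_deriv) (auto intro!: derivative_eq_intros)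
  then have d: "csinc 0 = deriv (\<lambda>z. sin (of_real pi * z) / of_real pi) 0"
    by (simp add: csinc_def)
  have "csinc holomorphic_on UNIV"
  proof (rule pole_theorem_open_0 [where a = 0 and g = "\<lambda>z. sin (of_real pi * z) / of_real pi"])
    show "csinc 0 = deriv (\<lambda>z. sin (of_real pi * z) / of_real pi) 0" by (rule d)
    show "(\<lambda>z. sin (complex_of_real pi * z) / complex_of_real pi) holomorphic_on UNIV"
      by (intro holomorphic_intros) simp
  qed (simp_all add: csinc_def)
  then show ?thesis by (rule holomorphic_on_subset) simp
qed

lemma holomorphic_csinc_shift: "(\<lambda>z. csinc (z - a)) holomorphic_on S"
proof -
  have "(csinc \<circ> (\<lambda>z. z - a)) holomorphic_on S"
    by (intro holomorphic_on_compose holomorphic_csinc holomorphic_on_diff holomorphic_on_ident holomorphic_on_const)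
  then show ?thesis by (simp add: o_def)
qed

text \<open>The exponent contains \<open>cmod z\<close> and not the distance to n, which would cost
  a factor exp(pi n). Within distance 1 of n compactness gives the bound; elsewhere the sine of pi
  z, up to sign free of n, is divided by something at least 1.\<close>

lemma csinc_bound: "\<exists>B\<ge>1. \<forall>z n. cmod (csinc (z - of_nat n)) \<le> B * exp (pi * cmod z)"
proof -
  have "compact (csinc ` cball 0 1)"
    by (intro compact_continuous_image holomorphic_on_imp_continuous_on holomorphic_csinc compact_cball)
  then obtain B where B: "\<And>w. cmod w \<le> 1 \<Longrightarrow> cmod (csinc w) \<le> B"
    by (force dest: compact_imp_bounded simp: bounded_iff)
  have "cmod (csinc (z - of_nat n)) \<le> max 1 B * exp (pi * cmod z)" for z n
  proof (cases "cmod (z - of_nat n) \<le> 1")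
    case True
    then have "cmod (csinc (z - of_nat n)) \<le> max 1 B * 1" using B by fastforce
    also have "\<dots> \<le> max 1 B * exp (pi * cmod z)" by (intro mult_left_mono) auto
    finally show ?thesis .
  next
    case False
    then have ne: "z \<noteq> of_nat n" by auto
    have "cmod (csinc (z - of_nat n)) = cmod (sin (of_real pi * z)) * (1 / (pi * cmod (z - of_nat n)))"
      by (simp add: csinc_diff_of_nat [OF ne] norm_mult norm_divide norm_power)
    also have "\<dots> \<le> exp (pi * cmod z) * 1"
    proof (intro mult_mono)
      show "cmod (sin (of_real pi * z)) \<le> exp (pi * cmod z)"
        using norm_sin_le_exp [of "of_real pi * z"] by (simp add: norm_mult)
      have "1 * 1 \<le> pi * cmod (z - of_nat n)" using False pi_ge_two by (intro mult_mono) auto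
      then show "1 / (pi * cmod (z - of_nat n)) \<le> 1" using False by simp
    qed auto
    also have "\<dots> \<le> exp (pi * cmod z) * max 1 B" by (intro mult_left_mono) auto
    finally show ?thesis by (simp add: mult.commute)
  qed
  then show ?thesis by (intro exI [of _ "max 1 B"]) auto
qed

section \<open>Cardinal series with decreasing coefficients\<close>

definition cardinal_series :: "(nat \<Rightarrow> real) \<Rightarrow> complex \<Rightarrow> complex" where
  "cardinal_series a z = (\<Sum>n. of_real (a (Suc n)) * csinc (z - of_nat (Suc n)))"

text \<open>Monotonicity starts at index 1 because the series does: for the sequence
  \<open>node\<close> below, the entry at 0 is the default value 0 of a divergent integral whenever
  the measure is infinite. Constant sequences are included; they are the case l = 0.\<close>

locale decreasing_sequence =
  fixes a :: "nat \<Rightarrow> real"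
  assumes nonneg: "0 \<le> a n" and decreasing: "1 \<le> n \<Longrightarrow> a (Suc n) \<le> a n"
begin

lemma le_first: "1 \<le> n \<Longrightarrow> a n \<le> a 1"
  by (induction n rule: dec_induct) (auto intro: order.trans [OF decreasing])

lemma cardinal_tail:
  assumes z: "2 * cmod z \<le> real M" and M: "0 < M" "M \<le> N"
  shows "cmod (\<Sum>m = M..<N. of_real (a m) * csinc (z - of_nat m)) \<le> exp (pi * cmod z) * (5 * a 1 / M)"
proof -
  have ne: "z \<noteq> of_nat m" if "M \<le> m" for m
  proof
    assume "z = of_nat m"
    then show False using z that M by simp
  qed
  have "(\<Sum>m = M..<N. of_real (a m) * csinc (z - of_nat m)) =
      sin (of_real pi * z) / of_real pi * (\<Sum>m = M..<N. (- 1) ^ m * (of_real (a m) / (z - of_nat m)))"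
    unfolding sum_distrib_left
  proof (rule sum.cong)
    fix m assume "m \<in> {M..<N}"
    then have "z \<noteq> of_nat m" using ne [of m] by simp
    then show "of_real (a m) * csinc (z - of_nat m) =
        sin (of_real pi * z) / of_real pi * ((- 1) ^ m * (of_real (a m) / (z - of_nat m)))"
      by (simp add: csinc_diff_of_nat)
  qed simp
  also have "cmod \<dots> = cmod (sin (of_real pi * z)) / pi *
      cmod (\<Sum>m = M..<N. (- 1) ^ m * (of_real (a m) / (z - of_nat m)))"
    by (simp add: norm_mult norm_divide)
  also have "\<dots> \<le> exp (pi * cmod z) * (5 * a 1 / M)"
  proof (intro mult_mono)
    have "cmod (sin (of_real pi * z)) / pi \<le> cmod (sin (of_real pi * z))"
      using pi_ge_two by (simp add: divide_le_eq mult_left_le [of _ "cmod (sin (of_real pi * z))"] mult_le_cancel_left1)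
    also have "\<dots> \<le> exp (pi * cmod z)"
      using norm_sin_le_exp [of "of_real pi * z"] by (simp add: norm_mult)
    finally show "cmod (sin (of_real pi * z)) / pi \<le> exp (pi * cmod z)" .
    have "cmod (\<Sum>m = M..<N. (- 1) ^ m * (of_real (a m) / (z - of_nat m))) \<le> 5 * a M / M"
      using nonneg decreasing z M by (intro alternating_partial_fraction_tail) auto
    also have "\<dots> \<le> 5 * a 1 / M" using le_first [of M] M by (intro divide_right_mono) auto
    finally show "cmod (\<Sum>m = M..<N. (- 1) ^ m * (of_real (a m) / (z - of_nat m))) \<le> 5 * a 1 / M" .
  qed auto
  finally show ?thesis .
qed

lemma cardinal_partial_sum_diff:
  assumes "M \<le> N"
  shows "(\<Sum>n<N. of_real (a (Suc n)) * csinc (z - of_nat (Suc n))) -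
      (\<Sum>n<M. of_real (a (Suc n)) * csinc (z - of_nat (Suc n))) =
      (\<Sum>m = Suc M..<Suc N. of_real (a m) * csinc (z - of_nat m))"
proof -
  have "(\<Sum>m = Suc M..<Suc N. of_real (a m) * csinc (z - of_nat m)) =
      (\<Sum>n = M..<N. of_real (a (Suc n)) * csinc (z - of_nat (Suc n)))"
    by (rule sum.shift_bounds_Suc_ivl)
  also have "\<dots> = (\<Sum>n<N. of_real (a (Suc n)) * csinc (z - of_nat (Suc n))) -
      (\<Sum>n<M. of_real (a (Suc n)) * csinc (z - of_nat (Suc n)))"
    using sum_diff_nat_ivl [of 0 M N "\<lambda>n. of_real (a (Suc n)) * csinc (z - of_nat (Suc n))"] assms
    by (simp add: lessThan_atLeast0)
  finally show ?thesis by simp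
qed

text \<open>Beyond the index 2 R the tail bound depends on R only, so the partial sums are uniformly
  Cauchy on the disc. Locally uniform limits then make the series entire.\<close>

lemma cardinal_uniform_limit:
  "uniform_limit (cball 0 R) (\<lambda>N z. \<Sum>n<N. of_real (a (Suc n)) * csinc (z - of_nat (Suc n)))
     (cardinal_series a) sequentially"
proof -
  let ?S = "\<lambda>N z. \<Sum>n<N. of_real (a (Suc n)) * csinc (z - of_nat (Suc n))"
  have close: "dist (?S M z) (?S N z) \<le> exp (pi * R) * (5 * a 1) / Suc M"
    if "cmod z \<le> R" "2 * R \<le> real M" "M \<le> N" for M N z
  proof -
    have "dist (?S M z) (?S N z) = cmod (\<Sum>m = Suc M..<Suc N. of_real (a m) * csinc (z - of_nat m))"
      unfolding cardinal_partial_sum_diff [OF that(3), symmetric] by (simp only: dist_norm norm_minus_commute)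
    also have "\<dots> \<le> exp (pi * cmod z) * (5 * a 1 / Suc M)"
      using that by (intro cardinal_tail) auto
    also have "\<dots> \<le> exp (pi * R) * (5 * a 1 / Suc M)"
      using that nonneg [of 1] by (intro mult_right_mono) auto
    finally show ?thesis by simp
  qed
  have "uniformly_Cauchy_on (cball 0 R) ?S"
  proof (rule uniformly_Cauchy_onI)
    fix e :: real assume "0 < e"
    have "(\<lambda>M. exp (pi * R) * (5 * a 1) / Suc M) \<longlonglongrightarrow> 0"
      by (rule LIMSEQ_Suc [OF lim_const_over_n])
    then have "eventually (\<lambda>M. exp (pi * R) * (5 * a 1) / Suc M < e / 2) sequentially"
      using \<open>0 < e\<close> by (intro order_tendstoD) auto
    then have "eventually (\<lambda>M. exp (pi * R) * (5 * a 1) / Suc M < e / 2 \<and> 2 * R \<le> real M) sequentially"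
      using eventually_ge_at_top [of "nat \<lceil>2 * R\<rceil>"] by eventually_elim linarith
    then obtain M where M: "exp (pi * R) * (5 * a 1) / Suc M < e / 2" "2 * R \<le> real M"
      by (auto simp: eventually_sequentially)
    show "\<exists>M. \<forall>z\<in>cball 0 R. \<forall>m\<ge>M. \<forall>n\<ge>M. dist (?S m z) (?S n z) < e"
    proof (intro exI ballI allI impI)
      fix z :: complex and m n assume z: "z \<in> cball 0 R" and mn: "M \<le> m" "M \<le> n"
      have "dist (?S m z) (?S n z) \<le> dist (?S M z) (?S m z) + dist (?S M z) (?S n z)"
        by (rule dist_triangle3)
      also have "\<dots> < e"
        using close [of z M m] close [of z M n] z mn M by simp
      finally show "dist (?S m z) (?S n z) < e" .
    qed
  qed
  then have "uniformly_convergent_on (cball 0 R) ?S"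
    by (rule Cauchy_uniformly_convergent)
  then obtain L where L: "uniform_limit (cball 0 R) ?S L sequentially"
    by (auto simp: uniformly_convergent_on_def)
  have "L z = cardinal_series a z" if "z \<in> cball 0 R" for z
    using tendsto_uniform_limitI [OF L that, folded sums_def] unfolding cardinal_series_def
    by (rule sums_unique)
  then show ?thesis
    using L unfolding uniform_limit_iff by (auto elim!: eventually_mono)
qed

lemma cardinal_sums:
  "(\<lambda>n. of_real (a (Suc n)) * csinc (z - of_nat (Suc n))) sums cardinal_series a z"
  unfolding sums_def by (rule tendsto_uniform_limitI [OF cardinal_uniform_limit [of "cmod z"]]) simp

text \<open>An explicit rate that sees the coefficients only through \<open>a 1\<close>. It makes
  convergence uniform over the whole family of Gaussians in \<open>kern_tendsto_0\<close>.\<close>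

lemma cardinal_remainder:
  assumes "2 * cmod z \<le> real (Suc M)"
  shows "cmod (cardinal_series a z - (\<Sum>n<M. of_real (a (Suc n)) * csinc (z - of_nat (Suc n))))
    \<le> exp (pi * cmod z) * (5 * a 1 / Suc M)"
proof (rule LIMSEQ_le_const2)
  show "(\<lambda>N. cmod ((\<Sum>n<N. of_real (a (Suc n)) * csinc (z - of_nat (Suc n))) -
      (\<Sum>n<M. of_real (a (Suc n)) * csinc (z - of_nat (Suc n))))) \<longlonglongrightarrow>
      cmod (cardinal_series a z - (\<Sum>n<M. of_real (a (Suc n)) * csinc (z - of_nat (Suc n))))"
    using cardinal_sums [of z] unfolding sums_def by (intro tendsto_intros)
  show "\<exists>N0. \<forall>N\<ge>N0. cmod ((\<Sum>n<N. of_real (a (Suc n)) * csinc (z - of_nat (Suc n))) -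
      (\<Sum>n<M. of_real (a (Suc n)) * csinc (z - of_nat (Suc n)))) \<le> exp (pi * cmod z) * (5 * a 1 / Suc M)"
  proof (intro exI [of _ M] allI impI)
    fix N assume "M \<le> N"
    then show "cmod ((\<Sum>n<N. of_real (a (Suc n)) * csinc (z - of_nat (Suc n))) -
      (\<Sum>n<M. of_real (a (Suc n)) * csinc (z - of_nat (Suc n)))) \<le> exp (pi * cmod z) * (5 * a 1 / Suc M)"
      using cardinal_tail [OF assms, of "Suc N"] by (subst cardinal_partial_sum_diff) auto
  qed
qed

lemma holomorphic_cardinal_series: "cardinal_series a holomorphic_on UNIV"
proof -
  have "cardinal_series a holomorphic_on UNIV"
  proof (rule holomorphic_uniform_sequence [of UNIV "\<lambda>N z. \<Sum>n<N. of_real (a (Suc n)) * csinc (z - of_nat (Suc n))"])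
    fix N :: nat
    show "(\<lambda>z. \<Sum>n<N. of_real (a (Suc n)) * csinc (z - of_nat (Suc n))) holomorphic_on UNIV"
      by (intro holomorphic_on_sum holomorphic_on_mult holomorphic_on_const holomorphic_csinc_shift)
  next
    fix z :: complex
    have "cball z 1 \<subseteq> cball 0 (cmod z + 1)"
    proof
      fix w assume "w \<in> cball z 1"
      then show "w \<in> cball 0 (cmod z + 1)"
        using norm_triangle_ineq2 [of w z] by (simp add: dist_norm norm_minus_commute [of z w])
    qed
    then show "\<exists>d>0. cball z d \<subseteq> UNIV \<and> uniform_limit (cball z d)
        (\<lambda>N z. \<Sum>n<N. of_real (a (Suc n)) * csinc (z - of_nat (Suc n))) (cardinal_series a) sequentially"
      using uniform_limit_on_subset [OF cardinal_uniform_limit] by (intro exI [of _ 1]) auto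
  qed simp
  then show ?thesis .
qed

end

text \<open>The constant \<open>B\<close> is chosen before the sequence. For Gaussian coefficients
  the bound is then exp(-pi l) times a quantity free of l and N, as dominated convergence in the
  superposition demands.\<close>

lemma cardinal_partial_sum_bound:
  "\<exists>B>0. \<forall>a z N. decreasing_sequence a \<longrightarrow>
     cmod (\<Sum>n<N. of_real (a (Suc n)) * csinc (z - of_nat (Suc n))) \<le> a 1 * (B * (1 + cmod z) * exp (pi * cmod z))"
proof -
  obtain B where B: "1 \<le> B" "\<And>z n. cmod (csinc (z - of_nat n)) \<le> B * exp (pi * cmod z)"
    using csinc_bound by blast
  have "cmod (\<Sum>n<N. of_real (a (Suc n)) * csinc (z - of_nat (Suc n))) \<le> a 1 * ((2 * B + 5) * (1 + cmod z) * exp (pi * cmod z))"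
    if "decreasing_sequence a" for a z N
  proof -
    interpret decreasing_sequence a by fact
    let ?S = "\<lambda>N. \<Sum>n<N. of_real (a (Suc n)) * csinc (z - of_nat (Suc n))"
    \<comment> \<open>Up to this index the terms are estimated one by one, at the cost of a factor
      linear in |z|; from there on the tail bound applies.\<close>
    define M where "M = nat \<lceil>2 * cmod z\<rceil>"
    have M: "2 * cmod z \<le> real M" "real M \<le> 2 * cmod z + 1"
      unfolding M_def by (auto simp: of_nat_ceiling) 
    have first: "cmod (?S N) \<le> a 1 * (B * real M * exp (pi * cmod z))" if "N \<le> M" for N
    proof -
      have "cmod (?S N) \<le> (\<Sum>n<N. a 1 * (B * exp (pi * cmod z)))"
        by (intro sum_norm_le) (use nonneg le_first B(1) B(2) [of z "Suc x" for x] in \<open>auto simp: norm_mult intro!: mult_mono\<close>)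
      also have "\<dots> = real N * (a 1 * (B * exp (pi * cmod z)))" by simp
      also have "\<dots> \<le> real M * (a 1 * (B * exp (pi * cmod z)))"
        using that nonneg [of 1] B by (intro mult_right_mono) auto
      finally show ?thesis by (simp add: mult_ac)
    qed
    have "cmod (?S N) \<le> a 1 * (B * real M * exp (pi * cmod z)) + exp (pi * cmod z) * (5 * a 1)"
    proof (cases "N \<le> M")
      case True
      then show ?thesis using first [OF True] nonneg [of 1] by (intro order.trans [OF first [OF True]]) simp
    next
      case False
      have "cmod (?S N) \<le> cmod (?S M) + cmod (?S N - ?S M)"
        using norm_triangle_ineq [of "?S M" "?S N - ?S M"] by simp
      also have "cmod (?S N - ?S M) \<le> exp (pi * cmod z) * (5 * a 1 / Suc M)"
        using False M cardinal_tail [of z "Suc M" "Suc N"] by (subst cardinal_partial_sum_diff) auto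
      also have "\<dots> \<le> exp (pi * cmod z) * (5 * a 1)"
        using nonneg [of 1] by (intro mult_left_mono) (auto simp: divide_le_eq mult_le_cancel_left1)
      finally show ?thesis using first [of M] by simp
    qed
    also have "\<dots> = a 1 * ((B * real M + 5) * exp (pi * cmod z))" by (simp add: algebra_simps)
    also have "\<dots> \<le> a 1 * ((2 * B + 5) * (1 + cmod z) * exp (pi * cmod z))"
    proof (intro mult_left_mono mult_right_mono)
      have "B * real M \<le> B * (2 * cmod z + 1)" using M B by (intro mult_left_mono) auto
      then show "B * real M + 5 \<le> (2 * B + 5) * (1 + cmod z)"
        using B by (simp add: algebra_simps) (smt (verit) mult_nonneg_nonneg norm_ge_zero)
    qed (use nonneg in auto)
    finally show ?thesis .
  qed
  then show ?thesis using B(1) by (intro exI [of _ "2 * B + 5"]) auto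
qed

section \<open>Functions of exponential type\<close>

lemma exp_type_leI:
  assumes "K holomorphic_on UNIV" "0 \<le> B" "\<And>z. cmod (K z) \<le> B * (1 + cmod z) * exp (\<sigma> * cmod z)"
  shows "exp_type_le \<sigma> K"
  unfolding exp_type_le_def
proof (intro conjI allI impI)
  fix \<epsilon> :: real assume \<epsilon>: "0 < \<epsilon>"
  show "\<exists>C>0. \<forall>z. cmod (K z) \<le> C * exp ((\<sigma> + \<epsilon>) * cmod z)"
  proof (intro exI [of _ "(B + 1) * (1 + 1 / \<epsilon>)"] conjI allI)
    show "0 < (B + 1) * (1 + 1 / \<epsilon>)" using assms(2) \<epsilon> by (intro mult_pos_pos add_nonneg_pos add_pos_pos) auto
    fix z
    \<comment> \<open>The linear factor is absorbed by the additional exp(\<epsilon> |z|) that the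
      notion of type grants.\<close>
    have "1 + cmod z \<le> (1 + 1 / \<epsilon>) * (1 + \<epsilon> * cmod z)"
      using \<epsilon> by (simp add: algebra_simps)
    also have "\<dots> \<le> (1 + 1 / \<epsilon>) * exp (\<epsilon> * cmod z)"
      using \<epsilon> by (intro mult_left_mono exp_ge_add_one_self) auto
    finally have "B * (1 + cmod z) \<le> (B + 1) * ((1 + 1 / \<epsilon>) * exp (\<epsilon> * cmod z))"
      using assms(2) by (intro mult_mono) auto
    then have "B * (1 + cmod z) * exp (\<sigma> * cmod z) \<le> (B + 1) * ((1 + 1 / \<epsilon>) * exp (\<epsilon> * cmod z)) * exp (\<sigma> * cmod z)"
      by (rule mult_right_mono) simp
    also have "\<dots> = (B + 1) * (1 + 1 / \<epsilon>) * exp ((\<sigma> + \<epsilon>) * cmod z)"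
      by (simp add: mult.assoc exp_add [symmetric] algebra_simps)
    finally show "cmod (K z) \<le> (B + 1) * (1 + 1 / \<epsilon>) * exp ((\<sigma> + \<epsilon>) * cmod z)"
      using assms(3) [of z] by linarith
  qed
qed (rule assms(1))

lemma exp_type_le_add:
  assumes "exp_type_le \<sigma> F" "exp_type_le \<sigma> G"
  shows "exp_type_le \<sigma> (\<lambda>z. F z + G z)"
  unfolding exp_type_le_def
proof (intro conjI allI impI)
  fix \<epsilon> :: real assume \<epsilon>: "0 < \<epsilon>"
  from assms \<epsilon> obtain C D where C: "0 < C" "\<And>z. cmod (F z) \<le> C * exp ((\<sigma> + \<epsilon>) * cmod z)"
    and D: "0 < D" "\<And>z. cmod (G z) \<le> D * exp ((\<sigma> + \<epsilon>) * cmod z)"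
    unfolding exp_type_le_def by meson
  then show "\<exists>C>0. \<forall>z. cmod (F z + G z) \<le> C * exp ((\<sigma> + \<epsilon>) * cmod z)"
    by (intro exI [of _ "C + D"] conjI allI order.trans [OF norm_triangle_ineq])
      (auto simp: distrib_right intro!: add_mono)
next
  show "(\<lambda>z. F z + G z) holomorphic_on UNIV"
    using assms unfolding exp_type_le_def by (intro holomorphic_on_add) auto
qed

lemma exp_type_le_cmult:
  assumes "exp_type_le \<sigma> F"
  shows "exp_type_le \<sigma> (\<lambda>z. c * F z)"
  unfolding exp_type_le_def
proof (intro conjI allI impI)
  fix \<epsilon> :: real assume \<epsilon>: "0 < \<epsilon>"
  from assms \<epsilon> obtain C where C: "0 < C" "\<And>z. cmod (F z) \<le> C * exp ((\<sigma> + \<epsilon>) * cmod z)"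
    unfolding exp_type_le_def by meson
  have "cmod (c * F z) \<le> (cmod c + 1) * C * exp ((\<sigma> + \<epsilon>) * cmod z)" for z
    unfolding norm_mult mult.assoc using C by (intro mult_mono) auto
  then show "\<exists>C>0. \<forall>z. cmod (c * F z) \<le> C * exp ((\<sigma> + \<epsilon>) * cmod z)"
    using C by (intro exI [of _ "(cmod c + 1) * C"]) (auto intro!: mult_pos_pos add_nonneg_pos)
next
  show "(\<lambda>z. c * F z) holomorphic_on UNIV"
    using assms unfolding exp_type_le_def by (intro holomorphic_on_mult holomorphic_on_const) auto
qed

lemma exp_type_le_csinc_shift: "exp_type_le pi (\<lambda>z. csinc (z - a))"
proof -
  obtain B where B: "1 \<le> B" "\<And>z n. cmod (csinc (z - of_nat n)) \<le> B * exp (pi * cmod z)"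
    using csinc_bound by blast
  show ?thesis
  proof (rule exp_type_leI [OF holomorphic_csinc_shift])
    fix z
    have "cmod (csinc (z - a)) \<le> B * exp (pi * cmod (z - a))" using B(2) [of "z - a" 0] by simp
    also have "\<dots> \<le> B * exp (pi * (cmod z + cmod a))"
      using B(1) norm_triangle_ineq4 [of z a] by (intro mult_left_mono) auto
    also have "\<dots> = B * exp (pi * cmod a) * 1 * exp (pi * cmod z)" by (simp add: distrib_left exp_add)
    also have "\<dots> \<le> B * exp (pi * cmod a) * (1 + cmod z) * exp (pi * cmod z)"
      using B(1) by (intro mult_right_mono mult_left_mono) auto
    finally show "cmod (csinc (z - a)) \<le> B * exp (pi * cmod a) * (1 + cmod z) * exp (pi * cmod z)" .
  qed (use B in auto)
qed

lemma exp_type_le_csinc: "exp_type_le pi csinc"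
  using exp_type_le_csinc_shift [of 0] by simp

lemma exp_type_le_cardinal_series:
  assumes "decreasing_sequence a"
  shows "exp_type_le pi (cardinal_series a)"
proof -
  interpret decreasing_sequence a by fact
  obtain B where B: "0 < B" "\<And>a z N. decreasing_sequence a \<Longrightarrow>
       cmod (\<Sum>n<N. of_real (a (Suc n)) * csinc (z - of_nat (Suc n))) \<le> a 1 * (B * (1 + cmod z) * exp (pi * cmod z))"
    using cardinal_partial_sum_bound by blast
  show ?thesis
  proof (rule exp_type_leI [OF holomorphic_cardinal_series])
    fix z
    have "(\<lambda>N. cmod (\<Sum>n<N. of_real (a (Suc n)) * csinc (z - of_nat (Suc n)))) \<longlonglongrightarrow> cmod (cardinal_series a z)"
      using cardinal_sums [of z] unfolding sums_def by (rule tendsto_norm)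
    then have "cmod (cardinal_series a z) \<le> a 1 * (B * (1 + cmod z) * exp (pi * cmod z))"
      by (rule LIMSEQ_le_const2) (use B(2) [OF assms] in auto)
    then show "cmod (cardinal_series a z) \<le> a 1 * B * (1 + cmod z) * exp (pi * cmod z)"
      by (simp add: mult_ac)
  qed (use B nonneg [of 1] in auto)
qed

section \<open>Partial theta functions\<close>

text \<open>With n^k bounded by 2^(k n), the n-th term is at most the n-th power of a quantity that
  tends to 0.\<close>

lemma summable_power_square:
  fixes q y :: real
  assumes "0 \<le> q" "q < 1"
  shows "summable (\<lambda>n. real n ^ k * q ^ (n\<^sup>2) * y ^ n)"
proof -
  have "(\<lambda>n. q ^ n * (2 ^ k * \<bar>y\<bar>)) \<longlonglongrightarrow> 0"
    using assms by (intro tendsto_mult_left_zero LIMSEQ_power_zero) auto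
  then have "eventually (\<lambda>n. q ^ n * (2 ^ k * \<bar>y\<bar>) < 1 / 2) sequentially"
    by (rule order_tendstoD) simp
  then have "eventually (\<lambda>n. norm (real n ^ k * q ^ (n\<^sup>2) * y ^ n) \<le> (1 / 2) ^ n) sequentially"
  proof eventually_elim
    case (elim n)
    have "real n ^ k \<le> (2 ^ n) ^ k"
      by (intro power_mono) (auto intro: less_imp_le)
    also have "\<dots> = (2 ^ k) ^ n"
      by (simp add: power_mult [symmetric] mult.commute)
    finally have "real n ^ k * q ^ (n\<^sup>2) * \<bar>y\<bar> ^ n \<le> (2 ^ k) ^ n * q ^ (n\<^sup>2) * \<bar>y\<bar> ^ n"
      using assms by (intro mult_right_mono) auto
    also have "\<dots> = (q ^ n * (2 ^ k * \<bar>y\<bar>)) ^ n"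
      by (simp add: power_mult_distrib power2_eq_square power_mult [symmetric])
    also have "\<dots> \<le> (1 / 2) ^ n"
      using elim assms by (intro power_mono) auto
    finally show ?case
      using assms by (simp add: abs_mult power_abs)
  qed
  then show ?thesis
    by (rule summable_comparison_test_ev) (simp add: summable_geometric)
qed

definition ptheta :: "real \<Rightarrow> real \<Rightarrow> real" where
  "ptheta q u = (\<Sum>n. (-1) ^ n * q ^ (n\<^sup>2) * u ^ n)"

text \<open>Minus the derivative of \<open>ptheta q\<close>, written as a power series so that its
  value at u = 1 is itself one of the alternating sums whose sign is wanted.\<close>

definition ptheta_slope :: "real \<Rightarrow> real \<Rightarrow> real" where
  "ptheta_slope q u = (\<Sum>n. (-1) ^ n * real (Suc n) * q ^ ((Suc n)\<^sup>2) * u ^ n)"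

lemma summable_ptheta:
  assumes "0 \<le> q" "q < 1"
  shows "summable (\<lambda>n. (-1) ^ n * q ^ (n\<^sup>2) * (u::real) ^ n)"
  using summable_power_square [OF assms, of 0 "-u"]
  by (simp add: power_minus' [of u] mult_ac power_minus [of u])

lemma DERIV_ptheta:
  assumes "0 \<le> q" "q < 1"
  shows "(ptheta q has_real_derivative - ptheta_slope q u) (at u)"
proof -
  have "((\<lambda>u. \<Sum>n. ((-1) ^ n * q ^ (n\<^sup>2)) * u ^ n) has_real_derivative
     (\<Sum>n. diffs (\<lambda>n. (-1) ^ n * q ^ (n\<^sup>2)) n * u ^ n)) (at u)"
    by (rule termdiffs_strong_converges_everywhere) (rule summable_ptheta [OF assms])
  moreover have "(\<Sum>n. diffs (\<lambda>n. (-1) ^ n * q ^ (n\<^sup>2)) n * u ^ n) = - ptheta_slope q u"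
  proof -
    have s: "summable (\<lambda>n. diffs (\<lambda>n. (-1) ^ n * q ^ (n\<^sup>2)) n * u ^ n)"
      by (rule termdiff_converges_all) (rule summable_ptheta [OF assms])
    have "ptheta_slope q u = (\<Sum>n. - (diffs (\<lambda>n. (-1) ^ n * q ^ (n\<^sup>2)) n * u ^ n))"
      unfolding ptheta_slope_def by (intro suminf_cong) (simp add: diffs_def mult_ac)
    then show ?thesis
      using suminf_minus [OF s] by simp
  qed
  ultimately show ?thesis
    by (simp add: ptheta_def [abs_def])
qed

lemma continuous_ptheta_slope:
  assumes "0 \<le> q" "q < 1"
  shows "isCont (ptheta_slope q) u"
proof -
  have "summable (\<lambda>n. ((-1) ^ n * real (Suc n) * q ^ ((Suc n)\<^sup>2)) * y ^ n)" for y :: real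
  proof -
    have "summable (\<lambda>n. diffs (\<lambda>n. (-1) ^ n * q ^ (n\<^sup>2)) n * y ^ n)"
      by (rule termdiff_converges_all) (rule summable_ptheta [OF assms])
    then have "summable (\<lambda>n. - (diffs (\<lambda>n. (-1) ^ n * q ^ (n\<^sup>2)) n * y ^ n))"
      by (rule summable_minus)
    then show ?thesis
      by (rule summable_cong [THEN iffD1, rotated]) (simp add: diffs_def mult_ac)
  qed
  from isCont_powser_converges_everywhere [OF this]
  show ?thesis by (simp add: ptheta_slope_def [abs_def])
qed

text \<open>The term n = 0 is split off and (n + 1)^2 = n^2 + 2 n + 1 is used. The new argument q^2
  u is smaller than u, which is what an argument at the first zero can exploit.\<close>

lemma ptheta_recurrence:
  assumes "0 \<le> q" "q < 1"
  shows "ptheta q u = 1 - q * u * ptheta q (q\<^sup>2 * u)"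
proof -
  have "ptheta q u = (\<Sum>n. (-1) ^ Suc n * q ^ ((Suc n)\<^sup>2) * u ^ Suc n) + 1"
    using suminf_split_head [OF summable_ptheta [OF assms, of u]] by (simp add: ptheta_def)
  also have "(\<Sum>n. (-1) ^ Suc n * q ^ ((Suc n)\<^sup>2) * u ^ Suc n) =
      (\<Sum>n. (- (q * u)) * ((-1) ^ n * q ^ (n\<^sup>2) * (q\<^sup>2 * u) ^ n))"
    by (intro suminf_cong)
      (simp add: power2_eq_square power_add power_mult_distrib mult_ac flip: power_mult)
  also have "\<dots> = - (q * u) * ptheta q (q\<^sup>2 * u)"
    unfolding ptheta_def by (rule suminf_mult [OF summable_ptheta [OF assms]])
  finally show ?thesis by simp
qed

lemma ptheta_slope_recurrence:
  assumes "0 \<le> q" "q < 1"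
  shows "ptheta_slope q u = q * ptheta q (q\<^sup>2 * u) - q * (q\<^sup>2 * u) * ptheta_slope q (q\<^sup>2 * u)"
proof -
  have "((\<lambda>u. 1 - q * u * ptheta q (q\<^sup>2 * u)) has_real_derivative
      - (q * ptheta q (q\<^sup>2 * u) - q * (q\<^sup>2 * u) * ptheta_slope q (q\<^sup>2 * u))) (at u)"
  proof -
    have "((\<lambda>u. ptheta q (q\<^sup>2 * u)) has_real_derivative - ptheta_slope q (q\<^sup>2 * u) * q\<^sup>2) (at u)"
      by (rule DERIV_chain2 [OF DERIV_ptheta [OF assms]]) (auto intro!: derivative_eq_intros)
    from DERIV_diff [OF DERIV_const [of 1] DERIV_mult [OF DERIV_cmult [OF DERIV_ident, of q] this]]
    show ?thesis by (simp add: algebra_simps)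
  qed
  moreover have "(\<lambda>u. 1 - q * u * ptheta q (q\<^sup>2 * u)) = ptheta q"
    by (rule ext) (rule ptheta_recurrence [OF assms, symmetric])
  ultimately have "((ptheta q) has_real_derivative
      - (q * ptheta q (q\<^sup>2 * u) - q * (q\<^sup>2 * u) * ptheta_slope q (q\<^sup>2 * u))) (at u)"
    by simp
  from DERIV_unique [OF this DERIV_ptheta [OF assms]] show ?thesis by simp
qed

text \<open>At the first point \<open>x\<close> where the slope vanishes, the recurrences give
  \<open>ptheta q (q\<^sup>2 x) \<le> 1/2\<close> and hence \<open>ptheta q x > 1/2\<close>, although the function was decreasing up to \<open>x\<close>.\<close>

lemma ptheta_slope_pos:
  assumes q: "0 < q" "q < 1" and u: "0 \<le> u" "u \<le> 1"
  shows "0 < ptheta_slope q u"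
proof (rule ccontr)
  assume neg: "\<not> ?thesis"
  have q': "0 \<le> q" using q by simp
  define B where "B = {x \<in> {0..1}. ptheta_slope q x \<le> 0}"
  have cont: "continuous_on {0..1} (ptheta_slope q)"
    using continuous_ptheta_slope [OF q' q(2)] by (simp add: continuous_at_imp_continuous_on)
  have "closed B"
    unfolding B_def
    using continuous_on_closed_Collect_le [OF cont continuous_on_const closed_atLeastAtMost] .
  moreover have "B \<subseteq> {0..1}" unfolding B_def by (rule Collect_restrict)
  then have "bounded B" by (rule bounded_subset [OF compact_imp_bounded [OF compact_Icc]])
  ultimately have "compact B" by (simp add: compact_eq_bounded_closed)
  moreover have "B \<noteq> {}" using neg u by (auto simp: B_def not_less)
  ultimately obtain x where x: "x \<in> B" "\<And>y. y \<in> B \<Longrightarrow> x \<le> y"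
    using compact_attains_inf [of B] by metis
  then have x01: "0 \<le> x" "x \<le> 1" and Dx: "ptheta_slope q x \<le> 0" by (auto simp: B_def)
  have pos: "0 < ptheta_slope q y" if "0 \<le> y" "y < x" for y
    using that x(2) [of y] x01 by (auto simp: B_def not_le [symmetric])
  have "ptheta_slope q 0 = q * ptheta q 0"
    using ptheta_slope_recurrence [OF q' q(2), of 0] by simp
  moreover have "ptheta q 0 = 1"
    using ptheta_recurrence [OF q' q(2), of 0] by simp
  ultimately have "x \<noteq> 0" using Dx q by auto
  with x01 have "0 < x" by simp
  define X where "X = q\<^sup>2 * x"
  define Y where "Y = q\<^sup>2 * X"
  have q2: "q\<^sup>2 < 1" "0 < q\<^sup>2" using q by (auto simp: power_less_one_iff)
  have X: "0 < X" "X < x" using q2 \<open>0 < x\<close> by (auto simp: X_def)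
  have Y: "0 < Y" "Y < x" using q2 X mult_strict_right_mono [OF q2(1) X(1)] unfolding Y_def by (simp, linarith)
  have "ptheta_slope q x = q * ptheta q X - q * X * ptheta_slope q X"
    using ptheta_slope_recurrence [OF q' q(2), of x] by (simp add: X_def)
  \<comment> \<open>Second use of both recurrences: \<open>q * X * ptheta q Y\<close> is traded for
    \<open>1 - ptheta q X\<close>, so the only slope left is taken at Y < x, where it is
    positive.\<close>
  also have "\<dots> = q * (2 * ptheta q X - 1 + q * X * Y * ptheta_slope q Y)"
    by (simp only: ptheta_slope_recurrence [OF q' q(2), of X, folded Y_def]
        ptheta_recurrence [OF q' q(2), of X, folded Y_def]) (simp add: algebra_simps)
  finally have "2 * ptheta q X - 1 + q * X * Y * ptheta_slope q Y \<le> 0"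
    using Dx q by (simp add: mult_le_0_iff)
  moreover have "0 \<le> q * X * Y * ptheta_slope q Y"
    using pos [of Y] X Y q by (intro mult_nonneg_nonneg) auto
  ultimately have half: "ptheta q X \<le> 1 / 2" by linarith
  have "q * x * ptheta q X \<le> q * x * (1 / 2)"
    using half q \<open>0 < x\<close> by (intro mult_left_mono) auto
  also have "\<dots> < 1 / 2"
  proof -
    have "q * x \<le> q" using q x01 by (simp add: mult_left_le)
    then show ?thesis using q by linarith
  qed
  finally have "1 / 2 < ptheta q x"
    using ptheta_recurrence [OF q' q(2), of x] by (simp add: X_def)
  moreover have "ptheta q x \<le> ptheta q X"
  proof (rule DERIV_nonpos_imp_decreasing_open [of X x])
    fix y assume "X < y" "y < x"
    then show "\<exists>d. (ptheta q has_real_derivative d) (at y) \<and> d \<le> 0"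
      using DERIV_ptheta [OF q' q(2), of y] pos [of y] X by (intro exI conjI) (assumption, simp)
  next
    show "continuous_on {X..x} (ptheta q)"
      by (intro continuous_at_imp_continuous_on ballI DERIV_isCont [OF DERIV_ptheta [OF q' q(2)]])
  qed (use X in simp)
  ultimately show False using half by linarith
qed

lemma summable_ptheta_slope:
  assumes "0 \<le> q" "q < 1"
  shows "summable (\<lambda>n. (-1) ^ n * real (Suc n) * q ^ ((Suc n)\<^sup>2) * (u::real) ^ n)"
proof -
  have "summable (\<lambda>n. diffs (\<lambda>n. (-1) ^ n * q ^ (n\<^sup>2)) n * u ^ n)"
    by (rule termdiff_converges_all) (rule summable_ptheta [OF assms])
  then have "summable (\<lambda>n. - (diffs (\<lambda>n. (-1) ^ n * q ^ (n\<^sup>2)) n * u ^ n))"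
    by (rule summable_minus)
  then show ?thesis
    by (rule summable_cong [THEN iffD1, rotated]) (simp add: diffs_def mult_ac)
qed

section \<open>Gaussian series and theta null values\<close>

lemma exp_neg_mult_square: "exp (- (c * (real n)\<^sup>2)) = exp (- c) ^ (n\<^sup>2)"
  by (simp add: exp_of_nat_mult [symmetric] mult.commute)

lemma summable_gauss:
  fixes c y :: real
  assumes "0 < c"
  shows "summable (\<lambda>n. real n ^ k * exp (- (c * (real n)\<^sup>2)) * y ^ n)"
  unfolding exp_neg_mult_square by (rule summable_power_square) (use assms in auto)

lemma summable_gauss_Suc:
  fixes c :: real
  assumes "0 < c"
  shows "summable (\<lambda>n. real (Suc n) ^ k * exp (- (c * (real (Suc n))\<^sup>2)))"
  using summable_gauss [OF assms, of k 1] by (subst summable_Suc_iff) simp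

text \<open>The integers are split by the reflection n -> -1 - n. For the half-integer squares of
  \<open>theta1\<close> the two halves then agree term by term; for ordinary squares they agree
  after a shift by one.\<close>

lemma has_sum_int_split:
  fixes f :: "int \<Rightarrow> 'a::banach"
  assumes "summable (\<lambda>n. norm (f (int n)))" "summable (\<lambda>n. norm (f (- 1 - int n)))"
  shows "(f has_sum ((\<Sum>n. f (int n)) + (\<Sum>n. f (- 1 - int n)))) UNIV"
proof -
  have "((f \<circ> int) has_sum (\<Sum>n. f (int n))) UNIV"
    using norm_summable_imp_has_sum [OF assms(1) summable_sums] summable_norm_cancel [OF assms(1)]
    by (simp add: o_def)
  then have 1: "(f has_sum (\<Sum>n. f (int n))) (range int)"
    by (subst has_sum_reindex) auto
  have inj: "inj (\<lambda>n. - 1 - int n)" by (auto simp: inj_def)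
  have "((f \<circ> (\<lambda>n. - 1 - int n)) has_sum (\<Sum>n. f (- 1 - int n))) UNIV"
    using norm_summable_imp_has_sum [OF assms(2) summable_sums] summable_norm_cancel [OF assms(2)]
    by (simp add: o_def)
  then have 2: "(f has_sum (\<Sum>n. f (- 1 - int n))) (range (\<lambda>n. - 1 - int n))"
    by (subst has_sum_reindex [OF inj])
  have "range int \<inter> range (\<lambda>n. - 1 - int n) = {}" by auto
  moreover have "range int \<union> range (\<lambda>n. - 1 - int n) = UNIV"
  proof -
    have "x \<in> range int \<union> range (\<lambda>n. - 1 - int n)" for x :: int
    proof (cases "0 \<le> x")
      case True
      then have "x = int (nat x)" by simp
      then show ?thesis by blast
    next
      case False
      then have "x = - 1 - int (nat (- 1 - x))" by simp
      then show ?thesis by blast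
    qed
    then show ?thesis by blast
  qed
  ultimately show ?thesis
    using has_sum_Un_disjoint [OF 1 2] by simp
qed

definition alt_sign :: "int \<Rightarrow> real" where
  "alt_sign n = (if even n then 1 else - 1)"

text \<open>The null values of Jacobi's theta_3 and, next, theta_4 at the nome exp(-c). They are
  sums over all integers so that substitutions of the lattice can be applied.\<close>

definition theta3_null :: "real \<Rightarrow> real" where
  "theta3_null c = (\<Sum>\<^sub>\<infinity>n::int. exp (- (c * (of_int n)\<^sup>2)))"

definition theta4_null :: "real \<Rightarrow> real" where
  "theta4_null c = (\<Sum>\<^sub>\<infinity>n::int. alt_sign n * exp (- (c * (of_int n)\<^sup>2)))"

lemma abs_alt_sign [simp]: "\<bar>alt_sign n\<bar> = 1"
  by (simp add: alt_sign_def)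

lemma alt_sign_diff: "alt_sign (a - b) = alt_sign a * alt_sign b"
  by (auto simp: alt_sign_def)

lemma alt_sign_of_nat: "alt_sign (int n) = (- 1) ^ n"
  by (auto simp: alt_sign_def)

lemma theta4_has_sum:
  assumes "0 < c"
  shows "((\<lambda>n::int. alt_sign n * exp (- (c * (of_int n)\<^sup>2))) has_sum
    (1 - 2 * (\<Sum>n. (- 1) ^ n * exp (- (c * (real (Suc n))\<^sup>2))))) UNIV"
proof -
  define f where "f = (\<lambda>n::int. alt_sign n * exp (- (c * (of_int n)\<^sup>2)))"
  have s: "summable (\<lambda>n. exp (- (c * (real n)\<^sup>2)))"
    using summable_gauss [OF assms, of 0 1] by simp
  have s1: "summable (\<lambda>n. norm (f (int n)))"
    using s by (simp add: f_def abs_mult)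
  have neg: "f (- 1 - int n) = f (int (Suc n))" for n
    by (auto simp: f_def alt_sign_def power2_eq_square algebra_simps)
  have s2: "summable (\<lambda>n. norm (f (- 1 - int n)))"
    unfolding neg using s1 by (subst summable_Suc_iff)
  have "summable (\<lambda>n. (- 1) ^ n * exp (- (c * (real (Suc n))\<^sup>2)))"
    by (rule summable_norm_cancel) (use summable_gauss_Suc [OF assms, of 0] in \<open>simp add: abs_mult\<close>)
  then have m: "(\<Sum>n. f (int (Suc n))) = - (\<Sum>n. (- 1) ^ n * exp (- (c * (real (Suc n))\<^sup>2)))"
    by (subst suminf_minus [symmetric])
      (auto simp: f_def alt_sign_of_nat [of "Suc n" for n, simplified] intro!: suminf_cong)
  have "(\<Sum>n. f (int n)) = (\<Sum>n. f (int (Suc n))) + f 0"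
    using suminf_split_head [OF summable_norm_cancel [OF s1]] by simp
  also have "f 0 = 1" by (simp add: f_def alt_sign_def)
  finally have "(\<Sum>n. f (int n)) + (\<Sum>n. f (- 1 - int n)) =
      1 - 2 * (\<Sum>n. (- 1) ^ n * exp (- (c * (real (Suc n))\<^sup>2)))"
    unfolding neg m by simp
  with has_sum_int_split [OF s1 s2] show ?thesis by (simp add: f_def)
qed

lemma theta4_eq:
  "0 < c \<Longrightarrow> theta4_null c = 1 - 2 * (\<Sum>n. (- 1) ^ n * exp (- (c * (real (Suc n))\<^sup>2)))"
  unfolding theta4_null_def by (rule infsumI [OF theta4_has_sum])

lemma theta3_summable:
  assumes "0 < c"
  shows "(\<lambda>n::int. exp (- (c * (real_of_int n)\<^sup>2))) summable_on UNIV"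
proof -
  define f where "f = (\<lambda>n::int. exp (- (c * (real_of_int n)\<^sup>2)))"
  have s: "summable (\<lambda>n. exp (- (c * (real n)\<^sup>2)))"
    using summable_gauss [OF assms, of 0 1] by simp
  have s1: "summable (\<lambda>n. norm (f (int n)))"
    using s by (simp add: f_def)
  have neg: "f (- 1 - int n) = f (int (Suc n))" for n
    by (auto simp: f_def power2_eq_square algebra_simps)
  have s2: "summable (\<lambda>n. norm (f (- 1 - int n)))"
    unfolding neg using s1 by (subst summable_Suc_iff)
  show ?thesis
    using has_sum_int_split [OF s1 s2] unfolding f_def by (rule has_sum_imp_summable)
qed

text \<open>Rotating the lattice by \<open>(a, b) \<mapsto> (a + b, a - b)\<close> picks out the pairs of equal parity; the
  remaining pairs cancel under the swap.\<close>

lemma theta_doubling: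
  assumes c: "0 < c"
  shows "theta3_null c * theta4_null c = (theta4_null (2 * c))\<^sup>2"
proof -
  define e where "e = (\<lambda>c (n::int). exp (- (c * (real_of_int n)\<^sup>2)))"
  have se: "e d summable_on UNIV" if "0 < d" for d
    unfolding e_def by (rule theta3_summable [OF that])
  have dom: "(\<lambda>(m, n). e d m * e d n) summable_on UNIV" if d: "0 < d" for d
  proof -
    have "(\<lambda>(m, n). e d m * e d n) summable_on (Sigma UNIV (\<lambda>_. UNIV))"
    proof (rule summable_on_SigmaI)
      show "((\<lambda>y. case (x, y) of (m, n) \<Rightarrow> e d m * e d n) has_sum (e d x * infsum (e d) UNIV)) UNIV" for x
        using has_sum_cmult_right [OF has_sum_infsum [OF se [OF d]]] by simp
      show "(\<lambda>x. e d x * infsum (e d) UNIV) summable_on UNIV"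
        by (rule summable_on_cmult_left [OF se [OF d]])
    qed (simp add: e_def)
    then show ?thesis by simp
  qed
  have prod: "(\<lambda>(m, n). f m * g n) summable_on (UNIV :: (int \<times> int) set)"
    "infsum (\<lambda>(m, n). f m * g n) (UNIV :: (int \<times> int) set) = infsum f UNIV * infsum g UNIV"
    if d: "0 < d" and fg: "\<And>n. \<bar>f n\<bar> = e d n" "\<And>n. \<bar>g n\<bar> = e d n" for d and f g :: "int \<Rightarrow> real"
  proof -
    have "(\<lambda>p. norm (case p of (m, n) \<Rightarrow> f m * g n)) summable_on (UNIV :: (int \<times> int) set)"
      using dom [OF d] by (simp add: case_prod_unfold abs_mult fg)
    then show s: "(\<lambda>(m, n). f m * g n) summable_on (UNIV :: (int \<times> int) set)"
      by (rule abs_summable_summable)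
    then have "infsum (\<lambda>(m, n). f m * g n) (UNIV :: (int \<times> int) set)
      = infsum (\<lambda>x. infsum (\<lambda>y. f x * g y) UNIV) UNIV"
      using infsum_Sigma_banach [of "\<lambda>(m, n). f m * g n" UNIV "\<lambda>_. UNIV"] by simp
    also have "\<dots> = infsum f UNIV * infsum g UNIV"
      by (simp add: infsum_cmult_right' infsum_cmult_left')
    finally show "infsum (\<lambda>(m, n). f m * g n) (UNIV :: (int \<times> int) set) = infsum f UNIV * infsum g UNIV" .
  qed
  define F where "F = (\<lambda>(m, n). e c m * (alt_sign n * e c n))"
  define E where "E = {(m::int, n). even (m + n)}"
  define D where "D = {(m::int, n). odd (m + n)}"
  have F: "F summable_on UNIV" "infsum F UNIV = theta3_null c * theta4_null c"
    using prod [OF c, of "e c" "\<lambda>n. alt_sign n * e c n"]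
    by (auto simp: F_def theta3_null_def theta4_null_def abs_mult e_def)
  have "infsum F D = infsum (\<lambda>p. F (prod.swap p)) D"
    by (rule infsum_reindex_bij_witness [of D prod.swap prod.swap]) (auto simp: D_def add.commute)
  also have "\<dots> = infsum (\<lambda>p. - F p) D"
    by (intro infsum_cong) (auto simp: D_def F_def alt_sign_def)
  finally have D0: "infsum F D = 0" by (simp add: infsum_uminus)
  have "infsum F E = infsum (\<lambda>(a, b). (alt_sign a * e (2 * c) a) * (alt_sign b * e (2 * c) b)) UNIV"
  proof (rule infsum_reindex_bij_witness [where i = "\<lambda>(a, b). (a + b, a - b)"
        and j = "\<lambda>(m, n). ((m + n) div 2, (m - n) div 2)"])
    fix p assume "p \<in> E"
    then obtain m n where p: "p = (m, n)" and ev: "even (m + n)" by (auto simp: E_def)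
    obtain s where s: "m + n = 2 * s" using ev by (rule evenE)
    then have m: "m = 2 * s - n" by simp
    show "(\<lambda>(a, b). (a + b, a - b)) ((\<lambda>(m, n). ((m + n) div 2, (m - n) div 2)) p) = p"
      by (simp add: p m)
    have "alt_sign n = alt_sign s * alt_sign (s - n)"
      by (simp add: alt_sign_diff [symmetric])
    \<comment> \<open>Parallelogram law: (2 s - n)^2 + n^2 = 2 s^2 + 2 (s - n)^2. This doubles the
      parameter.\<close>
    moreover have "e c (2 * s - n) * e c n = e (2 * c) s * e (2 * c) (s - n)"
      by (simp add: e_def exp_add [symmetric] power2_eq_square algebra_simps)
    ultimately show "(case (\<lambda>(m, n). ((m + n) div 2, (m - n) div 2)) p of
        (a, b) \<Rightarrow> (alt_sign a * e (2 * c) a) * (alt_sign b * e (2 * c) b)) = F p"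
      by (simp add: p m F_def)
  qed (auto simp: E_def)
  also have "\<dots> = (theta4_null (2 * c))\<^sup>2"
    using prod(2) [of "2 * c" "\<lambda>n. alt_sign n * e (2 * c) n" "\<lambda>n. alt_sign n * e (2 * c) n"] c
    by (simp add: theta4_null_def abs_mult e_def power2_eq_square)
  finally have E0: "infsum F E = (theta4_null (2 * c))\<^sup>2" .
  have "infsum F (E \<union> D) = infsum F E + infsum F D"
    by (intro infsum_Un_disjoint summable_on_subset_banach [OF F(1)]) (auto simp: E_def D_def)
  moreover have "E \<union> D = UNIV" by (auto simp: E_def D_def)
  ultimately show ?thesis using F(2) D0 E0 by simp
qed

lemma theta3_antimono:
  assumes "0 < c" "c \<le> d"
  shows "theta3_null d \<le> theta3_null c"
  unfolding theta3_null_def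
  by (intro infsum_mono theta3_summable) (use assms in \<open>auto intro: mult_right_mono\<close>)

text \<open>Keeping the 2 N + 1 central terms is enough to see that \<open>theta3_null\<close> blows
  up as c tends to 0; N = 0 gives positivity.\<close>

lemma theta3_ge:
  assumes "0 < c"
  shows "real (2 * N + 1) * exp (- (c * (real N)\<^sup>2)) \<le> theta3_null c"
proof -
  have "real (2 * N + 1) * exp (- (c * (real N)\<^sup>2)) = (\<Sum>n\<in>{- int N..int N}. exp (- (c * (real N)\<^sup>2)))"
    by simp
  also have "\<dots> \<le> (\<Sum>n\<in>{- int N..int N}. exp (- (c * (real_of_int n)\<^sup>2)))"
  proof (rule sum_mono)
    fix n assume "n \<in> {- int N..int N}"
    then have "\<bar>real_of_int n\<bar> \<le> real N" by auto
    then have "(real_of_int n)\<^sup>2 \<le> (real N)\<^sup>2" using power_mono [of "\<bar>real_of_int n\<bar>" "real N" 2] by simp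
    then show "exp (- (c * (real N)\<^sup>2)) \<le> exp (- (c * (real_of_int n)\<^sup>2))"
      using assms by simp
  qed
  also have "\<dots> \<le> theta3_null c"
    unfolding theta3_null_def by (rule finite_sum_le_infsum [OF theta3_summable [OF assms]]) auto
  finally show ?thesis .
qed

lemma theta3_pos: "0 < c \<Longrightarrow> 0 < theta3_null c"
  using theta3_ge [of c 0] by simp

text \<open>The doubling identity read as a descent from 2 c to c. As a square over a positive
  number, \<open>theta4_null\<close> inherits sign, monotonicity and smallness from larger
  parameters and from \<open>theta3_null\<close>.\<close>

lemma theta4_halve: "0 < c \<Longrightarrow> theta4_null c = (theta4_null (2 * c))\<^sup>2 / theta3_null c"
  using theta_doubling [of c] theta3_pos [of c] by (simp add: field_simps)

lemma theta4_nonneg: "0 < c \<Longrightarrow> 0 \<le> theta4_null c"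
  using theta4_halve [of c] theta3_pos [of c] by simp

lemma alternating_gauss_bounds:
  assumes "0 < c"
  shows "0 \<le> (\<Sum>n. (- 1) ^ n * exp (- (c * (real (Suc n))\<^sup>2)))"
    and "(\<Sum>n. (- 1) ^ n * exp (- (c * (real (Suc n))\<^sup>2))) \<le> exp (- c)"
proof -
  have lim: "(\<lambda>n. exp (- (c * (real (Suc n))\<^sup>2))) \<longlonglongrightarrow> 0"
    using summable_LIMSEQ_zero [OF summable_gauss_Suc [OF assms, of 0]] by simp
  have dec: "exp (- (c * (real (Suc (Suc n)))\<^sup>2)) \<le> exp (- (c * (real (Suc n))\<^sup>2))" for n
    using assms by (simp add: power_mono)
  show "0 \<le> (\<Sum>n. (- 1) ^ n * exp (- (c * (real (Suc n))\<^sup>2)))"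
    using summable_Leibniz'(2) [OF lim _ dec, of 0] by simp
  show "(\<Sum>n. (- 1) ^ n * exp (- (c * (real (Suc n))\<^sup>2))) \<le> exp (- c)"
    using summable_Leibniz'(4) [OF lim _ dec, of 0] by simp
qed

text \<open>The termwise differences of the two alternating series decrease, so Leibniz' criterion
  gives the sign. With u = (n + 1)^2 and v = (n + 2)^2 one has v \<le> 4 u and v - u \<ge> 3, and
  the decrease reduces to exp(3 y) \<ge> 4; this is where y \<ge> 1 enters.\<close>

lemma theta4_mono_large:
  assumes "1 \<le> c" "c \<le> d"
  shows "theta4_null c \<le> theta4_null d"
proof -
  have pos: "0 < c" "0 < d" using assms by auto
  define a where "a = (\<lambda>n. exp (- (c * (real (Suc n))\<^sup>2)) - exp (- (d * (real (Suc n))\<^sup>2)))"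
  have "summable a"
    unfolding a_def using summable_gauss_Suc [OF pos(1), of 0] summable_gauss_Suc [OF pos(2), of 0]
    by (intro summable_diff) auto
  then have lim: "a \<longlonglongrightarrow> 0" by (rule summable_LIMSEQ_zero)
  have dec: "a (Suc n) \<le> a n" for n
  proof -
    define u where "u = (real (Suc n))\<^sup>2"
    define v where "v = (real (Suc (Suc n)))\<^sup>2"
    have u1: "1 \<le> u" and uv: "v \<le> 4 * u" "u + 3 \<le> v"
      by (auto simp: u_def v_def power2_eq_square algebra_simps)
    have "exp (- (d * u)) - exp (- (d * v)) \<le> exp (- (c * u)) - exp (- (c * v))"
    proof (rule DERIV_nonpos_imp_nonincreasing [of c d "\<lambda>y. exp (- (y * u)) - exp (- (y * v))"])
      fix y assume y: "c \<le> y" "y \<le> d"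
      have "v * exp (- (y * v)) \<le> u * exp (- (y * u))"
      proof -
        have "4 \<le> exp (3::real)" using exp_ge_add_one_self [of 3] by simp
        also have "\<dots> \<le> exp (y * (v - u))"
          using y assms uv mult_mono [of 1 y 3 "v - u"] by simp
        finally have "v \<le> u * exp (y * (v - u))"
          using uv(1) u1 mult_left_mono [of 4 "exp (y * (v - u))" u] by linarith
        then have "v * exp (- (y * v)) \<le> u * exp (y * (v - u)) * exp (- (y * v))"
          by (rule mult_right_mono) simp
        also have "\<dots> = u * exp (- (y * u))"
          by (simp add: mult.assoc exp_add [symmetric] algebra_simps)
        finally show ?thesis .
      qed
      then show "\<exists>D. ((\<lambda>y. exp (- (y * u)) - exp (- (y * v))) has_real_derivative D) (at y) \<and> D \<le> 0"
        by (intro exI [of _ "- (u * exp (- (y * u))) + v * exp (- (y * v))"] conjI)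
          (auto intro!: derivative_eq_intros)
    qed (rule assms)
    then show ?thesis by (simp add: a_def u_def v_def)
  qed
  have nonneg: "0 \<le> a n" for n
    using assms by (auto simp: a_def intro: mult_right_mono)
  have "0 \<le> (\<Sum>n. (- 1) ^ n * a n)"
    using summable_Leibniz'(2) [OF lim nonneg dec, of 0] by simp
  moreover have "(\<Sum>n. (- 1) ^ n * a n) = (\<Sum>n. (- 1) ^ n * exp (- (c * (real (Suc n))\<^sup>2)))
      - (\<Sum>n. (- 1) ^ n * exp (- (d * (real (Suc n))\<^sup>2)))"
  proof -
    have s: "summable (\<lambda>n. (- 1) ^ n * exp (- (x * (real (Suc n))\<^sup>2)))" if "0 < x" for x :: real
      by (rule summable_norm_cancel) (use summable_gauss_Suc [OF that, of 0] in \<open>simp add: abs_mult\<close>)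
    show ?thesis
      unfolding a_def right_diff_distrib by (rule suminf_diff [symmetric]) (use s pos in auto)
  qed
  ultimately show ?thesis using pos by (simp add: theta4_eq)
qed

text \<open>Induction on the number of doublings that bring c above 1. In the quotient of
  \<open>theta4_halve\<close> the numerator increases with c by induction and the denominator
  decreases.\<close>

lemma theta4_mono:
  assumes "0 < c" "c \<le> d"
  shows "theta4_null c \<le> theta4_null d"
proof -
  have "\<forall>c d. 1 \<le> 2 ^ k * c \<longrightarrow> c \<le> d \<longrightarrow> theta4_null c \<le> theta4_null d" for k :: nat
  proof (induction k)
    case 0
    then show ?case by (simp add: theta4_mono_large)
  next
    case (Suc k)
    show ?case
    proof (intro allI impI)
      fix c d :: real
      assume 1: "1 \<le> 2 ^ Suc k * c" and cd: "c \<le> d"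
      have "0 < c" 
      proof (rule ccontr)
        assume "\<not> 0 < c"
        then have "2 ^ Suc k * c \<le> 0" by (intro mult_nonneg_nonpos) auto
        with 1 show False by linarith
      qed
      then have "0 < d" using cd by simp
      have "theta4_null (2 * c) \<le> theta4_null (2 * d)"
        using Suc.IH 1 cd by (simp add: mult_ac)
      then have "(theta4_null (2 * c))\<^sup>2 \<le> (theta4_null (2 * d))\<^sup>2"
        using theta4_nonneg [of "2 * c"] \<open>0 < c\<close> by (intro power_mono) auto
      then show "theta4_null c \<le> theta4_null d"
        unfolding theta4_halve [OF \<open>0 < c\<close>] theta4_halve [OF \<open>0 < d\<close>]
        by (intro frac_le theta3_pos theta3_antimono) (use \<open>0 < c\<close> \<open>0 < d\<close> cd in auto)
    qed
  qed
  moreover obtain k where "1 / c < 2 ^ k"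
    using real_arch_pow [of 2 "1 / c"] by auto
  then have "1 \<le> 2 ^ k * c" using assms by (simp add: field_simps)
  ultimately show ?thesis using assms by blast
qed

lemma theta4_le_one: "0 < c \<Longrightarrow> theta4_null c \<le> 1"
  using alternating_gauss_bounds(1) [of c] by (simp add: theta4_eq)

lemma theta4_tendsto_0: "(theta4_null \<longlongrightarrow> 0) (at_right 0)"
proof (rule tendstoI)
  fix r :: real assume "0 < r"
  obtain N :: nat where N: "1 / r < N" using reals_Archimedean2 by blast
  have "N > 0" using N \<open>0 < r\<close> by (metis divide_pos_pos less_trans of_nat_0_less_iff zero_less_one)
  \<comment> \<open>For such c the Gaussian factor at N is at least 1/2, so
    \<open>theta3_null c\<close> is at least N; halving bounds \<open>theta4_null c\<close> by the
    reciprocal.\<close>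
  have "eventually (\<lambda>c. 0 < c \<and> c < 1 / (2 * (real N)\<^sup>2)) (at_right (0::real))"
    using \<open>N > 0\<close> by (intro eventually_conj eventually_at_right_less eventually_at_right_real [THEN eventually_mono])
      (auto simp: greaterThanLessThan_iff)
  then show "eventually (\<lambda>c. dist (theta4_null c) 0 < r) (at_right 0)"
  proof eventually_elim
    case (elim c)
    then have c: "0 < c" and cN: "c * (real N)\<^sup>2 < 1 / 2"
      using \<open>N > 0\<close> by (auto simp: field_simps)
    have "real N \<le> real (2 * N + 1) * (1 / 2)" by simp
    also have "\<dots> \<le> real (2 * N + 1) * exp (- (c * (real N)\<^sup>2))"
      using cN exp_ge_add_one_self [of "- (c * (real N)\<^sup>2)"] by (intro mult_left_mono) linarith+
    also have "\<dots> \<le> theta3_null c" by (rule theta3_ge [OF c])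
    finally have t3: "real N \<le> theta3_null c" .
    have "theta4_null c \<le> 1 / theta3_null c"
      unfolding theta4_halve [OF c]
      using theta4_nonneg [of "2 * c"] theta4_le_one [of "2 * c"] c theta3_pos [OF c]
      by (intro divide_right_mono) (auto simp: power_le_one)
    also have "\<dots> \<le> 1 / N" using t3 \<open>N > 0\<close> by (intro divide_left_mono) auto
    also have "\<dots> < r" using N \<open>0 < r\<close> \<open>N > 0\<close> by (simp add: field_simps)
    finally show ?case using theta4_nonneg [OF c] by simp
  qed
qed

text \<open>The value at \<open>0\<close> is the Abel sum of the divergent series.\<close>

definition alt_gauss :: "real \<Rightarrow> real" where
  "alt_gauss c = (if c = 0 then 1 / 2 else \<Sum>n. (- 1) ^ n * exp (- (c * (real (Suc n))\<^sup>2)))"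

lemma alt_gauss_theta4: "0 < c \<Longrightarrow> alt_gauss c = (1 - theta4_null c) / 2"
  by (simp add: alt_gauss_def theta4_eq)

lemma alt_gauss_nonneg: "0 \<le> c \<Longrightarrow> 0 \<le> alt_gauss c"
  using alternating_gauss_bounds(1) [of c] by (auto simp: alt_gauss_def)

lemma alt_gauss_le_half: "0 \<le> c \<Longrightarrow> alt_gauss c \<le> 1 / 2"
  using theta4_nonneg [of c] alt_gauss_theta4 [of c] by (cases "c = 0") (auto simp: alt_gauss_def)

lemma alt_gauss_le_exp: "0 \<le> c \<Longrightarrow> alt_gauss c \<le> exp (- c)"
  using alternating_gauss_bounds(2) [of c] by (auto simp: alt_gauss_def)

lemma alt_gauss_antimono: "0 < c \<Longrightarrow> c \<le> d \<Longrightarrow> alt_gauss d \<le> alt_gauss c"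
  using theta4_mono [of c d] by (simp add: alt_gauss_theta4)

lemma alt_gauss_tendsto: "(alt_gauss \<longlongrightarrow> 1 / 2) (at_right 0)"
proof -
  have "((\<lambda>c. (1 - theta4_null c) / 2) \<longlongrightarrow> (1 - 0) / 2) (at_right 0)"
    by (intro tendsto_intros theta4_tendsto_0) auto
  moreover have "eventually (\<lambda>c. (1 - theta4_null c) / 2 = alt_gauss c) (at_right 0)"
    using eventually_at_right_less [of 0] by eventually_elim (simp add: alt_gauss_theta4)
  ultimately show ?thesis by (simp add: tendsto_cong)
qed

lemma DERIV_gauss_series:
  fixes w :: "nat \<Rightarrow> real"
  assumes w: "\<And>n. \<bar>w n\<bar> \<le> W" and c: "0 < c"
  shows "((\<lambda>c. \<Sum>n. w n * exp (- (c * (real (Suc n))\<^sup>2))) has_real_derivative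
     - (\<Sum>n. w n * (real (Suc n))\<^sup>2 * exp (- (c * (real (Suc n))\<^sup>2)))) (at c)"
proof -
  \<comment> \<open>Any number in (0, c) would do: on the half-line above it one majorant serves the
    differentiated series.\<close>
  define b where "b = c / 2"
  have b: "0 < b" "b < c" using c by (auto simp: b_def)
  have W: "0 \<le> W" using w [of 0] by linarith
  have "((\<lambda>c. \<Sum>n. w n * exp (- (c * (real (Suc n))\<^sup>2))) has_real_derivative
     (\<Sum>n. - (w n * (real (Suc n))\<^sup>2 * exp (- (c * (real (Suc n))\<^sup>2))))) (at c)"
  proof (rule has_field_derivative_series'(2) [of "{b<..}"])
    fix n :: nat and x :: real
    show "((\<lambda>c. w n * exp (- (c * (real (Suc n))\<^sup>2))) has_real_derivative
        - (w n * (real (Suc n))\<^sup>2 * exp (- (x * (real (Suc n))\<^sup>2)))) (at x within {b<..})"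
      by (auto intro!: derivative_eq_intros)
  next
    have m: "summable (\<lambda>n. W * (real (Suc n) ^ 2 * exp (- (b * (real (Suc n))\<^sup>2))))"
      by (intro summable_mult summable_gauss_Suc b)
    show "uniformly_convergent_on {b<..}
       (\<lambda>n x. \<Sum>i<n. - (w i * (real (Suc i))\<^sup>2 * exp (- (x * (real (Suc i))\<^sup>2))))"
      unfolding uniformly_convergent_on_def
    proof (rule exI, rule Weierstrass_m_test [OF _ m])
      fix n and x assume "x \<in> {b<..}"
      then have "exp (- (x * (real (Suc n))\<^sup>2)) \<le> exp (- (b * (real (Suc n))\<^sup>2))"
        by (simp add: mult_right_mono)
      then show "norm (- (w n * (real (Suc n))\<^sup>2 * exp (- (x * (real (Suc n))\<^sup>2))))
          \<le> W * (real (Suc n) ^ 2 * exp (- (b * (real (Suc n))\<^sup>2)))"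
        using w [of n] W by (simp add: abs_mult mult.assoc mult_mono)
    qed
  next
    show "summable (\<lambda>n. w n * exp (- (c * (real (Suc n))\<^sup>2)))"
    proof (rule summable_comparison_test')
      show "summable (\<lambda>n. W * (real (Suc n) ^ 0 * exp (- (c * (real (Suc n))\<^sup>2))))"
        by (intro summable_mult summable_gauss_Suc c)
      show "norm (w n * exp (- (c * (real (Suc n))\<^sup>2))) \<le> W * (real (Suc n) ^ 0 * exp (- (c * (real (Suc n))\<^sup>2)))" for n
        using w [of n] by (simp add: abs_mult mult_right_mono)
    qed
  qed (use b in \<open>auto simp: interior_open\<close>)
  moreover have "summable (\<lambda>n. w n * (real (Suc n))\<^sup>2 * exp (- (c * (real (Suc n))\<^sup>2)))"
  proof (rule summable_comparison_test')
    show "summable (\<lambda>n. W * (real (Suc n) ^ 2 * exp (- (c * (real (Suc n))\<^sup>2))))"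
      by (intro summable_mult summable_gauss_Suc c)
    show "norm (w n * (real (Suc n))\<^sup>2 * exp (- (c * (real (Suc n))\<^sup>2)))
        \<le> W * (real (Suc n) ^ 2 * exp (- (c * (real (Suc n))\<^sup>2)))" for n
      using w [of n] by (simp add: abs_mult mult.assoc mult_right_mono)
  qed
  ultimately show ?thesis by (simp add: suminf_minus)
qed

text \<open>The sum is minus the derivative of \<open>alt_gauss\<close>, hence half the derivative
  of \<open>theta4_null\<close>, and \<open>alt_gauss\<close> is antitone.\<close>

lemma alternating_square_gauss_nonneg:
  assumes "0 < c"
  shows "0 \<le> (\<Sum>n. (- 1) ^ n * (real (Suc n))\<^sup>2 * exp (- (c * (real (Suc n))\<^sup>2)))"
proof -
  define S where "S = (\<lambda>c. \<Sum>n. (- 1) ^ n * exp (- (c * (real (Suc n))\<^sup>2)))"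
  have D: "(S has_real_derivative
     - (\<Sum>n. (- 1) ^ n * (real (Suc n))\<^sup>2 * exp (- (c * (real (Suc n))\<^sup>2)))) (at c)"
    unfolding S_def by (rule DERIV_gauss_series [where W = 1]) (use assms in auto)
  show ?thesis
  proof (rule ccontr)
    assume "\<not> ?thesis"
    then have "0 < - (\<Sum>n. (- 1) ^ n * (real (Suc n))\<^sup>2 * exp (- (c * (real (Suc n))\<^sup>2)))" by simp
    from DERIV_pos_inc_right [OF D this] obtain d where d: "0 < d" "\<And>h. 0 < h \<Longrightarrow> h < d \<Longrightarrow> S c < S (c + h)"
      by blast
    have "S c < S (c + d / 2)" using d by simp
    moreover have "S (c + d / 2) \<le> S c"
      using alt_gauss_antimono [of c "c + d / 2"] assms d by (simp add: alt_gauss_def S_def)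
    ultimately show False by simp
  qed
qed

text \<open>This is the slope of the partial theta function at u = 1. Together with the previous sum
  it carries the sign for x > 0.\<close>

lemma alternating_linear_gauss_nonneg:
  assumes "0 < c"
  shows "0 \<le> (\<Sum>n. (- 1) ^ n * real (Suc n) * exp (- (c * (real (Suc n))\<^sup>2)))"
  using ptheta_slope_pos [of "exp (- c)" 1] assms
  unfolding ptheta_slope_def exp_neg_mult_square by simp

section \<open>The sign of the error for one Gaussian\<close>

lemma nsinc_diff_of_nat:
  assumes "x \<noteq> real m"
  shows "nsinc (x - real m) = sin (pi * x) / pi * ((- 1) ^ m / (x - real m))"
proof -
  have "complex_of_real (nsinc (x - real m)) = csinc (of_real x - of_nat m)"
    using csinc_of_real [of "x - real m"] by simp
  also have "\<dots> = of_real (sin (pi * x) / pi * ((- 1) ^ m / (x - real m)))"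
  proof -
    have "sin (complex_of_real pi * complex_of_real x) = of_real (sin (pi * x))"
      by (metis of_real_mult sin_of_real)
    moreover have "complex_of_real x \<noteq> of_nat m"
      using assms by (metis of_real_eq_iff of_real_of_nat_eq)
    ultimately show ?thesis by (simp add: csinc_diff_of_nat)
  qed
  finally show ?thesis by (simp only: of_real_eq_iff)
qed

lemma decreasing_gauss:
  assumes "0 \<le> c"
  shows "decreasing_sequence (\<lambda>n. exp (- (c * (real n)\<^sup>2)))"
  by unfold_locales (use assms in \<open>auto intro!: mult_left_mono power_mono\<close>)

text \<open>With \<open>c = \<pi> l\<close>, the extremal function for the truncated Gaussian of parameter \<open>l\<close>: the coefficient
  at \<open>0\<close> is chosen so that the two partial fraction expansions decay like \<open>1/x\<^sup>2\<close>.\<close>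

definition kern :: "real \<Rightarrow> real \<Rightarrow> real" where
  "kern c x = alt_gauss c * nsinc x + (\<Sum>n. exp (- (c * (real (Suc n))\<^sup>2)) * nsinc (x - real (Suc n)))"

lemma kern_sums:
  assumes "0 \<le> c"
  shows "(\<lambda>n. exp (- (c * (real (Suc n))\<^sup>2)) * nsinc (x - real (Suc n))) sums
     Re (cardinal_series (\<lambda>n. exp (- (c * (real n)\<^sup>2))) (of_real x))"
proof -
  interpret decreasing_sequence "\<lambda>n. exp (- (c * (real n)\<^sup>2))"
    by (rule decreasing_gauss [OF assms])
  have eq: "complex_of_real (exp (- (c * (real (Suc n))\<^sup>2))) * csinc (of_real x - of_nat (Suc n)) =
      of_real (exp (- (c * (real (Suc n))\<^sup>2)) * nsinc (x - real (Suc n)))" for n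
    using csinc_of_real [of "x - real (Suc n)"] by simp
  show ?thesis
    using sums_Re [OF cardinal_sums [of "of_real x"]] unfolding eq by simp
qed

lemma kern_eq_cardinal_series:
  assumes "0 \<le> c"
  shows "kern c x = alt_gauss c * nsinc x + Re (cardinal_series (\<lambda>n. exp (- (c * (real n)\<^sup>2))) (of_real x))"
  using sums_unique [OF kern_sums [OF assms, of x]] by (simp add: kern_def)

text \<open>At c = 0 there is no summable majorant. The remainder of the series is bounded uniformly
  for c \<ge> 0 because the first coefficient is at most 1, so the limit may be taken under the sum;
  the coefficient at 0 tends to its Abel value 1/2.\<close>

lemma kern_tendsto_0: "((\<lambda>c. kern c x) \<longlongrightarrow> kern 0 x) (at_right 0)"
proof -
  define S where "S N c = (\<Sum>n<N. complex_of_real (exp (- (c * (real (Suc n))\<^sup>2))) * csinc (of_real x - of_nat (Suc n)))"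
    for N c
  define L where "L c = cardinal_series (\<lambda>n. exp (- (c * (real n)\<^sup>2))) (of_real x)" for c
  have "uniform_limit {0..} S L sequentially"
  proof (rule uniform_limitI)
    fix e :: real assume "0 < e"
    have "(\<lambda>M. exp (pi * \<bar>x\<bar>) * 5 / Suc M) \<longlonglongrightarrow> 0"
      by (rule LIMSEQ_Suc [OF lim_const_over_n])
    then have "eventually (\<lambda>M. exp (pi * \<bar>x\<bar>) * 5 / Suc M < e) sequentially"
      using \<open>0 < e\<close> by (intro order_tendstoD) auto
    then show "eventually (\<lambda>M. \<forall>c\<in>{0..}. dist (S M c) (L c) < e) sequentially"
      using eventually_ge_at_top [of "nat \<lceil>2 * \<bar>x\<bar>\<rceil>"]
    proof eventually_elim
      case (elim M)
      show ?case
      proof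
        fix c :: real assume "c \<in> {0..}"
        then have c: "0 \<le> c" by simp
        interpret decreasing_sequence "\<lambda>n. exp (- (c * (real n)\<^sup>2))"
          by (rule decreasing_gauss [OF c])
        have "2 * cmod (of_real x) \<le> real (Suc M)" using elim unfolding norm_of_real by linarith
        from cardinal_remainder [OF this]
        have "dist (S M c) (L c) \<le> exp (pi * \<bar>x\<bar>) * (5 * exp (- (c * (real 1)\<^sup>2)) / Suc M)"
          by (simp add: S_def L_def dist_norm norm_minus_commute)
        also have "\<dots> \<le> exp (pi * \<bar>x\<bar>) * (5 * 1 / Suc M)"
          using c by (intro mult_left_mono divide_right_mono) auto
        finally show "dist (S M c) (L c) < e" using elim by simp
      qed
    qed
  qed
  then have "continuous_on {0..} L"
    by (rule uniform_limit_theorem [rotated])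
      (auto simp: S_def intro!: always_eventually continuous_intros)
  then have "(L \<longlongrightarrow> L 0) (at 0 within {0..})"
    by (auto simp: continuous_on_def)
  then have L: "(L \<longlongrightarrow> L 0) (at_right 0)"
    by (rule tendsto_within_subset) auto
  have "((\<lambda>c. alt_gauss c * nsinc x + Re (L c)) \<longlongrightarrow> 1 / 2 * nsinc x + Re (L 0)) (at_right 0)"
    by (intro tendsto_intros L alt_gauss_tendsto)
  moreover have "kern 0 x = 1 / 2 * nsinc x + Re (L 0)"
    using kern_eq_cardinal_series [of 0 x] by (simp add: alt_gauss_def L_def)
  moreover have "eventually (\<lambda>c. alt_gauss c * nsinc x + Re (L c) = kern c x) (at_right 0)"
    using eventually_at_right_less [of 0]
    by eventually_elim (simp add: kern_eq_cardinal_series L_def)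
  ultimately show ?thesis by (simp add: tendsto_cong)
qed

text \<open>\<open>kern c x\<close> divided by sin(pi x)/pi. The minus sign comes from (-1)^(n+1) in
  the translate by n + 1.\<close>

definition kern_quot :: "real \<Rightarrow> real \<Rightarrow> real" where
  "kern_quot c x = alt_gauss c / x - (\<Sum>n. (- 1) ^ n * exp (- (c * (real (Suc n))\<^sup>2)) / (x - real (Suc n)))"

lemma sin_pi_nz_imp: "sin (pi * x) \<noteq> 0 \<Longrightarrow> x \<noteq> real n"
  using sin_npi2 [of n] by auto

lemma sin_pi_nz_imp_nz: "sin (pi * x) \<noteq> 0 \<Longrightarrow> x \<noteq> 0"
  by auto

lemma kern_quot_summable:
  assumes "0 \<le> c" and x: "sin (pi * x) \<noteq> 0"
  shows "(\<lambda>n. (- 1) ^ n * exp (- (c * (real (Suc n))\<^sup>2)) / (x - real (Suc n))) sums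
     (- (pi / sin (pi * x)) * Re (cardinal_series (\<lambda>n. exp (- (c * (real n)\<^sup>2))) (of_real x)))"
proof -
  have "- (pi / sin (pi * x)) * (exp (- (c * (real (Suc n))\<^sup>2)) * nsinc (x - real (Suc n))) =
      (- 1) ^ n * exp (- (c * (real (Suc n))\<^sup>2)) / (x - real (Suc n))" for n
  proof -
    have "- (pi / S) * (E * (S / pi * (- s / d))) = s * E / d" if "S \<noteq> 0" for S E s d :: real
      using that by simp
    from this [OF x, of "exp (- (c * (real (Suc n))\<^sup>2))" "(- 1) ^ n" "x - real (Suc n)"] show ?thesis
      unfolding nsinc_diff_of_nat [OF sin_pi_nz_imp [OF x]] power_Suc by simp
  qed
  then show ?thesis
    using sums_mult [OF kern_sums [OF assms(1), of x], of "- (pi / sin (pi * x))"] by simp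
qed

lemma kern_eq_quot:
  assumes "0 \<le> c" and x: "sin (pi * x) \<noteq> 0"
  shows "kern c x = sin (pi * x) / pi * kern_quot c x"
  using x sin_pi_nz_imp_nz [OF x]
  unfolding kern_quot_def kern_eq_cardinal_series [OF assms(1)] sums_unique [OF kern_quot_summable [OF assms], symmetric]
  by (simp add: nsinc_def field_simps)

lemma kern_quot_tendsto_0:
  assumes x: "sin (pi * x) \<noteq> 0"
  shows "((\<lambda>c. kern_quot c x) \<longlongrightarrow> kern_quot 0 x) (at_right 0)"
proof -
  have eq: "kern_quot c x = pi / sin (pi * x) * kern c x" if "0 \<le> c" for c
    using kern_eq_quot [OF that x] x by simp
  have "((\<lambda>c. pi / sin (pi * x) * kern c x) \<longlongrightarrow> pi / sin (pi * x) * kern 0 x) (at_right 0)"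
    by (intro tendsto_intros kern_tendsto_0)
  moreover have "eventually (\<lambda>c. pi / sin (pi * x) * kern c x = kern_quot c x) (at_right 0)"
    using eventually_at_right_less [of 0] by eventually_elim (simp add: eq)
  ultimately show ?thesis by (simp add: tendsto_cong eq)
qed

lemma summable_alternating_gauss:
  assumes "0 < c"
  shows "summable (\<lambda>n. (- 1) ^ n * real (Suc n) ^ k * exp (- (c * (real (Suc n))\<^sup>2)))"
  by (rule summable_norm_cancel)
    (use summable_gauss_Suc [OF assms, of k] in \<open>simp add: abs_mult\<close>)

text \<open>The choice of the coefficient at 0 spreads 1/x over the series. Each bracket equals
  -m/(x (x - m)) with m = n + 1; the quadratic decay and both sign arguments start from this
  form.\<close>

lemma kern_quot_eq:
  assumes c: "0 < c" and x: "sin (pi * x) \<noteq> 0"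
  shows "(\<lambda>n. (- 1) ^ n * (1 / x - 1 / (x - real (Suc n))) * exp (- (c * (real (Suc n))\<^sup>2))) sums kern_quot c x"
proof -
  have "(\<lambda>n. (- 1) ^ n * exp (- (c * (real (Suc n))\<^sup>2)) / x) sums (alt_gauss c / x)"
    using summable_alternating_gauss [OF c, of 0] c
    by (intro sums_divide) (simp add: alt_gauss_def summable_sums)
  from sums_diff [OF this summable_sums [OF sums_summable [OF kern_quot_summable [OF _ x]]], of c]
  show ?thesis
    using c by (simp add: kern_quot_def algebra_simps diff_divide_distrib)
qed

text \<open>Since m/(y + m) is the integral of m u^(y + m - 1) over [0, 1], the sum is the integral
  of u^y \<open>ptheta_slope q u\<close>, with positive integrand. In place of termwise integration
  the proof differentiates the primitive \<open>w u = u powr (y + 1) * W u\<close>, which vanishes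
  at 0.\<close>

lemma alternating_gauss_fraction_nonneg:
  assumes c: "0 < c" and y: "0 < y"
  shows "0 \<le> (\<Sum>n. (- 1) ^ n * (real (Suc n) / (y + real (Suc n))) * exp (- (c * (real (Suc n))\<^sup>2)))"
proof -
  define q where "q = exp (- c)"
  have q: "0 < q" "q < 1" "0 \<le> q" using c by (auto simp: q_def)
  define a where "a n = (- 1) ^ n * (real (Suc n) / (y + real (Suc n))) * q ^ ((Suc n)\<^sup>2)" for n
  define W where "W u = (\<Sum>n. a n * u ^ n)" for u
  have sa: "summable (\<lambda>n. a n * u ^ n)" for u
  proof (rule summable_comparison_test')
    have "(- 1) ^ n * real (Suc n) * q ^ ((Suc n)\<^sup>2) * (- \<bar>u\<bar>) ^ n = real (Suc n) * q ^ ((Suc n)\<^sup>2) * \<bar>u\<bar> ^ n" for n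
    proof -
      have "(- 1) ^ n * (- \<bar>u\<bar>) ^ n = \<bar>u\<bar> ^ n" by (simp flip: power_mult_distrib)
      then show ?thesis by (metis mult.assoc mult.commute)
    qed
    then show "summable (\<lambda>n. real (Suc n) * q ^ ((Suc n)\<^sup>2) * \<bar>u\<bar> ^ n)"
      using summable_ptheta_slope [OF q(3) q(2), of "- \<bar>u\<bar>"] by (simp only:)
    fix n
    have "real (Suc n) / (y + real (Suc n)) \<le> real (Suc n)" using y by (simp add: divide_le_eq algebra_simps)
    then show "norm (a n * u ^ n) \<le> real (Suc n) * q ^ ((Suc n)\<^sup>2) * \<bar>u\<bar> ^ n"
      using q y mult_right_mono [of "real (Suc n) / (y + real (Suc n))" "real (Suc n)" "q ^ ((Suc n)\<^sup>2) * \<bar>u\<bar> ^ n"]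
      unfolding a_def by (simp add: abs_mult power_abs mult.assoc del: of_nat_Suc)
  qed
  have DW: "(W has_real_derivative (\<Sum>n. diffs a n * u ^ n)) (at u)" for u
    unfolding W_def [abs_def] by (rule termdiffs_strong_converges_everywhere) (rule sa)
  have slope: "(y + 1) * W u + u * (\<Sum>n. diffs a n * u ^ n) = ptheta_slope q u" for u
  proof -
    have s: "summable (\<lambda>n. diffs a n * u ^ n)" by (rule termdiff_converges_all) (rule sa)
    have "(\<lambda>n. of_nat n * a n * u ^ (n - Suc 0)) sums (\<Sum>n. diffs a n * u ^ n)"
      using diffs_equiv [OF s] by simp
    then have "(\<lambda>n. (y + 1) * (a n * u ^ n) + u * (of_nat n * a n * u ^ (n - Suc 0))) sums
        ((y + 1) * W u + u * (\<Sum>n. diffs a n * u ^ n))"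
      unfolding W_def by (intro sums_add sums_mult summable_sums sa)
    moreover have "(y + 1) * (a n * u ^ n) + u * (of_nat n * a n * u ^ (n - Suc 0)) =
        (- 1) ^ n * real (Suc n) * q ^ ((Suc n)\<^sup>2) * u ^ n" for n
    proof -
      have "u * (of_nat n * a n * u ^ (n - Suc 0)) = real n * a n * u ^ n"
        by (cases n) auto
      moreover have "(y + 1) * (a n * u ^ n) + real n * a n * u ^ n = (y + real (Suc n)) * a n * u ^ n"
        by (simp add: algebra_simps)
      moreover have "(y + real (Suc n)) * a n = (- 1) ^ n * real (Suc n) * q ^ ((Suc n)\<^sup>2)"
        using y unfolding a_def by (simp add: divide_simps)
      ultimately show ?thesis by (simp only:)
    qed
    ultimately show ?thesis by (simp only: ptheta_slope_def sums_iff)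
  qed
  define w where "w u = u powr (y + 1) * W u" for u
  have "w 0 \<le> w 1"
  proof (rule DERIV_nonneg_imp_increasing_open [of 0 1])
    fix u :: real assume u: "0 < u" "u < 1"
    have "(w has_real_derivative ((y + 1) * u powr y * W u + u powr (y + 1) * (\<Sum>n. diffs a n * u ^ n))) (at u)"
      unfolding w_def [abs_def] using u
      by (auto intro!: derivative_eq_intros DW [THEN DERIV_chain2])
    moreover have "(y + 1) * u powr y * W u + u powr (y + 1) * (\<Sum>n. diffs a n * u ^ n) = u powr y * ptheta_slope q u"
      using u unfolding slope [symmetric] by (simp add: powr_add algebra_simps)
    moreover have "0 \<le> u powr y * ptheta_slope q u"
      using ptheta_slope_pos [of q u] q u by simp
    ultimately show "\<exists>d. (w has_real_derivative d) (at u) \<and> 0 \<le> d" by auto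
  next
    have "continuous_on {0..1} W"
      by (intro continuous_at_imp_continuous_on ballI DERIV_isCont [OF DW])
    then show "continuous_on {0..1} w"
      unfolding w_def [abs_def] using y by (intro continuous_on_mult continuous_on_powr') auto
  qed simp
  then show ?thesis using y
    by (simp add: w_def W_def a_def q_def exp_neg_mult_square del: of_nat_Suc)
qed

lemma kern_quot_neg_nonpos:
  assumes c: "0 \<le> c" and x: "sin (pi * x) \<noteq> 0" "x < 0"
  shows "kern_quot c x \<le> 0"
proof -
  have pos: "kern_quot c x \<le> 0" if c: "0 < c" for c
  proof -
    define y where "y = - x"
    have y: "0 < y" using x by (simp add: y_def)
    have s: "summable (\<lambda>n. (- 1) ^ n * (real (Suc n) / (y + real (Suc n))) * exp (- (c * (real (Suc n))\<^sup>2)))"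
    proof (rule summable_comparison_test')
      show "summable (\<lambda>n. real (Suc n) ^ 0 * exp (- (c * (real (Suc n))\<^sup>2)))"
        by (rule summable_gauss_Suc [OF c])
      show "norm ((- 1) ^ n * (real (Suc n) / (y + real (Suc n))) * exp (- (c * (real (Suc n))\<^sup>2)))
          \<le> real (Suc n) ^ 0 * exp (- (c * (real (Suc n))\<^sup>2))" for n
        using y by (simp add: abs_mult divide_le_eq)
    qed
    have "1 / x - 1 / (x - real (Suc n)) = - (1 / y) * (real (Suc n) / (y + real (Suc n)))" for n
      using y by (simp add: y_def divide_simps) (simp add: algebra_simps)
    then have "(\<lambda>n. - (1 / y) * ((- 1) ^ n * (real (Suc n) / (y + real (Suc n))) * exp (- (c * (real (Suc n))\<^sup>2))))
        sums kern_quot c x"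
      using kern_quot_eq [OF c x(1)] by (simp add: mult_ac del: of_nat_Suc)
    moreover have "(\<lambda>n. - (1 / y) * ((- 1) ^ n * (real (Suc n) / (y + real (Suc n))) * exp (- (c * (real (Suc n))\<^sup>2))))
        sums (- (1 / y) * (\<Sum>n. (- 1) ^ n * (real (Suc n) / (y + real (Suc n))) * exp (- (c * (real (Suc n))\<^sup>2))))"
      by (intro sums_mult summable_sums s)
    ultimately have "kern_quot c x = - (1 / y) * (\<Sum>n. (- 1) ^ n * (real (Suc n) / (y + real (Suc n))) * exp (- (c * (real (Suc n))\<^sup>2)))"
      by (rule sums_unique2)
    also have "\<dots> \<le> 0"
      using alternating_gauss_fraction_nonneg [OF c y] y
      by (intro mult_nonpos_nonneg) auto
    finally show ?thesis .
  qed
  show ?thesis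
  proof (cases "c = 0")
    case True
    \<comment> \<open>For c = 0 the alternating sums above diverge; the inequality passes to the
      limit.\<close>
    have "kern_quot 0 x \<le> 0"
      by (rule tendsto_upperbound [OF kern_quot_tendsto_0 [OF x(1)]])
        (use eventually_at_right_less [of 0] in \<open>eventually_elim, simp_all add: pos\<close>)
    with True show ?thesis by simp
  qed (use c pos in auto)
qed

text \<open>The factor exp(c x^2) makes differentiation in c multiply the term with m = n + 1 by x^2
  - m^2, which cancels its pole: (1/x - 1/(x - m)) (x^2 - m^2) = -(m + m^2/x). What remains are
  alternating sums without denominators depending on m, each of known sign.\<close>

lemma kern_quot_increasing:
  assumes x: "sin (pi * x) \<noteq> 0" "0 < x" and cd: "0 < c" "c \<le> d"
  shows "exp (d * x\<^sup>2) * kern_quot d x \<le> exp (c * x\<^sup>2) * kern_quot c x"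
proof -
  define w where "w n = (- 1) ^ n * (1 / x - 1 / (x - real (Suc n)))" for n
  \<comment> \<open>The coefficients converge for fixed x, so they are bounded, which termwise
    differentiation uses.\<close>
  have "(\<lambda>n. 1 / x - 1 / (x - real (Suc n))) \<longlonglongrightarrow> 1 / x - 0"
    by (intro tendsto_intros LIMSEQ_Suc) real_asymp
  then have "Bseq (\<lambda>n. 1 / x - 1 / (x - real (Suc n)))"
    by (intro convergent_imp_Bseq) (auto simp: convergent_def)
  then obtain W where "\<And>n. norm (1 / x - 1 / (x - real (Suc n))) \<le> W"
    by (auto simp: Bseq_def)
  then have W: "\<bar>w n\<bar> \<le> W" for n by (simp add: w_def abs_mult)
  have eq: "kern_quot c x = (\<Sum>n. w n * exp (- (c * (real (Suc n))\<^sup>2)))" if "0 < c" for c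
    using sums_unique [OF kern_quot_eq [OF that x(1)]] by (simp add: w_def)
  define Q where "Q c = exp (c * x\<^sup>2) * (\<Sum>n. w n * exp (- (c * (real (Suc n))\<^sup>2)))" for c
  have "Q d \<le> Q c"
  proof (rule DERIV_nonpos_imp_nonincreasing [OF cd(2)])
    fix b assume "c \<le> b" "b \<le> d"
    then have b: "0 < b" using cd by simp
    define S where "S k = (\<Sum>n. (- 1) ^ n * real (Suc n) ^ k * exp (- (b * (real (Suc n))\<^sup>2)))" for k
    have sw: "summable (\<lambda>n. w n * exp (- (b * (real (Suc n))\<^sup>2)))"
      using sums_summable [OF kern_quot_eq [OF b x(1)]] by (simp add: w_def)
    have sw2: "summable (\<lambda>n. w n * (real (Suc n))\<^sup>2 * exp (- (b * (real (Suc n))\<^sup>2)))"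
    proof (rule summable_comparison_test')
      show "summable (\<lambda>n. W * (real (Suc n) ^ 2 * exp (- (b * (real (Suc n))\<^sup>2))))"
        by (intro summable_mult summable_gauss_Suc b)
      show "norm (w n * (real (Suc n))\<^sup>2 * exp (- (b * (real (Suc n))\<^sup>2)))
          \<le> W * (real (Suc n) ^ 2 * exp (- (b * (real (Suc n))\<^sup>2)))" for n
        using W [of n] by (simp add: abs_mult mult.assoc mult_right_mono)
    qed
    have "(Q has_real_derivative exp (b * x\<^sup>2) * x\<^sup>2 * (\<Sum>n. w n * exp (- (b * (real (Suc n))\<^sup>2))) +
        exp (b * x\<^sup>2) * - (\<Sum>n. w n * (real (Suc n))\<^sup>2 * exp (- (b * (real (Suc n))\<^sup>2)))) (at b)"
      unfolding Q_def [abs_def]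
      by (rule derivative_eq_intros DERIV_gauss_series [OF W b] | simp)+
    moreover have "x\<^sup>2 * (\<Sum>n. w n * exp (- (b * (real (Suc n))\<^sup>2))) -
        (\<Sum>n. w n * (real (Suc n))\<^sup>2 * exp (- (b * (real (Suc n))\<^sup>2))) = - (S 1 + 1 / x * S 2)"
    proof -
      have "(\<lambda>n. x\<^sup>2 * (w n * exp (- (b * (real (Suc n))\<^sup>2))) - w n * (real (Suc n))\<^sup>2 * exp (- (b * (real (Suc n))\<^sup>2)))
          sums (x\<^sup>2 * (\<Sum>n. w n * exp (- (b * (real (Suc n))\<^sup>2))) -
            (\<Sum>n. w n * (real (Suc n))\<^sup>2 * exp (- (b * (real (Suc n))\<^sup>2))))"
        by (intro sums_diff sums_mult summable_sums sw sw2)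
      moreover have "(\<lambda>n. - ((- 1) ^ n * real (Suc n) ^ 1 * exp (- (b * (real (Suc n))\<^sup>2)) +
          1 / x * ((- 1) ^ n * real (Suc n) ^ 2 * exp (- (b * (real (Suc n))\<^sup>2))))) sums (- (S 1 + 1 / x * S 2))"
        unfolding S_def by (intro sums_minus sums_add sums_mult summable_sums summable_alternating_gauss b)
      moreover have "x\<^sup>2 * (w n * exp (- (b * (real (Suc n))\<^sup>2))) - w n * (real (Suc n))\<^sup>2 * exp (- (b * (real (Suc n))\<^sup>2))
          = - ((- 1) ^ n * real (Suc n) ^ 1 * exp (- (b * (real (Suc n))\<^sup>2)) +
          1 / x * ((- 1) ^ n * real (Suc n) ^ 2 * exp (- (b * (real (Suc n))\<^sup>2))))" for n
      proof -
        define m where "m = real (Suc n)"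
        have "x - m \<noteq> 0" "x \<noteq> 0" using sin_pi_nz_imp [OF x(1), of "Suc n"] sin_pi_nz_imp_nz [OF x(1)] by (auto simp: m_def)
        then have "(1 / x - 1 / (x - m)) * (x\<^sup>2 - m\<^sup>2) = - (m + 1 / x * m\<^sup>2)"
          by (simp add: divide_simps power2_eq_square) (simp add: algebra_simps)
        moreover have "w n * (x\<^sup>2 - m\<^sup>2) = (- 1) ^ n * ((1 / x - 1 / (x - m)) * (x\<^sup>2 - m\<^sup>2))"
          by (simp only: w_def m_def mult.assoc)
        ultimately have "w n * (x\<^sup>2 - m\<^sup>2) = - ((- 1) ^ n * (m + 1 / x * m\<^sup>2))"
          by (simp only: mult_minus_right)
        then have "w n * (x\<^sup>2 - m\<^sup>2) * exp (- (b * m\<^sup>2)) = - ((- 1) ^ n * (m + 1 / x * m\<^sup>2)) * exp (- (b * m\<^sup>2))"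
          by simp
        then show ?thesis unfolding m_def [symmetric] by (simp add: algebra_simps)
      qed
      ultimately show ?thesis by (simp add: sums_iff)
    qed
    moreover have "0 \<le> S 1" "0 \<le> S 2"
      using alternating_linear_gauss_nonneg [OF b] alternating_square_gauss_nonneg [OF b]
      by (auto simp: S_def)
    moreover have "exp (b * x\<^sup>2) * x\<^sup>2 * p + exp (b * x\<^sup>2) * - r = exp (b * x\<^sup>2) * (x\<^sup>2 * p - r)" for p r
      by (simp add: algebra_simps)
    moreover have "0 \<le> S 1 + 1 / x * S 2"
      using \<open>0 \<le> S 1\<close> \<open>0 \<le> S 2\<close> x by (intro add_nonneg_nonneg mult_nonneg_nonneg) auto
    then have "exp (b * x\<^sup>2) * - (S 1 + 1 / x * S 2) \<le> 0"
      by (intro mult_nonneg_nonpos) (simp_all only: exp_ge_zero neg_le_0_iff_le)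
    ultimately show "\<exists>D. (Q has_real_derivative D) (at b) \<and> D \<le> 0"
      by metis
  qed
  then show ?thesis using cd by (simp add: Q_def eq)
qed

section \<open>The explicit error at l = 0: Nielsen's beta function\<close>

definition alt_harmonic :: "real \<Rightarrow> real" where
  "alt_harmonic x = (\<Sum>m. (- 1) ^ m / (x + real m))"

lemma alt_harmonic_summable:
  assumes "0 < x"
  shows "summable (\<lambda>m. (- 1) ^ m / (x + real m))"
proof -
  have "(\<lambda>m. 1 / (x + real m)) \<longlonglongrightarrow> 0" by real_asymp
  from summable_Leibniz'(1) [OF this] show ?thesis
    using assms by (simp add: frac_le)
qed

lemma alt_harmonic_shift:
  assumes "0 < x"
  shows "alt_harmonic x + alt_harmonic (x + 1) = 1 / x"
proof -
  have "alt_harmonic x = (\<Sum>m. (- 1) ^ Suc m / (x + real (Suc m))) + 1 / x"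
    using suminf_split_head [OF alt_harmonic_summable [OF assms]] by (simp add: alt_harmonic_def)
  also have "(\<Sum>m. (- 1) ^ Suc m / (x + real (Suc m))) = (\<Sum>m. - ((- 1) ^ m / (x + 1 + real m)))"
    by (intro suminf_cong) (simp add: add_ac)
  also have "\<dots> = - alt_harmonic (x + 1)"
    unfolding alt_harmonic_def using assms by (intro suminf_minus alt_harmonic_summable) simp
  finally show ?thesis by simp
qed

text \<open>The function decreases under x -> x + 1, since its differences form an alternating
  series with decreasing terms, and the values at x and x + 1 add up to 1/x. So the first is at
  least half of it.\<close>

lemma alt_harmonic_ge:
  assumes x: "0 < x"
  shows "1 / (2 * x) \<le> alt_harmonic x"
proof -
  define a where "a m = 1 / (x + real m) - 1 / (x + 1 + real m)" for m
  have a: "a m = 1 / ((x + real m) * (x + 1 + real m))" for m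
    using x by (simp add: a_def divide_simps)
  have "a \<longlonglongrightarrow> 0" unfolding a_def by real_asymp
  moreover have "0 \<le> a m" for m using x by (simp add: a)
  moreover have "a (Suc m) \<le> a m" for m
    unfolding a using x by (intro divide_left_mono mult_mono mult_pos_pos) auto
  ultimately have "0 \<le> (\<Sum>m. (- 1) ^ m * a m)"
    using summable_Leibniz'(2) [of a 0] by simp
  also have "(\<Sum>m. (- 1) ^ m * a m) = (\<Sum>m. (- 1) ^ m / (x + real m) - (- 1) ^ m / (x + 1 + real m))"
    by (simp add: a_def right_diff_distrib)
  also have "\<dots> = alt_harmonic x - alt_harmonic (x + 1)"
    unfolding alt_harmonic_def using x by (intro suminf_diff [symmetric] alt_harmonic_summable) auto
  finally have "alt_harmonic (x + 1) \<le> alt_harmonic x" by simp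
  moreover have "1 / x = 2 * (1 / (2 * x))" by simp
  ultimately show ?thesis using alt_harmonic_shift [OF x] by linarith
qed

text \<open>Obtained by differentiating the reflection formula of the Gamma function and dividing by
  it.\<close>

lemma Digamma_reflection_real:
  fixes x :: real
  assumes "x \<notin> \<int>"
  shows "Digamma (1 - x) - Digamma x = pi * cot (pi * x)"
proof -
  have nz: "sin (pi * x) \<noteq> 0" if "x \<notin> \<int>" for x
    using that by (auto simp: sin_zero_iff_int2 mult.commute)
  have G: "Gamma y * Gamma (1 - y) = pi / sin (pi * y)" for y :: real
  proof -
    have "complex_of_real (Gamma y * Gamma (1 - y)) = of_real (pi / sin (pi * y))"
      using Gamma_reflection_complex [of "of_real y"]
      by (simp flip: Gamma_complex_of_real sin_of_real)
    then show ?thesis by (simp only: of_real_eq_iff)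
  qed
  have np: "x \<notin> \<int>\<^sub>\<le>\<^sub>0" "1 - x \<notin> \<int>\<^sub>\<le>\<^sub>0"
    using assms by (auto dest!: nonpos_Ints_Int)
  have "((\<lambda>y. Gamma y * Gamma (1 - y)) has_real_derivative
      Gamma x * Digamma x * Gamma (1 - x) + (Gamma (1 - x) * Digamma (1 - x) * (- 1)) * Gamma x) (at x)"
    using np by (auto intro!: derivative_eq_intros)
  moreover have "((\<lambda>y. pi / sin (pi * y)) has_real_derivative - (pi * (cos (pi * x) * pi)) / (sin (pi * x))\<^sup>2) (at x)"
    using nz [OF assms] by (auto intro!: derivative_eq_intros simp: power2_eq_square)
  ultimately have "Gamma x * Digamma x * Gamma (1 - x) + (Gamma (1 - x) * Digamma (1 - x) * (- 1)) * Gamma x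
      = - (pi * (cos (pi * x) * pi)) / (sin (pi * x))\<^sup>2"
    unfolding G by (rule DERIV_unique)
  then have "(Gamma x * Gamma (1 - x)) * (Digamma (1 - x) - Digamma x) = pi * (cos (pi * x) * pi) / (sin (pi * x))\<^sup>2"
    by (simp add: algebra_simps)
  then have "pi / sin (pi * x) * (Digamma (1 - x) - Digamma x) = pi / sin (pi * x) * (pi * cot (pi * x))"
    unfolding G by (simp add: cot_def power2_eq_square)
  then show ?thesis using nz [OF assms] by simp
qed

text \<open>Grouping the terms in pairs gives two digamma limits in which the logarithms cancel. The
  statement is about partial sums and admits negative arguments because it is applied both at x and
  at 1 - x.\<close>

lemma alt_harmonic_partial_sums:
  assumes "x \<noteq> 0" "x \<noteq> - 1"
  shows "(\<lambda>N. \<Sum>m<2 * N. (- 1) ^ m / (x + real m)) \<longlonglongrightarrow> (Digamma ((x + 1) / 2) - Digamma (x / 2)) / 2"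
proof -
  have "(\<Sum>m<2 * N. (- 1) ^ m / (x + real m)) =
      ((ln (real N) - (\<Sum>n<N. inverse ((x + 1) / 2 + real n))) - (ln (real N) - (\<Sum>n<N. inverse (x / 2 + real n)))) / 2"
    for N
  proof (induction N)
    case (Suc N)
    have half: "inverse (r / 2) / 2 = 1 / r" for r :: real by (simp add: inverse_eq_divide)
    have "x / 2 + real N = (x + real (2 * N)) / 2" "(x + 1) / 2 + real N = (x + real (Suc (2 * N))) / 2"
      by (simp_all add: field_simps)
    then have "inverse (x / 2 + real N) / 2 = 1 / (x + real (2 * N))"
      "inverse ((x + 1) / 2 + real N) / 2 = 1 / (x + real (Suc (2 * N)))"
      by (simp_all only: half)
    moreover have "(\<Sum>m<2 * Suc N. (- 1) ^ m / (x + real m)) =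
        (\<Sum>m<2 * N. (- 1) ^ m / (x + real m)) + 1 / (x + real (2 * N)) - 1 / (x + real (Suc (2 * N)))"
      by simp
    moreover have "p' = ((l' - (a + a')) - (l' - (b + b'))) / 2"
      if "b' / 2 = u" "a' / 2 = v" "p' = p + u - v" "p = ((l - a) - (l - b)) / 2"
      for p p' l l' a a' b b' u v :: real
      using that by (simp add: field_simps)
    ultimately show ?case
      using Suc unfolding sum.lessThan_Suc by blast
  qed simp
  moreover have "(\<lambda>N. ((ln (real N) - (\<Sum>n<N. inverse ((x + 1) / 2 + real n))) - (ln (real N) - (\<Sum>n<N. inverse (x / 2 + real n)))) / 2)
      \<longlonglongrightarrow> (Digamma ((x + 1) / 2) - Digamma (x / 2)) / 2"
    using Digamma_LIMSEQ [of "(x + 1) / 2"] Digamma_LIMSEQ [of "x / 2"] assms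
    by (intro tendsto_intros) auto
  ultimately show ?thesis by (simp only:)
qed

text \<open>Via the digamma reflection formula, which takes the place of the partial fractions of
  \<open>\<pi> / sin (\<pi> x)\<close>.\<close>

lemma kern_quot_0:
  assumes x: "sin (pi * x) \<noteq> 0" "0 < x"
  shows "pi / sin (pi * x) - kern_quot 0 x = alt_harmonic x - 1 / (2 * x)"
proof -
  have xZ: "x \<notin> \<int>" using x by (auto simp: sin_zero_iff_int2 mult.commute elim!: Ints_cases)
  have half: "x / 2 \<notin> \<int>" "(1 - x) / 2 \<notin> \<int>"
  proof -
    have "x \<in> \<int>" if "x / 2 \<in> \<int>" using Ints_mult [OF that, of 2] by simp
    moreover have "x \<in> \<int>" if "(1 - x) / 2 \<in> \<int>"
    proof -
      have "1 - (1 - x) / 2 * 2 = x" by (simp add: diff_divide_distrib)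
      then show ?thesis using Ints_diff [OF Ints_1 Ints_mult [OF that, of 2]] by (metis Ints_numeral)
    qed
    ultimately show "x / 2 \<notin> \<int>" "(1 - x) / 2 \<notin> \<int>" using xZ by auto
  qed
  have even: "filterlim (\<lambda>N. 2 * N) sequentially (sequentially :: nat filter)"
    by (rule filterlim_subseq) (simp add: strict_mono_def)
  have "(\<lambda>m. (- 1) ^ m / (x + real m)) sums alt_harmonic x"
    unfolding alt_harmonic_def by (rule summable_sums [OF alt_harmonic_summable [OF x(2)]])
  then have "(\<lambda>N. \<Sum>m<2 * N. (- 1) ^ m / (x + real m)) \<longlonglongrightarrow> alt_harmonic x"
    unfolding sums_def by (rule filterlim_compose [OF _ even])
  then have b: "alt_harmonic x = (Digamma ((x + 1) / 2) - Digamma (x / 2)) / 2"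
    using alt_harmonic_partial_sums [of x] x by (intro LIMSEQ_unique) auto
  define A where "A = (\<Sum>n. (- 1) ^ n * exp (- (0 * (real (Suc n))\<^sup>2)) / (x - real (Suc n)))"
  have "(\<lambda>n. (- 1) ^ n * exp (- (0 * (real (Suc n))\<^sup>2)) / (x - real (Suc n))) sums A"
    unfolding A_def by (rule summable_sums [OF sums_summable [OF kern_quot_summable [OF order_refl x(1)]]])
  then have "(\<lambda>n. - ((- 1) ^ n * exp (- (0 * (real (Suc n))\<^sup>2)) / (x - real (Suc n)))) sums (- A)"
    by (rule sums_minus)
  moreover have "- ((- 1) ^ n * exp (- (0 * (real (Suc n))\<^sup>2)) / (x - real (Suc n))) = (- 1) ^ n / ((1 - x) + real n)" for n
    by (simp add: minus_divide_right)
  ultimately have "(\<lambda>N. \<Sum>m<2 * N. (- 1) ^ m / ((1 - x) + real m)) \<longlonglongrightarrow> - A"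
    unfolding sums_def by (simp only:) (rule filterlim_compose [OF _ even])
  then have a: "- A = (Digamma ((1 - x + 1) / 2) - Digamma ((1 - x) / 2)) / 2"
  proof (rule LIMSEQ_unique)
    have "x \<noteq> 1" "x \<noteq> 2" using xZ by auto
    then show "(\<lambda>N. \<Sum>m<2 * N. (- 1) ^ m / ((1 - x) + real m)) \<longlonglongrightarrow> (Digamma ((1 - x + 1) / 2) - Digamma ((1 - x) / 2)) / 2"
      by (intro alt_harmonic_partial_sums) auto
  qed
  \<comment> \<open>The four digamma arguments pair off as y and 1 - y, for y = x/2 and for y = (1 -
    x)/2. The two cotangents then combine to cot t + tan t = 1/(sin t cos t) with t = pi
    x/2.\<close>
  have "1 - (1 - x) / 2 = (x + 1) / 2" "1 - x / 2 = (1 - x + 1) / 2" by (auto simp: field_simps)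
  then have "alt_harmonic x - A = (pi * cot (pi * (x / 2)) + pi * cot (pi * ((1 - x) / 2))) / 2"
    using Digamma_reflection_real [OF half(1)] Digamma_reflection_real [OF half(2)] a b
    by (simp add: field_simps)
  also have "cot (pi * ((1 - x) / 2)) = tan (pi * (x / 2))"
    using tan_cot' [of "pi * ((1 - x) / 2)"] by (simp add: field_simps)
  also have "(pi * cot (pi * (x / 2)) + pi * tan (pi * (x / 2))) / 2 = pi / sin (pi * x)"
  proof -
    define t where "t = pi * (x / 2)"
    have s: "sin (pi * x) = 2 * sin t * cos t" using sin_double [of t] by (simp add: t_def)
    then have nz: "sin t \<noteq> 0" "cos t \<noteq> 0" using x(1) by auto
    have "cot t + tan t = ((cos t)\<^sup>2 + (sin t)\<^sup>2) / (sin t * cos t)"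
      using nz by (simp add: cot_def tan_def field_simps power2_eq_square)
    also have "\<dots> = 1 / (sin t * cos t)" by simp
    finally have "(pi * cot t + pi * tan t) / 2 = pi * (1 / (sin t * cos t)) / 2"
      by (simp only: distrib_left [symmetric])
    then show ?thesis unfolding t_def [symmetric] s by simp
  qed
  finally show ?thesis by (simp add: kern_quot_def alt_gauss_def A_def)
qed

text \<open>Division by sin(pi x)/pi gives an inequality whose direction no longer depends on the
  sign of the sine: \<open>kern_quot c x\<close> lies below exp(-c x^2) pi/sin(pi x) when x > 0, and
  below 0 when x < 0. Multiplying back by the square of the sine restores the claim.\<close>

lemma kern_sign:
  assumes c: "0 \<le> c" and "x \<noteq> 0"
  shows "0 \<le> sin (pi * x) * ((if 0 < x then exp (- (c * x\<^sup>2)) else 0) - kern c x)"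
proof (cases "sin (pi * x) = 0")
  case False
  define s where "s = sin (pi * x)"
  have s: "s \<noteq> 0" using False by (simp add: s_def)
  show ?thesis
  proof (cases "0 < x")
    case True
    have "exp (c * x\<^sup>2) * kern_quot c x \<le> kern_quot 0 x"
    proof (cases "c = 0")
      case False
      then have c: "0 < c" using c by simp
      \<comment> \<open>Monotonicity holds between positive parameters; the comparison with
        parameter 0 is its limit.\<close>
      have lim: "((\<lambda>b. exp (b * x\<^sup>2) * kern_quot b x) \<longlongrightarrow> exp (0 * x\<^sup>2) * kern_quot 0 x) (at_right 0)"
        by (intro tendsto_intros kern_quot_tendsto_0) (use s s_def in auto)
      have "eventually (\<lambda>b. 0 < b \<and> b < c) (at_right 0)"
        using c by (auto simp: eventually_at_right_field)
      then have "eventually (\<lambda>b. exp (c * x\<^sup>2) * kern_quot c x \<le> exp (b * x\<^sup>2) * kern_quot b x) (at_right 0)"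
        by eventually_elim (use kern_quot_increasing [OF _ True] s s_def in auto)
      from tendsto_lowerbound [OF lim this] show ?thesis by simp
    qed simp
    also have "kern_quot 0 x \<le> pi / s"
      using kern_quot_0 [OF _ True] alt_harmonic_ge [OF True] s by (simp add: s_def)
    finally have "exp (- (c * x\<^sup>2)) * (exp (c * x\<^sup>2) * kern_quot c x) \<le> exp (- (c * x\<^sup>2)) * (pi / s)"
      by (rule mult_left_mono) simp
    then have "kern_quot c x \<le> exp (- (c * x\<^sup>2)) * (pi / s)"
      by (simp add: mult.assoc [symmetric] exp_add [symmetric])
    then have "0 \<le> s\<^sup>2 / pi * (exp (- (c * x\<^sup>2)) * (pi / s) - kern_quot c x)"
      by (intro mult_nonneg_nonneg) auto
    also have "\<dots> = s * (exp (- (c * x\<^sup>2)) - s / pi * kern_quot c x)"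
      using s by (simp add: field_simps power2_eq_square)
    finally show ?thesis using True kern_eq_quot [OF c False] by (simp add: s_def)
  next
    case neg: False
    then have "kern_quot c x \<le> 0"
      using kern_quot_neg_nonpos [OF c False] \<open>x \<noteq> 0\<close> by simp
    then have "0 \<le> s\<^sup>2 / pi * (- kern_quot c x)"
      by (intro mult_nonneg_nonneg) auto
    then show ?thesis using neg kern_eq_quot [OF c False] by (simp add: s_def power2_eq_square)
  qed
qed simp

text \<open>At c = 0 the modulus of the error is even, so one function of |x| describes both
  half-lines. This permits folding and periodizing when the distance is computed.\<close>

lemma kern_0_error:
  assumes x: "sin (pi * x) \<noteq> 0"
  shows "\<bar>(if 0 < x then 1 else 0) - kern 0 x\<bar> = \<bar>sin (pi * x)\<bar> / pi * (alt_harmonic \<bar>x\<bar> - 1 / (2 * \<bar>x\<bar>))"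
proof (cases "0 < x")
  case True
  have "1 - kern 0 x = sin (pi * x) / pi * (pi / sin (pi * x) - kern_quot 0 x)"
    using x kern_eq_quot [OF order_refl x] by (simp add: field_simps)
  also have "\<dots> = sin (pi * x) / pi * (alt_harmonic x - 1 / (2 * x))"
    by (simp only: kern_quot_0 [OF x True])
  finally show ?thesis
    using True alt_harmonic_ge [OF True] by (simp add: abs_mult)
next
  case False
  define y where "y = - x"
  have y: "0 < y" using False sin_pi_nz_imp_nz [OF x] by (simp add: y_def)
  have "(\<Sum>n. (- 1) ^ n * exp (- (0 * (real (Suc n))\<^sup>2)) / (x - real (Suc n))) = (\<Sum>n. - ((- 1) ^ n / (y + 1 + real n)))"
  proof (intro suminf_cong)
    fix n
    have "x - real (Suc n) = - (y + 1 + real n)" by (simp add: y_def)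
    then show "(- 1) ^ n * exp (- (0 * (real (Suc n))\<^sup>2)) / (x - real (Suc n)) = - ((- 1) ^ n / (y + 1 + real n))"
      by (simp only: divide_minus_right) simp
  qed
  also have "\<dots> = - alt_harmonic (y + 1)"
    unfolding alt_harmonic_def using y by (intro suminf_minus alt_harmonic_summable) simp
  finally have "kern_quot 0 x = - (1 / (2 * y)) + alt_harmonic (y + 1)"
    by (simp add: kern_quot_def alt_gauss_def y_def)
  \<comment> \<open>The functional equation moves the argument y + 1 back to y and produces the same
    expression as on the positive side, with opposite sign.\<close>
  also have "\<dots> = - (alt_harmonic y - 1 / (2 * y))"
  proof -
    have "1 / y = 2 * (1 / (2 * y))" by simp
    then show ?thesis using alt_harmonic_shift [OF y] by linarith
  qed
  finally have "kern 0 x = - (sin (pi * x) / pi * (alt_harmonic y - 1 / (2 * y)))"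
    using kern_eq_quot [OF order_refl x] by (simp only: mult_minus_right)
  then show ?thesis
    using False y alt_harmonic_ge [OF y] by (simp add: abs_mult y_def)
qed

section \<open>Fourier integrals of functions of exponential type\<close>

definition laplace :: "(real \<Rightarrow> complex) \<Rightarrow> complex \<Rightarrow> complex" where
  "laplace f s = (\<integral>x. indicator {0..} x *\<^sub>R (exp (- (s * of_real x)) * f x) \<partial>lborel)"

lemma norm_laplace_kernel:
  assumes "0 \<le> Re s"
  shows "norm (indicator {0..} x *\<^sub>R (exp (- (s * of_real x)) * f x)) \<le> norm (f x)"
proof (cases "0 \<le> x")
  case True
  have "cmod (exp (- (s * of_real x))) \<le> 1"
    using True assms by simp
  then show ?thesis using True by (simp add: norm_mult mult_left_le_one_le del: norm_exp_eq_Re)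
qed simp

lemma laplace_measurable [measurable]:
  assumes [measurable]: "f \<in> borel_measurable borel"
  shows "(\<lambda>x. indicator {0..} x *\<^sub>R (exp (- (s * complex_of_real x)) * f x)) \<in> borel_measurable borel"
  by measurable

lemma laplace_integrable:
  assumes f: "integrable lborel f" and s: "0 \<le> Re s"
  shows "integrable lborel (\<lambda>x. indicator {0..} x *\<^sub>R (exp (- (s * of_real x)) * f x))"
proof (rule Bochner_Integration.integrable_bound [OF f])
  have "f \<in> borel_measurable borel" using borel_measurable_integrable [OF f] by simp
  then show "(\<lambda>x. indicator {0..} x *\<^sub>R (exp (- (s * complex_of_real x)) * f x)) \<in> borel_measurable lborel"
    using laplace_measurable [of f s] by simp
qed (use norm_laplace_kernel [OF s] in auto)

text \<open>Continuity up to the line Re s = 0, on which the Fourier integral lives.\<close>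

lemma laplace_tendsto:
  assumes f: "integrable lborel f" and X: "X \<longlonglongrightarrow> s" "\<And>n. 0 \<le> Re (X n)"
  shows "(\<lambda>n. laplace f (X n)) \<longlonglongrightarrow> laplace f s"
  unfolding laplace_def
proof (rule integral_dominated_convergence [where w = "\<lambda>x. norm (f x)"])
  have m: "f \<in> borel_measurable borel" using borel_measurable_integrable [OF f] by simp
  show "(\<lambda>x. indicator {0..} x *\<^sub>R (exp (- (s * complex_of_real x)) * f x)) \<in> borel_measurable lborel"
    "\<And>i. (\<lambda>x. indicator {0..} x *\<^sub>R (exp (- (X i * complex_of_real x)) * f x)) \<in> borel_measurable lborel"
    using laplace_measurable [OF m] by simp_all
  show "integrable lborel (\<lambda>x. norm (f x))" using f by simp
  show "AE x in lborel. (\<lambda>i. indicator {0..} x *\<^sub>R (exp (- (X i * of_real x)) * f x)) \<longlonglongrightarrow>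
      indicator {0..} x *\<^sub>R (exp (- (s * of_real x)) * f x)"
    by (intro always_eventually allI tendsto_intros X)
  show "AE x in lborel. norm (indicator {0..} x *\<^sub>R (exp (- (X i * of_real x)) * f x)) \<le> norm (f x)" for i
    using norm_laplace_kernel [OF X(2)] by auto
qed

text \<open>Integrals over [0, N] are entire by differentiation under the integral sign, and they
  converge uniformly on the half-plane.\<close>

lemma laplace_holomorphic:
  assumes f: "integrable lborel f" and cont: "continuous_on UNIV f"
  shows "laplace f holomorphic_on {s. 0 < Re s}"
proof -
  define L where "L N s = integral (cbox 0 (real N)) (\<lambda>x. exp (- (s * of_real x)) * f x)" for N :: nat and s
  have mf: "f \<in> borel_measurable borel" using borel_measurable_integrable [OF f] by simp
  have L_eq: "L N s = (\<integral>x. indicator {0..real N} x *\<^sub>R (exp (- (s * of_real x)) * f x) \<partial>lborel)" for N s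
  proof -
    have "set_integrable lborel {0..real N} (\<lambda>x. exp (- (s * of_real x)) * f x)"
      by (intro borel_integrable_atLeastAtMost' continuous_intros continuous_on_subset [OF cont]) auto
    then show ?thesis
      using set_borel_integral_eq_integral(2) [of "{0..real N}" "\<lambda>x. exp (- (s * of_real x)) * f x"]
      by (simp add: L_def set_lebesgue_integral_def)
  qed
  have hol: "L N holomorphic_on UNIV" for N
    unfolding L_def
  proof (rule leibniz_rule_holomorphic)
    show "((\<lambda>s. exp (- (s * of_real t)) * f t) has_field_derivative - of_real t * exp (- (s * of_real t)) * f t) (at s within UNIV)" for s t
      by (auto intro!: derivative_eq_intros)
    show "(\<lambda>x. exp (- (s * of_real x)) * f x) integrable_on cbox 0 (real N)" for s
      by (intro integrable_continuous continuous_intros continuous_on_subset [OF cont]) auto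
    have "continuous_on UNIV (\<lambda>p::complex \<times> real. f (snd p))"
      using continuous_on_compose2 [OF cont continuous_on_snd [OF continuous_on_id]] by auto
    then show "continuous_on (UNIV \<times> cbox 0 (real N)) (\<lambda>(s, t). - of_real t * exp (- (s * of_real t)) * f t)"
      unfolding case_prod_unfold
      by (intro continuous_intros) (auto intro: continuous_on_subset)
  qed simp
  \<comment> \<open>A truncation error free of s: on the half-plane the kernel has modulus at most
    1, so cutting at N costs at most this.\<close>
  define tail where "tail N = (\<integral>x. indicator {real N<..} x *\<^sub>R norm (f x) \<partial>lborel)" for N :: nat
  have tail: "tail \<longlonglongrightarrow> 0"
  proof -
    have "(\<lambda>N. \<integral>x. indicator {real N<..} x *\<^sub>R norm (f x) \<partial>lborel) \<longlonglongrightarrow> (\<integral>x. 0 \<partial>(lborel :: real measure))"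
    proof (rule integral_dominated_convergence [where w = "\<lambda>x. norm (f x)"])
      show "AE x in lborel. (\<lambda>N. indicator {real N<..} x *\<^sub>R norm (f x)) \<longlonglongrightarrow> 0"
      proof (intro always_eventually allI)
        fix x :: real
        have "eventually (\<lambda>N. indicator {real N<..} x *\<^sub>R norm (f x) = 0) sequentially"
          using eventually_ge_at_top [of "nat \<lceil>x\<rceil>"]
        proof eventually_elim
          case (elim N)
          then have "x \<le> real N" by linarith
          then show ?case by simp
        qed
        then show "(\<lambda>N. indicator {real N<..} x *\<^sub>R norm (f x)) \<longlonglongrightarrow> 0"
          by (rule tendsto_eventually)
      qed
      show "(\<lambda>x. indicator {real N<..} x *\<^sub>R norm (f x)) \<in> borel_measurable lborel" for N
        using mf by measurable
    qed (use f in \<open>auto simp: indicator_def\<close>)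
    then show ?thesis by (simp add: tail_def [abs_def])
  qed
  have close: "dist (L N s) (laplace f s) \<le> tail N" if s: "0 \<le> Re s" for N s
  proof -
    have i1: "integrable lborel (\<lambda>x. indicator {0..real N} x *\<^sub>R (exp (- (s * of_real x)) * f x))"
      unfolding set_integrable_def [symmetric]
      by (intro borel_integrable_atLeastAtMost' continuous_intros continuous_on_subset [OF cont]) auto
    have i2: "integrable lborel (\<lambda>x. indicator {real N<..} x *\<^sub>R norm (f x))"
      by (rule Bochner_Integration.integrable_bound [OF f]) (use mf in \<open>auto simp: indicator_def\<close>)
    have "laplace f s - L N s = (\<integral>x. indicator {0..} x *\<^sub>R (exp (- (s * of_real x)) * f x)
        - indicator {0..real N} x *\<^sub>R (exp (- (s * of_real x)) * f x) \<partial>lborel)"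
      unfolding laplace_def L_eq
      by (rule Bochner_Integration.integral_diff [symmetric]) (intro laplace_integrable f s, rule i1)
    also have "norm \<dots> \<le> (\<integral>x. indicator {real N<..} x *\<^sub>R norm (f x) \<partial>lborel)"
    proof (rule order.trans [OF integral_norm_bound integral_mono])
      fix x
      show "norm (indicator {0..} x *\<^sub>R (exp (- (s * of_real x)) * f x)
          - indicator {0..real N} x *\<^sub>R (exp (- (s * of_real x)) * f x)) \<le> indicator {real N<..} x *\<^sub>R norm (f x)"
        using norm_laplace_kernel [OF s, of x f] by (auto simp: indicator_def split: if_splits)
    qed (intro integrable_norm Bochner_Integration.integrable_diff laplace_integrable f s i1 i2)+
    finally show ?thesis by (simp add: tail_def dist_norm norm_minus_commute)
  qed
  show ?thesis
  proof (rule holomorphic_uniform_sequence [of _ L])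
    show "open {s. 0 < Re s}" by (rule open_halfspace_Re_gt)
    show "L N holomorphic_on {s. 0 < Re s}" for N by (rule holomorphic_on_subset [OF hol]) simp
    fix s assume "s \<in> {s. 0 < Re s}"
    then have "\<exists>d>0. cball s d \<subseteq> {s. 0 < Re s}"
      using open_halfspace_Re_gt [of 0] by (simp add: open_contains_cball)
    then obtain d where d: "0 < d" "cball s d \<subseteq> {s. 0 < Re s}" by blast
    have "uniform_limit (cball s d) L (laplace f) sequentially"
    proof (rule uniform_limitI)
      fix e :: real assume "0 < e"
      then have "eventually (\<lambda>N. tail N < e) sequentially" using tail by (rule order_tendstoD(2) [rotated])
      then show "eventually (\<lambda>N. \<forall>s\<in>cball s d. dist (L N s) (laplace f s) < e) sequentially"
      proof eventually_elim
        case (elim N)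
        show ?case
        proof
          fix w assume "w \<in> cball s d"
          then have "0 \<le> Re w" using d(2) by auto
          then show "dist (L N w) (laplace f w) < e" using close [of w N] elim by linarith
        qed
      qed
    qed
    with d show "\<exists>d>0. cball s d \<subseteq> {s. 0 < Re s} \<and> uniform_limit (cball s d) L (laplace f) sequentially"
      by blast
  qed
qed

text \<open>The Gamma integral, read off from the total mass 1 of the Erlang density.\<close>

lemma has_bochner_integral_power_exp:
  fixes t :: real
  assumes "0 < t"
  shows "has_bochner_integral lborel (\<lambda>x. indicator {0..} x * (x ^ n * exp (- (t * x)))) (fact n / t ^ Suc n)"
proof -
  have "has_bochner_integral lborel (\<lambda>x. erlang_density n t x) 1"
  proof (rule has_bochner_integral_nn_integral)
    show "(\<integral>\<^sup>+ x. ennreal (erlang_density n t x) \<partial>lborel) = ennreal 1"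
      using nn_integral_erlang_ith_moment [OF assms, where k = n and i = 0] by simp
  qed (use assms in auto)
  from has_bochner_integral_mult_right [OF this, of "fact n / t ^ Suc n"]
  have *: "has_bochner_integral lborel (\<lambda>x. fact n / t ^ Suc n * erlang_density n t x) (fact n / t ^ Suc n)" by simp
  have "(\<lambda>x. fact n / t ^ Suc n * erlang_density n t x) = (\<lambda>x. indicator {0..} x * (x ^ n * exp (- (t * x))))"
  proof
    fix x
    show "fact n / t ^ Suc n * erlang_density n t x = indicator {0..} x * (x ^ n * exp (- (t * x)))"
      using assms by (auto simp: erlang_density_def indicator_def)
  qed
  with * show ?thesis by simp
qed

text \<open>The growth bound has one fixed constant: the locale is entered at an exponent slightly
  above the type. It is instantiated twice, for F(z) and for F(-z), one for each half-line.\<close>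

locale exp_type_series =
  fixes F :: "complex \<Rightarrow> complex" and a :: "nat \<Rightarrow> complex" and C \<sigma> :: real
  assumes sums: "(\<lambda>n. a n * z ^ n) sums F z"
    and holo: "F holomorphic_on UNIV"
    and bound: "cmod (F z) \<le> C * exp (\<sigma> * cmod z)"
    and sigma: "0 < \<sigma>"
    and L1: "integrable lborel (\<lambda>x. F (of_real x))"
begin

lemma coeff_bound:
  assumes r: "0 \<le> r"
  shows "cmod (a n) * r ^ n \<le> C * exp (\<sigma> * r)"
proof (cases "r = 0")
  case True
  have "F 0 = a 0" using sums [of 0] by (simp add: sums_iff)
  moreover have "0 \<le> C" using bound [of 0] by (auto intro: order.trans [OF norm_ge_zero])
  ultimately show ?thesis using bound [of 0] True by (cases n) auto
next
  case False
  then have r: "0 < r" using r by simp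
  have "a n = (deriv ^^ n) F 0 / fact n"
  proof -
    have "F has_fps_expansion Abs_fps a"
      unfolding has_fps_expansion_def
    proof
      have "conv_radius a = \<infinity>"
      proof (rule ccontr)
        assume ne: "conv_radius a \<noteq> \<infinity>"
        then obtain R where R: "conv_radius a < ereal R" by (auto simp: less_PInf_Ex_of_nat)
        have "0 \<le> conv_radius a" by (rule conv_radius_nonneg)
        then have "conv_radius a < ereal (norm (complex_of_real R))"
          using R by (auto intro: less_le_trans)
        then have "\<not> summable (\<lambda>n. a n * of_real R ^ n)"
          by (rule not_summable_outside_conv_radius)
        then show False using sums [of "of_real R"] by (simp add: sums_iff)
      qed
      then show "0 < fps_conv_radius (Abs_fps a)" by (simp add: fps_conv_radius_def)
      show "eventually (\<lambda>z. eval_fps (Abs_fps a) z = F z) (nhds 0)"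
        using sums by (auto simp: eval_fps_def sums_iff intro!: always_eventually)
    qed
    from fps_nth_fps_expansion [OF this, of n] show ?thesis by simp
  qed
  moreover have "cmod ((deriv ^^ n) F 0) \<le> fact n * (C * exp (\<sigma> * r)) / r ^ n"
  proof (rule Cauchy_inequality)
    show "F holomorphic_on ball 0 r" "continuous_on (cball 0 r) F"
      using holo by (auto intro: holomorphic_on_subset holomorphic_on_imp_continuous_on)
    show "cmod (F x) \<le> C * exp (\<sigma> * r)" if "cmod (0 - x) = r" for x
      using bound [of x] that by simp
  qed (rule r)
  ultimately have "fact n * cmod (a n) \<le> fact n * (C * exp (\<sigma> * r) / r ^ n)"
    by (simp add: norm_divide)
  then have "cmod (a n) \<le> C * exp (\<sigma> * r) / r ^ n" by (rule mult_left_le_imp_le) simp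
  then show ?thesis using r by (simp add: field_simps)
qed

text \<open>Cauchy's inequality for radius x is integrated against exp(-t x) over x \<ge> 0. The
  factorial appears by itself as a Gamma integral, so no asymptotics of n! are involved.\<close>

lemma borel_coeff_bound:
  assumes t: "\<sigma> < t"
  shows "cmod (a n) * (fact n / t ^ Suc n) \<le> C / (t - \<sigma>)"
proof -
  have "0 < t" using t sigma by simp
  have 1: "has_bochner_integral lborel (\<lambda>x. cmod (a n) * (indicator {0..} x * (x ^ n * exp (- (t * x)))))
      (cmod (a n) * (fact n / t ^ Suc n))"
    using \<open>0 < t\<close> by (intro has_bochner_integral_mult_right has_bochner_integral_power_exp)
  have 2: "has_bochner_integral lborel (\<lambda>x. C * (indicator {0..} x * (x ^ 0 * exp (- ((t - \<sigma>) * x)))))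
      (C * (fact 0 / (t - \<sigma>) ^ Suc 0))"
    by (intro has_bochner_integral_mult_right has_bochner_integral_power_exp) (use t in simp)
  have "cmod (a n) * (indicator {0..} x * (x ^ n * exp (- (t * x))))
      \<le> C * (indicator {0..} x * (x ^ 0 * exp (- ((t - \<sigma>) * x))))" for x
  proof (cases "0 \<le> x")
    case True
    have "cmod (a n) * x ^ n * exp (- (t * x)) \<le> C * exp (\<sigma> * x) * exp (- (t * x))"
      by (intro mult_right_mono coeff_bound True) simp
    then show ?thesis using True by (simp add: mult.assoc exp_add [symmetric] algebra_simps)
  qed simp
  then have "integral\<^sup>L lborel (\<lambda>x. cmod (a n) * (indicator {0..} x * (x ^ n * exp (- (t * x)))))
      \<le> integral\<^sup>L lborel (\<lambda>x. C * (indicator {0..} x * (x ^ 0 * exp (- ((t - \<sigma>) * x)))))"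
    using 1 2 by (intro integral_mono) (auto simp: has_bochner_integral_iff)
  then show ?thesis
    using has_bochner_integral_integral_eq [OF 1] has_bochner_integral_integral_eq [OF 2] by simp
qed

lemma borel_summable:
  assumes s: "\<sigma> < t"
  shows "summable (\<lambda>n. cmod (a n) * (fact n / t ^ Suc n))"
proof (rule summable_comparison_test')
  \<comment> \<open>The coefficient bound at a radius strictly between \<sigma> and t leaves the
    geometric factor (r/t)^(n+1).\<close>
  define r where "r = (\<sigma> + t) / 2"
  have r: "\<sigma> < r" "r < t" "0 < r" using s sigma by (auto simp: r_def)
  show "summable (\<lambda>n. C / (r - \<sigma>) * ((r / t) ^ Suc n))"
    using r by (intro summable_mult summable_Suc_iff [THEN iffD2] summable_geometric) auto
  fix n
  have "cmod (a n) * (fact n / t ^ Suc n) = cmod (a n) * (fact n / r ^ Suc n) * (r / t) ^ Suc n"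
    using r by (simp add: power_divide field_simps)
  also have "\<dots> \<le> C / (r - \<sigma>) * (r / t) ^ Suc n"
    using r by (intro mult_right_mono borel_coeff_bound) auto
  finally show "norm (cmod (a n) * (fact n / t ^ Suc n)) \<le> C / (r - \<sigma>) * (r / t) ^ Suc n"
    using r by simp
qed

definition borel where "borel s = (\<Sum>n. a n * fact n / s ^ Suc n)"

lemma laplace_eq_borel_real:
  assumes t: "\<sigma> < t"
  shows "laplace (\<lambda>x. F (of_real x)) (of_real t) = borel (of_real t)"
proof -
  have "0 < t" using t sigma by simp
  define g where "g n x = a n * of_real (indicator {0..} x * (x ^ n * exp (- (t * x))))" for n and x :: real
  have hb: "has_bochner_integral lborel (g n) (a n * of_real (fact n / t ^ Suc n))" for n
    unfolding g_def by (intro has_bochner_integral_mult_right has_bochner_integral_of_real has_bochner_integral_power_exp \<open>0 < t\<close>)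
  have hn: "has_bochner_integral lborel (\<lambda>x. norm (g n x)) (cmod (a n) * (fact n / t ^ Suc n))" for n
  proof -
    have "(\<lambda>x. norm (g n x)) = (\<lambda>x. cmod (a n) * (indicator {0..} x * (x ^ n * exp (- (t * x)))))"
      by (intro ext) (auto simp: g_def norm_mult norm_power indicator_def)
    then show ?thesis
      using has_bochner_integral_mult_right [OF has_bochner_integral_power_exp [OF \<open>0 < t\<close>], of "cmod (a n)" n] by simp
  qed
  have gs: "(\<lambda>n. g n x) sums (indicator {0..} x *\<^sub>R (exp (- (of_real t * of_real x)) * F (of_real x)))" for x
  proof -
    have "g n x = of_real (indicator {0..} x) * exp (- (of_real t * of_real x)) * (a n * of_real x ^ n)" for n
      by (simp add: g_def mult_ac flip: exp_of_real)
    then show ?thesis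
      using sums_mult [OF sums [of "of_real x"], of "of_real (indicator {0..} x) * exp (- (of_real t * of_real x))"]
      by (simp add: scaleR_conv_of_real mult.assoc)
  qed
  have abs: "summable (\<lambda>n. norm (g n x))" for x
  proof -
    have "summable (\<lambda>n. norm (a n * of_real x ^ n))"
    proof (rule powser_insidea)
      show "summable (\<lambda>n. a n * of_real (\<bar>x\<bar> + 1) ^ n)" using sums by (rule sums_summable)
      have "cmod (of_real (\<bar>x\<bar> + 1)) = \<bar>x\<bar> + 1" unfolding norm_of_real by simp
      then show "norm (complex_of_real x) < norm (complex_of_real (\<bar>x\<bar> + 1))" by simp
    qed
    from summable_mult [OF this, of "indicator {0..} x * exp (- (t * x))"] show ?thesis
      by (simp add: g_def norm_mult norm_power indicator_def mult_ac abs_mult power_abs)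
  qed
  have "(\<lambda>n. integral\<^sup>L lborel (g n)) sums (\<integral>x. (\<Sum>n. g n x) \<partial>lborel)"
  proof (rule sums_integral)
    show "integrable lborel (g n)" for n using hb by (auto simp: has_bochner_integral_iff)
    show "summable (\<lambda>n. \<integral>x. norm (g n x) \<partial>lborel)"
      using hn borel_summable [OF t] by (simp add: has_bochner_integral_iff)
  qed (use abs in auto)
  moreover have "(\<Sum>n. g n x) = indicator {0..} x *\<^sub>R (exp (- (of_real t * of_real x)) * F (of_real x))" for x
    using gs [of x] by (simp add: sums_iff)
  moreover have "integral\<^sup>L lborel (g n) = a n * fact n / of_real t ^ Suc n" for n
    using has_bochner_integral_integral_eq [OF hb [of n]] by simp
  ultimately show ?thesis
    by (simp add: laplace_def borel_def sums_iff)
qed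

lemma borel_holomorphic: "borel holomorphic_on {s. \<sigma> < cmod s}"
proof -
  define g where "g w = (\<Sum>n. a n * fact n * w ^ n)" for w
  have "g holomorphic_on ball 0 (1 / \<sigma>)"
  proof (rule power_series_holomorphic)
    fix w :: complex assume "w \<in> ball 0 (1 / \<sigma>)"
    then have w: "cmod w < 1 / \<sigma>" by simp
    have "summable (\<lambda>n. a n * fact n * w ^ n)"
    proof (cases "w = 0")
      case True
      then show ?thesis by (intro summable_finite [of "{0}"]) auto
    next
      case False
      then have "\<sigma> < 1 / cmod w" using w sigma by (simp add: field_simps)
      have "1 / cmod w * (cmod (a n) * (fact n / (1 / cmod w) ^ Suc n)) = norm (a n * fact n * w ^ n)" for n
        using False by (simp add: norm_mult norm_power power_one_over)
      then have "summable (\<lambda>n. norm (a n * fact n * w ^ n))"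
        using summable_mult [OF borel_summable [OF \<open>\<sigma> < 1 / cmod w\<close>], of "1 / cmod w"] by (simp only:)
      then show ?thesis by (rule summable_norm_cancel)
    qed
    then show "(\<lambda>n. a n * fact n * (w - 0) ^ n) sums g w"
      by (simp add: g_def summable_sums)
  qed
  moreover have inv: "(\<lambda>s. 1 / s) holomorphic_on {s. \<sigma> < cmod s}"
    using sigma by (intro holomorphic_on_divide holomorphic_on_const holomorphic_on_ident) auto
  ultimately have "(g \<circ> (\<lambda>s. 1 / s)) holomorphic_on {s. \<sigma> < cmod s}"
    using sigma by (intro holomorphic_on_compose_gen [of _ _ g "ball 0 (1 / \<sigma>)"])
      (auto simp: norm_divide intro!: frac_less2)
  from holomorphic_on_mult [OF inv this]
  have "(\<lambda>s. (1 / s) * (g \<circ> (\<lambda>s. 1 / s)) s) holomorphic_on {s. \<sigma> < cmod s}" .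
  then show ?thesis
  proof (rule holomorphic_transform)
    fix s assume "s \<in> {s. \<sigma> < cmod s}"
    then have s: "\<sigma> < cmod s" by simp
    then have "s \<noteq> 0" using sigma by auto
    have "summable (\<lambda>n. a n * fact n * (1 / s) ^ n)"
    proof (rule summable_norm_cancel)
      have "cmod s * (cmod (a n) * (fact n / cmod s ^ Suc n)) = norm (a n * fact n * (1 / s) ^ n)" for n
        using \<open>s \<noteq> 0\<close> by (simp add: norm_mult norm_power norm_divide power_one_over)
      then show "summable (\<lambda>n. norm (a n * fact n * (1 / s) ^ n))"
        using summable_mult [OF borel_summable [OF s], of "cmod s"] by (simp only:)
    qed
    from suminf_mult [OF this, of "1 / s"]
    show "1 / s * (g \<circ> (\<lambda>s. 1 / s)) s = borel s"
      by (simp add: borel_def g_def power_divide)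
  qed
qed

text \<open>Analytic continuation; the substitution \<open>s = exp w\<close> makes the domain convex.\<close>

lemma laplace_eq_borel_right:
  assumes s: "0 < Re s" "\<sigma> < cmod s"
  shows "laplace (\<lambda>x. F (of_real x)) s = borel s"
proof -
  let ?f = "\<lambda>x. F (of_real x)"
  \<comment> \<open>The exponential maps this half-strip onto the part of the right half-plane
    outside the disc; \<open>U\<close> corresponds to the real ray on which termwise integration has
    already given equality.\<close>
  define S where "S = {w. ln \<sigma> < Re w} \<inter> ({w. - (pi / 2) < Im w} \<inter> {w. Im w < pi / 2})"
  define U where "U = complex_of_real ` {ln \<sigma><..}"
  have cont: "continuous_on UNIV ?f"
    using continuous_on_compose2 [OF holomorphic_on_imp_continuous_on [OF holo] continuous_on_of_real_id] by simp
  have dom: "0 < Re (exp w)" "\<sigma> < cmod (exp w)" if "w \<in> S" for w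
  proof -
    have "0 < cos (Im w)" using that by (intro cos_gt_zero_pi) (auto simp: S_def)
    then show "0 < Re (exp w)" by (simp add: Re_exp)
    have "exp (ln \<sigma>) < exp (Re w)" using that by (simp add: S_def)
    then show "\<sigma> < cmod (exp w)" using sigma by simp
  qed
  have 1: "(laplace ?f \<circ> exp) holomorphic_on S"
    by (rule holomorphic_on_compose_gen [OF holomorphic_on_exp laplace_holomorphic [OF L1 cont]])
      (use dom in auto)
  have 2: "(borel \<circ> exp) holomorphic_on S"
    by (rule holomorphic_on_compose_gen [OF holomorphic_on_exp borel_holomorphic])
      (use dom in auto)
  define h where "h w = (laplace ?f \<circ> exp) w - (borel \<circ> exp) w" for w
  have "h (Ln s) = 0"
  proof (rule analytic_continuation [of h S U "of_real (ln \<sigma> + 1)"])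
    show "h holomorphic_on S" unfolding h_def by (intro holomorphic_on_diff 1 2)
    show "open S" unfolding S_def
      by (intro open_Int open_halfspace_Re_gt open_halfspace_Im_gt open_halfspace_Im_lt)
    show "connected S" unfolding S_def
      by (intro convex_connected convex_Int convex_halfspace_Re_gt convex_halfspace_Im_gt convex_halfspace_Im_lt)
    show "U \<subseteq> S" "of_real (ln \<sigma> + 1) \<in> S" by (auto simp: U_def S_def)
    show "of_real (ln \<sigma> + 1) islimpt U"
      unfolding islimpt_approachable
    proof (intro allI impI)
      fix e :: real assume "0 < e"
      then show "\<exists>x'\<in>U. x' \<noteq> of_real (ln \<sigma> + 1) \<and> dist x' (of_real (ln \<sigma> + 1)) < e"
        by (intro bexI [of _ "of_real (ln \<sigma> + 1 + e / 2)"])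
          (auto simp: U_def dist_of_real dist_real_def simp del: of_real_add of_real_divide)
    qed
    show "h z = 0" if "z \<in> U" for z
    proof -
      obtain r where r: "z = of_real r" "ln \<sigma> < r" using \<open>z \<in> U\<close> by (auto simp: U_def)
      then have "\<sigma> < exp r" using sigma by (metis exp_less_cancel_iff exp_ln)
      from laplace_eq_borel_real [OF this] show ?thesis
        by (simp add: h_def r exp_of_real)
    qed
    have "s \<noteq> 0" using s by auto
    then have "\<bar>Im (Ln s)\<bar> < pi / 2" using Re_Ln_pos_lt s by blast
    moreover have "ln \<sigma> < Re (Ln s)" using \<open>s \<noteq> 0\<close> s sigma by simp
    ultimately show "Ln s \<in> S" by (auto simp: S_def)
  qed
  moreover have "exp (Ln s) = s" using s by (intro exp_Ln) auto
  ultimately show ?thesis by (simp add: h_def)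
qed

text \<open>Equality extends to Re s = 0 because both sides are continuous along a sequence
  approaching s from the right.\<close>

lemma laplace_eq_borel:
  assumes s: "0 \<le> Re s" "\<sigma> < cmod s"
  shows "laplace (\<lambda>x. F (of_real x)) s = borel s"
proof -
  define X where "X n = s + of_real (1 / real (Suc n))" for n
  have X: "X \<longlonglongrightarrow> s"
  proof -
    have "(\<lambda>n. s + complex_of_real (1 / real (Suc n))) \<longlonglongrightarrow> s + of_real 0"
      by (intro tendsto_intros LIMSEQ_Suc lim_1_over_n)
    then show ?thesis by (simp add: X_def [abs_def])
  qed
  have Re: "0 < Re (X n)" for n using s by (simp add: X_def add_nonneg_pos)
  have lim: "(\<lambda>n. laplace (\<lambda>x. F (of_real x)) (X n)) \<longlonglongrightarrow> laplace (\<lambda>x. F (of_real x)) s"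
    using Re by (intro laplace_tendsto L1 X) (auto intro: less_imp_le)
  have "open {s. \<sigma> < cmod s}" by (intro open_Collect_less continuous_intros)
  moreover from this have "isCont borel s"
    using holomorphic_on_imp_continuous_on [OF borel_holomorphic] s
    by (simp add: continuous_on_eq_continuous_at)
  ultimately have "(\<lambda>n. borel (X n)) \<longlonglongrightarrow> borel s"
    using X by (auto intro: isCont_tendsto_compose)
  moreover have "eventually (\<lambda>n. \<sigma> < cmod (X n)) sequentially"
    using order_tendstoD(1) [OF tendsto_norm [OF X] s(2)] .
  then have "eventually (\<lambda>n. borel (X n) = laplace (\<lambda>x. F (of_real x)) (X n)) sequentially"
    by eventually_elim (simp add: laplace_eq_borel_right Re)
  ultimately have "(\<lambda>n. laplace (\<lambda>x. F (of_real x)) (X n)) \<longlonglongrightarrow> borel s"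
    by (simp add: tendsto_cong)
  then show ?thesis using lim by (rule LIMSEQ_unique [rotated])
qed

end

lemma integral_split_at_0:
  fixes f :: "real \<Rightarrow> complex"
  assumes f: "integrable lborel f"
  shows "(\<integral>x. f x \<partial>lborel) = (\<integral>x. indicator {0..} x *\<^sub>R f x \<partial>lborel) + (\<integral>x. indicator {0..} x *\<^sub>R f (- x) \<partial>lborel)"
proof -
  have m: "f \<in> borel_measurable borel" using borel_measurable_integrable [OF f] by simp
  have i: "integrable lborel (\<lambda>x. indicator A x *\<^sub>R f x)" if "A \<in> sets borel" for A
    using that by (intro integrable_mult_indicator f) auto
  have "(\<integral>x. f x \<partial>lborel) = (\<integral>x. indicator {0..} x *\<^sub>R f x + indicator {..<0} x *\<^sub>R f x \<partial>lborel)"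
    by (intro Bochner_Integration.integral_cong) (auto simp: indicator_def)
  also have "\<dots> = (\<integral>x. indicator {0..} x *\<^sub>R f x \<partial>lborel) + (\<integral>x. indicator {..<0} x *\<^sub>R f x \<partial>lborel)"
    by (intro Bochner_Integration.integral_add i) auto
  also have "(\<integral>x. indicator {..<0} x *\<^sub>R f x \<partial>lborel) = (\<integral>x. indicator {..<0} (- x) *\<^sub>R f (- x) \<partial>lborel)"
    using lborel_integral_real_affine [of "- 1" "\<lambda>x. indicator {..<0} x *\<^sub>R f x" 0] by simp
  also have "\<dots> = (\<integral>x. indicator {0..} x *\<^sub>R f (- x) \<partial>lborel)"
  proof (rule integral_cong_AE)
    have "AE x in lborel. x \<noteq> (0 :: real)" by (rule AE_lborel_singleton)
    then show "AE x in lborel. indicator {..<0} (- x) *\<^sub>R f (- x) = indicator {0..} x *\<^sub>R f (- x)"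
      by eventually_elim (auto simp: indicator_def)
  qed (use m in measurable)
  finally show ?thesis .
qed

text \<open>The two half-line Laplace transforms of \<open>F\<close> continue to the same function, the Borel
  transform, outside the disc of radius \<open>\<sigma>\<close>; this replaces the Paley--Wiener theorem.\<close>

lemma fourier_vanish_outside:
  assumes F: "exp_type_le \<sigma> F" and \<sigma>: "0 \<le> \<sigma>" and L1: "integrable lborel (\<lambda>x. F (of_real x))"
    and \<tau>: "\<sigma> < \<bar>\<tau>\<bar>"
  shows "(\<integral>x. F (of_real x) * iexp (\<tau> * x) \<partial>lborel) = 0"
proof -
  \<comment> \<open>Strictly between the type and the frequency: above the type one growth constant
    suffices, and below the frequency the point s stays outside the disc.\<close>
  define \<rho> where "\<rho> = (\<sigma> + \<bar>\<tau>\<bar>) / 2"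
  have \<rho>: "\<sigma> < \<rho>" "\<rho> < \<bar>\<tau>\<bar>" "0 < \<rho>" using \<tau> \<sigma> by (auto simp: \<rho>_def)
  have holo: "F holomorphic_on UNIV" using F by (simp add: exp_type_le_def)
  obtain C where C: "\<And>z. cmod (F z) \<le> C * exp (\<rho> * cmod z)"
    using F \<rho>(1) unfolding exp_type_le_def by (metis diff_gt_0_iff_gt add.commute diff_add_cancel)
  define a where "a n = (deriv ^^ n) F 0 / fact n" for n
  have sums: "(\<lambda>n. a n * z ^ n) sums F z" for z
    using holomorphic_power_series [of F 0 "cmod z + 1" z] holo
    by (auto simp: a_def intro: holomorphic_on_subset)
  interpret P: exp_type_series F a C \<rho>
    by unfold_locales (use sums holo C \<rho> L1 in auto)
  have L1': "integrable lborel (\<lambda>x. F (- of_real x))"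
    using lborel_integrable_real_affine [OF L1, of "- 1" 0] by simp
  interpret M: exp_type_series "\<lambda>z. F (- z)" "\<lambda>n. (- 1) ^ n * a n" C \<rho>
  proof unfold_locales
    show "(\<lambda>n. (- 1) ^ n * a n * z ^ n) sums F (- z)" for z
      using sums [of "- z"] by (simp add: power_minus [of z] mult_ac)
    show "(\<lambda>z. F (- z)) holomorphic_on UNIV"
      using holomorphic_on_compose [of uminus UNIV F] holo
      by (simp add: o_def holomorphic_on_minus holomorphic_on_ident holomorphic_on_subset)
    show "cmod (F (- z)) \<le> C * exp (\<rho> * cmod z)" for z using C [of "- z"] by simp
  qed (use \<rho> L1' in auto)
  define s where "s = - (\<i> * of_real \<tau>)"
  have s: "\<rho> < cmod s" "Re s = 0" using \<rho> by (auto simp: s_def norm_mult)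
  \<comment> \<open>The coefficient of F(-z) carries (-1)^n and the denominator (-1)^(n+1). The
    half-line transforms at s and -s are therefore opposite values of one function, and their sum,
    the Fourier integral, is 0.\<close>
  have "M.borel (- s) = - P.borel s"
  proof -
    have "summable (\<lambda>n. a n * fact n / s ^ Suc n)"
    proof (rule summable_norm_cancel)
      show "summable (\<lambda>n. norm (a n * fact n / s ^ Suc n))"
        using P.borel_summable [OF s(1)] by (simp add: norm_divide norm_mult norm_power)
    qed
    then have "- P.borel s = (\<Sum>n. - (a n * fact n / s ^ Suc n))"
      unfolding P.borel_def by (rule suminf_minus [symmetric])
    also have "\<dots> = M.borel (- s)"
      unfolding M.borel_def
    proof (intro suminf_cong)
      fix n
      show "- (a n * fact n / s ^ Suc n) = (- 1) ^ n * a n * fact n / (- s) ^ Suc n"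
        by (cases "even n") auto
    qed
    finally show ?thesis ..
  qed
  then have sum0: "laplace (\<lambda>x. F (of_real x)) s + laplace (\<lambda>x. F (- of_real x)) (- s) = 0"
    using P.laplace_eq_borel [of s] M.laplace_eq_borel [of "- s"] s by simp
  have "integrable lborel (\<lambda>x. F (of_real x) * iexp (\<tau> * x))"
    by (rule Bochner_Integration.integrable_bound [OF L1])
      (use borel_measurable_integrable [OF L1] in \<open>auto simp: norm_mult\<close>)
  from integral_split_at_0 [OF this]
  have "(\<integral>x. F (of_real x) * iexp (\<tau> * x) \<partial>lborel) =
      laplace (\<lambda>x. F (of_real x)) s + laplace (\<lambda>x. F (- of_real x)) (- s)"
    by (simp add: laplace_def s_def mult_ac)
  with sum0 show ?thesis by simp
qed

text \<open>The edge frequency is reached by continuity in \<tau>. It cannot be spared: with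
  \<sigma> = pi, the fundamental sin(pi x) of the square wave lies exactly on the edge.\<close>

lemma fourier_vanish:
  assumes F: "exp_type_le \<sigma> F" and \<sigma>: "0 \<le> \<sigma>" and L1: "integrable lborel (\<lambda>x. F (of_real x))"
    and \<tau>: "\<sigma> \<le> \<bar>\<tau>\<bar>"
  shows "(\<integral>x. F (of_real x) * iexp (\<tau> * x) \<partial>lborel) = 0"
proof -
  \<comment> \<open>The sequence approaches \<tau> from the side away from 0, so its members lie
    strictly outside the band.\<close>
  define X where "X n = \<tau> + (if 0 \<le> \<tau> then 1 else - 1) * (1 / real (Suc n))" for n
  have X: "X \<longlonglongrightarrow> \<tau>"
  proof -
    have "(\<lambda>n. \<tau> + (if 0 \<le> \<tau> then 1 else - 1) * (1 / real (Suc n))) \<longlonglongrightarrow> \<tau> + (if 0 \<le> \<tau> then 1 else - 1) * 0"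
      by (intro tendsto_intros LIMSEQ_Suc lim_1_over_n)
    then show ?thesis by (simp add: X_def [abs_def])
  qed
  have "\<bar>\<tau>\<bar> < \<bar>X n\<bar>" for n
  proof -
    define d where "d = 1 / real (Suc n)"
    have "0 < d" by (simp add: d_def)
    then show ?thesis unfolding X_def d_def [symmetric] by auto
  qed
  then have 0: "(\<integral>x. F (of_real x) * iexp (X n * x) \<partial>lborel) = 0" for n
    using \<tau> by (intro fourier_vanish_outside [OF F \<sigma> L1]) (meson order.strict_trans1)
  have "(\<lambda>n. \<integral>x. F (of_real x) * iexp (X n * x) \<partial>lborel) \<longlonglongrightarrow> (\<integral>x. F (of_real x) * iexp (\<tau> * x) \<partial>lborel)"
  proof (rule integral_dominated_convergence [where w = "\<lambda>x. norm (F (of_real x))"])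
    show "AE x in lborel. (\<lambda>n. F (of_real x) * iexp (X n * x)) \<longlonglongrightarrow> F (of_real x) * iexp (\<tau> * x)"
      by (intro always_eventually allI tendsto_intros X)
  qed (use L1 borel_measurable_integrable [OF L1] in \<open>auto simp: norm_mult\<close>)
  then show ?thesis unfolding 0 by (simp add: LIMSEQ_const_iff)
qed

section \<open>Orthogonality to the square wave\<close>

text \<open>The sine coefficients of pi/4 times the square wave sgn(sin t).\<close>

definition odd_coeff :: "nat \<Rightarrow> real" where
  "odd_coeff n = (if odd n then 1 / real n else 0)"

text \<open>The Abel mean of that Fourier series in closed form, the imaginary part of artanh(r
  e^(it)). Two separate logarithms give at once a bound independent of r and a limit as r tends to
  1.\<close>

definition smooth_square_wave :: "real \<Rightarrow> real \<Rightarrow> real" where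
  "smooth_square_wave r t = (Im (Ln (1 + of_real r * cis t)) - Im (Ln (1 - of_real r * cis t))) / 2"

lemma smooth_square_wave_sums:
  assumes r: "0 \<le> r" "r < 1"
  shows "(\<lambda>n. odd_coeff n * r ^ n * sin (real n * t)) sums smooth_square_wave r t"
proof -
  define z where "z = complex_of_real r * cis t"
  have z: "cmod z < 1" using r by (simp add: z_def norm_mult)
  have "(\<lambda>n. ((- 1) ^ Suc n / of_nat n * z ^ n - (- 1) ^ Suc n / of_nat n * (- z) ^ n) / 2) sums ((Ln (1 + z) - Ln (1 + - z)) / 2)"
    using z by (intro sums_divide sums_diff Ln_series) auto
  then have "(\<lambda>n. Im (((- 1) ^ Suc n / of_nat n * z ^ n - (- 1) ^ Suc n / of_nat n * (- z) ^ n) / 2)) sums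
      Im ((Ln (1 + z) - Ln (1 + - z)) / 2)"
    by (rule sums_Im)
  moreover have "Im (((- 1) ^ Suc n / of_nat n * z ^ n - (- 1) ^ Suc n / of_nat n * (- z) ^ n) / 2) =
      odd_coeff n * r ^ n * sin (real n * t)" for n
  proof (cases "odd n")
    case True
    then have "((- 1) ^ Suc n / of_nat n * z ^ n - (- 1) ^ Suc n / of_nat n * (- z) ^ n) / 2 =
        of_real (1 / real n * r ^ n) * cis (real n * t)"
      by (simp add: z_def power_mult_distrib Complex.DeMoivre)
    then have "Im (((- 1) ^ Suc n / of_nat n * z ^ n - (- 1) ^ Suc n / of_nat n * (- z) ^ n) / 2) =
        1 / real n * r ^ n * sin (real n * t)"
      by (simp only: times_complex.sel Re_complex_of_real Im_complex_of_real cis.sel mult_zero_left add_0_right)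
    then show ?thesis using True by (simp add: odd_coeff_def)
  next
    case False
    then show ?thesis by (simp add: odd_coeff_def)
  qed
  ultimately show ?thesis by (simp add: smooth_square_wave_def z_def)
qed

lemma abs_smooth_square_wave_le:
  assumes "0 \<le> r" "r < 1"
  shows "\<bar>smooth_square_wave r t\<bar> \<le> pi"
proof -
  have "\<bar>Im (Ln w)\<bar> \<le> pi" if "w \<noteq> 0" for w
    using Im_Ln_le_pi [OF that] mpi_less_Im_Ln [OF that] by simp
  moreover have "1 + complex_of_real r * cis t \<noteq> 0" "1 - complex_of_real r * cis t \<noteq> 0"
  proof -
    have "cmod (complex_of_real r * cis t) < 1" using assms by (simp add: norm_mult)
    then show "1 + complex_of_real r * cis t \<noteq> 0" "1 - complex_of_real r * cis t \<noteq> 0"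
      by (auto simp: add_eq_0_iff)
  qed
  ultimately have "\<bar>Im (Ln (1 + complex_of_real r * cis t))\<bar> \<le> pi" "\<bar>Im (Ln (1 - complex_of_real r * cis t))\<bar> \<le> pi"
    by blast+
  then show ?thesis
    using abs_triangle_ineq4 [of "Im (Ln (1 + complex_of_real r * cis t))" "Im (Ln (1 - complex_of_real r * cis t))"]
    unfolding smooth_square_wave_def by simp
qed

lemma cos_zero_eq_half_pi:
  assumes "cos y = 0" "0 < sin y" "\<bar>y\<bar> < pi"
  shows "y = pi / 2"
proof -
  have "0 < y"
  proof (rule ccontr)
    assume "\<not> 0 < y"
    then have "0 \<le> sin (- y)" using assms by (intro sin_ge_zero) auto
    then show False using assms by simp
  qed
  then show ?thesis using assms cos_inj_pi [of y "pi / 2"] by simp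
qed

text \<open>At r = 1 the quotient (1 + e^(it))/(1 - e^(it)) equals i sin t/(1 - cos t), which is
  purely imaginary. Both 1 + e^(it) and 1 - e^(it) lie in the right half-plane, so the difference of
  their arguments is below pi in modulus and must be pi/2 with the sign of sin t.\<close>

lemma smooth_square_wave_tendsto:
  assumes t: "sin t \<noteq> 0" and R: "R \<longlonglongrightarrow> 1"
  shows "(\<lambda>k. smooth_square_wave (R k) t) \<longlonglongrightarrow> pi / 4 * sgn (sin t)"
proof -
  have cos: "- 1 < cos t" "cos t < 1"
  proof -
    have "cos t \<noteq> 1" "cos t \<noteq> - 1" using t sin_cos_squared_add [of t] by (auto simp: power2_eq_square)
    then show "- 1 < cos t" "cos t < 1" using cos_le_one [of t] cos_ge_minus_one [of t] by linarith+
  qed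
  define p where "p = 1 + cis t"
  define m where "m = 1 - cis t"
  have Re: "0 < Re p" "0 < Re m" using cos by (auto simp: p_def m_def)
  then have np: "p \<notin> \<real>\<^sub>\<le>\<^sub>0" "m \<notin> \<real>\<^sub>\<le>\<^sub>0" "p \<noteq> 0" "m \<noteq> 0"
    by (auto simp: complex_nonpos_Reals_iff)
  define d where "d = Ln p - Ln m"
  have d: "\<bar>Im d\<bar> < pi"
  proof -
    have "\<bar>Im (Ln p)\<bar> < pi / 2" "\<bar>Im (Ln m)\<bar> < pi / 2"
      using Re_Ln_pos_lt np Re by blast+
    then show ?thesis
      using abs_triangle_ineq4 [of "Im (Ln p)" "Im (Ln m)"] unfolding d_def by simp
  qed
  have "exp d = p / m" using np by (simp add: d_def exp_diff)
  also have "\<dots> = \<i> * of_real (sin t / (1 - cos t))"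
  proof -
    have "p = m * (\<i> * of_real (sin t / (1 - cos t)))"
    proof (rule complex_eqI)
      have "sin t * (sin t / (1 - cos t)) = 1 + cos t"
      proof -
        have "sin t * sin t = (1 + cos t) * (1 - cos t)"
          using sin_cos_squared_add [of t] by (simp add: power2_eq_square algebra_simps)
        then show ?thesis using cos by (simp add: field_simps)
      qed
      then show "Re p = Re (m * (\<i> * of_real (sin t / (1 - cos t))))"
        by (simp add: p_def m_def)
      show "Im p = Im (m * (\<i> * of_real (sin t / (1 - cos t))))"
        using cos by (simp add: p_def m_def)
    qed
    then show ?thesis using np by (simp add: field_simps)
  qed
  finally have e: "exp d = \<i> * of_real (sin t / (1 - cos t))" .
  have "exp (Re d) * cos (Im d) = 0" using arg_cong [OF e, of Re] by (simp add: Re_exp)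
  then have c0: "cos (Im d) = 0" by simp
  have s0: "exp (Re d) * sin (Im d) = sin t / (1 - cos t)" using arg_cong [OF e, of Im] by (simp add: Im_exp)
  have Imd: "Im d = pi / 2 * sgn (sin t)"
  proof (cases "0 < sin t")
    case True
    then have "0 < exp (Re d) * sin (Im d)" using cos s0 by simp
    then have "0 < sin (Im d)" by (simp add: zero_less_mult_iff)
    then show ?thesis using cos_zero_eq_half_pi [OF c0 _ d] True by simp
  next
    case False
    then have neg: "sin t < 0" using t by simp
    then have "exp (Re d) * sin (Im d) < 0" using cos s0 by (simp add: divide_neg_pos)
    then have "0 < sin (- Im d)" by (simp add: mult_less_0_iff)
    then have "- Im d = pi / 2" using c0 d by (intro cos_zero_eq_half_pi) auto
    then show ?thesis using neg by simp
  qed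
  have lim: "(\<lambda>k. (Im (Ln (1 + of_real (R k) * cis t)) - Im (Ln (1 - of_real (R k) * cis t))) / 2)
      \<longlonglongrightarrow> (Im (Ln (1 + of_real 1 * cis t)) - Im (Ln (1 - of_real 1 * cis t))) / 2"
    using np by (intro tendsto_intros R) (auto simp: p_def m_def)
  have "(Im (Ln (1 + of_real 1 * cis t)) - Im (Ln (1 - of_real 1 * cis t))) / 2 = Im d / 2"
    by (simp add: d_def p_def m_def)
  also have "\<dots> = pi / 4 * sgn (sin t)" by (simp add: Imd)
  finally show ?thesis using lim unfolding smooth_square_wave_def by (simp only:)
qed

lemma smooth_square_wave_measurable [measurable]:
  assumes "0 \<le> r" "r < 1"
  shows "(\<lambda>x. smooth_square_wave r (pi * x)) \<in> borel_measurable borel"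
proof -
  have "(\<lambda>x. smooth_square_wave r (pi * x)) = (\<lambda>x. \<Sum>n. odd_coeff n * r ^ n * sin (real n * (pi * x)))"
    using smooth_square_wave_sums [OF assms] by (auto simp: sums_iff)
  then show ?thesis by simp
qed

lemma AE_sin_nonzero: "AE x in lborel. sin (pi * x) \<noteq> 0"
proof (rule AE_I')
  have "countable (range real_of_int)" by simp
  then show "range real_of_int \<in> null_sets lborel"
    by (intro countable_imp_null_set_lborel)
  show "{x \<in> space lborel. \<not> sin (pi * x) \<noteq> 0} \<subseteq> range real_of_int"
    by (auto simp: sin_zero_iff_int2)
qed

context
  fixes f :: "real \<Rightarrow> complex"
  assumes f: "integrable lborel f"
begin

text \<open>The factor r^n supplies the geometric majorant for termwise integration; r tends to 1
  only afterwards, by dominated convergence.\<close>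

lemma integral_smooth_square_wave_sums:
  assumes r: "0 \<le> r" "r < 1"
  shows "(\<lambda>n. of_real (odd_coeff n * r ^ n) * (\<integral>x. f x * of_real (sin (real n * (pi * x))) \<partial>lborel)) sums
    (\<integral>x. f x * of_real (smooth_square_wave r (pi * x)) \<partial>lborel)"
proof -
  have m: "f \<in> borel_measurable borel" using borel_measurable_integrable [OF f] by simp
  define g where "g n x = f x * of_real (odd_coeff n * r ^ n * sin (real n * (pi * x)))" for n x
  have c1: "\<bar>odd_coeff n\<bar> \<le> 1" for n by (cases n) (auto simp: odd_coeff_def)
  have gb: "norm (g n x) \<le> r ^ n * norm (f x)" for n x
  proof -
    have "norm (g n x) = norm (f x) * (\<bar>odd_coeff n\<bar> * r ^ n * \<bar>sin (real n * (pi * x))\<bar>)"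
      using r by (simp add: g_def norm_mult norm_power abs_mult)
    also have "\<dots> \<le> norm (f x) * (1 * r ^ n * 1)"
      using r c1 by (intro mult_mono) auto
    finally show ?thesis by (simp add: mult.commute)
  qed
  have gi: "integrable lborel (g n)" for n
    by (rule Bochner_Integration.integrable_bound [OF integrable_mult_right [OF f, of "of_real (r ^ n)"]])
      (use m gb r in \<open>auto simp: g_def [abs_def] norm_mult norm_power\<close>)
  have "(\<lambda>n. integral\<^sup>L lborel (g n)) sums (\<integral>x. (\<Sum>n. g n x) \<partial>lborel)"
  proof (rule sums_integral [OF gi])
    have geo: "summable (\<lambda>n. r ^ n * c)" for c using r by (intro summable_mult2 summable_geometric) auto
    show "AE x in lborel. summable (\<lambda>n. norm (g n x))"
      using gb by (intro always_eventually allI summable_comparison_test' [OF geo]) auto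
    show "summable (\<lambda>n. \<integral>x. norm (g n x) \<partial>lborel)"
    proof (rule summable_comparison_test' [OF geo])
      fix n
      have "(\<integral>x. norm (g n x) \<partial>lborel) \<le> (\<integral>x. r ^ n * norm (f x) \<partial>lborel)"
        using gb f gi by (intro integral_mono) auto
      then show "norm (\<integral>x. norm (g n x) \<partial>lborel) \<le> r ^ n * (\<integral>x. norm (f x) \<partial>lborel)" by simp
    qed
  qed
  moreover have "integral\<^sup>L lborel (g n) = of_real (odd_coeff n * r ^ n) * (\<integral>x. f x * of_real (sin (real n * (pi * x))) \<partial>lborel)" for n
    unfolding g_def by (subst integral_mult_right_zero [symmetric]) (simp add: mult_ac)
  moreover have "(\<Sum>n. g n x) = f x * of_real (smooth_square_wave r (pi * x))" for x
    using sums_mult [OF sums_of_real [OF smooth_square_wave_sums [OF r, of "pi * x"]], of "f x"]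
    by (simp add: g_def sums_iff)
  ultimately show ?thesis by simp
qed

lemma integral_smooth_square_wave_tendsto:
  assumes R: "R \<longlonglongrightarrow> 1" "\<And>k. 0 \<le> R k" "\<And>k. R k < 1"
  shows "(\<lambda>k. \<integral>x. f x * of_real (smooth_square_wave (R k) (pi * x)) \<partial>lborel)
    \<longlonglongrightarrow> of_real (pi / 4) * (\<integral>x. f x * of_real (sgn (sin (pi * x))) \<partial>lborel)"
proof -
  have m: "f \<in> borel_measurable borel" using borel_measurable_integrable [OF f] by simp
  have "(\<lambda>k. \<integral>x. f x * of_real (smooth_square_wave (R k) (pi * x)) \<partial>lborel)
    \<longlonglongrightarrow> (\<integral>x. f x * of_real (pi / 4 * sgn (sin (pi * x))) \<partial>lborel)"
  proof (rule integral_dominated_convergence [where w = "\<lambda>x. pi * norm (f x)"])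
    show "AE x in lborel. (\<lambda>k. f x * of_real (smooth_square_wave (R k) (pi * x)))
        \<longlonglongrightarrow> f x * of_real (pi / 4 * sgn (sin (pi * x)))"
      using AE_sin_nonzero by eventually_elim (intro tendsto_intros smooth_square_wave_tendsto R)
    show "AE x in lborel. norm (f x * of_real (smooth_square_wave (R k) (pi * x))) \<le> pi * norm (f x)" for k
      using abs_smooth_square_wave_le [OF R(2,3)] by (auto simp: norm_mult mult.commute [of pi] intro!: mult_left_mono)
    show "(\<lambda>x. f x * of_real (smooth_square_wave (R k) (pi * x))) \<in> borel_measurable lborel" for k
      using m smooth_square_wave_measurable [OF R(2,3), of k] by simp
    show "(\<lambda>x. f x * of_real (pi / 4 * sgn (sin (pi * x)))) \<in> borel_measurable lborel"
      using m by simp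
  qed (use f in simp)
  moreover have "(\<integral>x. f x * of_real (pi / 4 * sgn (sin (pi * x))) \<partial>lborel) =
      of_real (pi / 4) * (\<integral>x. f x * of_real (sgn (sin (pi * x))) \<partial>lborel)"
    by (subst integral_mult_right_zero [symmetric]) (simp add: mult_ac)
  ultimately show ?thesis by simp
qed

end

lemma radii_tendsto_1: "(\<lambda>k. 1 - 1 / real (Suc k)) \<longlonglongrightarrow> 1"
  using tendsto_diff [OF tendsto_const LIMSEQ_Suc [OF lim_1_over_n], of 1] by simp

text \<open>The frequencies of the square wave are n pi and -n pi with n odd, none inside the open
  band.\<close>

lemma square_wave_orthogonal:
  assumes F: "exp_type_le pi F" and L1: "integrable lborel (\<lambda>x. F (of_real x))"
  shows "(\<integral>x. F (of_real x) * of_real (sgn (sin (pi * x))) \<partial>lborel) = 0"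
proof -
  have 0: "(\<integral>x. F (of_real x) * of_real (sin (real n * (pi * x))) \<partial>lborel) = 0" if "odd n" for n
  proof -
    have "n \<ge> 1" using that by (cases n) auto
    have i: "integrable lborel (\<lambda>x. F (of_real x) * iexp (\<tau> * x))" for \<tau>
      by (rule Bochner_Integration.integrable_bound [OF L1])
        (use borel_measurable_integrable [OF L1] in \<open>auto simp: norm_mult\<close>)
    have v: "(\<integral>x. F (of_real x) * iexp (\<tau> * x) \<partial>lborel) = 0" if "\<tau> = real n * pi \<or> \<tau> = - (real n * pi)" for \<tau>
      using that \<open>n \<ge> 1\<close> by (intro fourier_vanish [OF F _ L1]) (auto simp: abs_mult mult_le_cancel_right1)
    have "F (of_real x) * of_real (sin (real n * (pi * x))) =
        - (\<i> / 2) * (F (of_real x) * iexp ((real n * pi) * x) - F (of_real x) * iexp ((- (real n * pi)) * x))" for x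
    proof -
      have "complex_of_real (sin u) = - (\<i> / 2) * (iexp u - iexp (- u))" for u
        by (simp add: complex_eq_iff exp_eq_polar)
      moreover have "(real n * pi) * x = real n * (pi * x)" "(- (real n * pi)) * x = - (real n * (pi * x))" by simp_all
      ultimately show ?thesis by (simp only:) (simp add: algebra_simps)
    qed
    then have "(\<integral>x. F (of_real x) * of_real (sin (real n * (pi * x))) \<partial>lborel) =
        - (\<i> / 2) * (\<integral>x. F (of_real x) * iexp ((real n * pi) * x) - F (of_real x) * iexp ((- (real n * pi)) * x) \<partial>lborel)"
      by (simp only: integral_mult_right_zero)
    also have "\<dots> = - (\<i> / 2) * (0 - 0)"
      by (subst Bochner_Integration.integral_diff [OF i i]) (subst v, simp, subst v, simp, simp)
    finally show ?thesis by simp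
  qed
  have "(\<integral>x. F (of_real x) * of_real (smooth_square_wave r (pi * x)) \<partial>lborel) = 0" if r: "0 \<le> r" "r < 1" for r
  proof -
    have "of_real (odd_coeff n * r ^ n) * (\<integral>x. F (of_real x) * of_real (sin (real n * (pi * x))) \<partial>lborel) = 0" for n
      using 0 by (cases "odd n") (auto simp: odd_coeff_def)
    then have "(\<lambda>n. 0) sums (\<integral>x. F (of_real x) * of_real (smooth_square_wave r (pi * x)) \<partial>lborel)"
      using integral_smooth_square_wave_sums [OF L1 r] by (simp only:)
    from sums_unique2 [OF this sums_zero] show ?thesis .
  qed
  then have "(\<lambda>k. 0) \<longlonglongrightarrow> of_real (pi / 4) * (\<integral>x. F (of_real x) * of_real (sgn (sin (pi * x))) \<partial>lborel)"
    using integral_smooth_square_wave_tendsto [OF L1 radii_tendsto_1] by simp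
  then show ?thesis by (simp add: LIMSEQ_const_iff)
qed

section \<open>Uniqueness from interpolation\<close>

definition divided_difference :: "(complex \<Rightarrow> complex) \<Rightarrow> complex \<Rightarrow> complex \<Rightarrow> complex" where
  "divided_difference F a z = (if z = a then deriv F a else (F z - F a) / (z - a))"

lemma holomorphic_divided_difference:
  assumes "F holomorphic_on UNIV"
  shows "divided_difference F a holomorphic_on UNIV"
proof -
  have 1: "(\<lambda>z. F z - F a) holomorphic_on UNIV" using assms by (intro holomorphic_intros)
  have 2: "deriv (\<lambda>z. F z - F a) a = deriv F a"
  proof (rule DERIV_imp_deriv)
    have "(F has_field_derivative deriv F a) (at a)"
      using assms by (intro holomorphic_derivI [OF _ open_UNIV]) auto
    from DERIV_diff [OF this DERIV_const [of "F a"]]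
    show "((\<lambda>z. F z - F a) has_field_derivative deriv F a) (at a)" by simp
  qed
  show ?thesis
    by (rule pole_theorem_open_0 [where g = "\<lambda>z. F z - F a" and a = a]) (simp_all add: 1 2 divided_difference_def)
qed

text \<open>Within distance 1 of a compactness bounds the quotient; farther away the divisor has
  modulus at least 1, so the growth of F is kept.\<close>

lemma exp_type_le_divided_difference:
  assumes F: "exp_type_le \<sigma> F" and "F a = 0" and \<sigma>: "0 \<le> \<sigma>"
  shows "exp_type_le \<sigma> (divided_difference F a)"
  unfolding exp_type_le_def
proof (intro conjI allI impI)
  show holo: "divided_difference F a holomorphic_on UNIV"
    using F by (intro holomorphic_divided_difference) (simp add: exp_type_le_def)
  fix \<epsilon> :: real assume \<epsilon>: "0 < \<epsilon>"
  from F \<epsilon> obtain C where C: "0 < C" "\<And>z. cmod (F z) \<le> C * exp ((\<sigma> + \<epsilon>) * cmod z)"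
    unfolding exp_type_le_def by meson
  have "compact (divided_difference F a ` cball a 1)"
    using holo by (intro compact_continuous_image compact_cball)
      (auto intro: holomorphic_on_imp_continuous_on holomorphic_on_subset)
  then obtain M where M: "\<And>z. dist a z \<le> 1 \<Longrightarrow> cmod (divided_difference F a z) \<le> M"
    by (force dest: compact_imp_bounded simp: bounded_iff)
  have "cmod (divided_difference F a z) \<le> (C + max 0 M) * exp ((\<sigma> + \<epsilon>) * cmod z)" for z
  proof (cases "dist a z \<le> 1")
    case True
    have "cmod (divided_difference F a z) \<le> M" by (rule M [OF True])
    also have "M \<le> (C + max 0 M) * 1" using C(1) by simp
    also have "\<dots> \<le> (C + max 0 M) * exp ((\<sigma> + \<epsilon>) * cmod z)"
      using C(1) \<sigma> \<epsilon> by (intro mult_left_mono) auto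
    finally show ?thesis .
  next
    case False
    then have z: "1 \<le> cmod (z - a)" "z \<noteq> a" by (auto simp: dist_norm norm_minus_commute)
    have "cmod (divided_difference F a z) = cmod (F z) / cmod (z - a)"
      using z \<open>F a = 0\<close> by (simp add: divided_difference_def norm_divide)
    also have "\<dots> \<le> cmod (F z) / 1" using z by (intro divide_left_mono) auto
    also have "\<dots> \<le> C * exp ((\<sigma> + \<epsilon>) * cmod z)" using C(2) by simp
    also have "\<dots> \<le> (C + max 0 M) * exp ((\<sigma> + \<epsilon>) * cmod z)" by (intro mult_right_mono) auto
    finally show ?thesis .
  qed
  moreover have "0 < C + max 0 M" using C(1) by simp
  ultimately show "\<exists>C>0. \<forall>z. cmod (divided_difference F a z) \<le> C * exp ((\<sigma> + \<epsilon>) * cmod z)" by blast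
qed

lemma integrable_inverse_one_plus_square: "integrable lborel (\<lambda>x::real. inverse (1 + x\<^sup>2))"
proof -
  have "set_integrable lborel (einterval (-\<infinity>) \<infinity>) (\<lambda>x::real. inverse (1 + x\<^sup>2))"
    by (rule integrable_inverse_1_plus_square)
  then show ?thesis by (simp add: set_integrable_def einterval_eq_UNIV)
qed

lemma abs_nsinc_le_one: "\<bar>nsinc x\<bar> \<le> 1"
proof (cases "x = 0")
  case False
  have "\<bar>sin (pi * x)\<bar> \<le> \<bar>pi * x\<bar>" by (rule abs_sin_x_le_abs_x)
  then show ?thesis using False by (simp add: nsinc_def abs_mult)
qed (simp add: nsinc_def)

lemma nsinc_measurable [measurable]: "nsinc \<in> borel_measurable borel"
  unfolding nsinc_def by measurable

lemma integrable_divided_difference: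
  assumes holo: "H holomorphic_on UNIV" and "H (of_real w) = 0"
    and bound: "\<And>x::real. 1 \<le> \<bar>x - w\<bar> \<Longrightarrow> cmod (H (of_real x)) / \<bar>x - w\<bar> \<le> B x"
    and B: "integrable lborel B" "\<And>x. 0 \<le> B x"
  shows "integrable lborel (\<lambda>x. divided_difference H (of_real w) (of_real x))"
proof -
  define D where "D x = divided_difference H (of_real w) (of_real x)" for x :: real
  have hD: "divided_difference H (of_real w) holomorphic_on UNIV"
    by (rule holomorphic_divided_difference [OF holo])
  have cont: "continuous_on UNIV D"
    unfolding D_def using holomorphic_on_imp_continuous_on [OF hD]
    by (rule continuous_on_compose2 [OF _ continuous_on_of_real_id]) simp
  have "compact (D ` cball w 1)"
    by (intro compact_continuous_image compact_cball continuous_on_subset [OF cont]) simp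
  then obtain M where M: "\<And>x. dist w x \<le> 1 \<Longrightarrow> norm (D x) \<le> M"
    by (force dest: compact_imp_bounded simp: bounded_iff)
  have "0 \<le> M" by (rule order.trans [OF norm_ge_zero M [of w]]) simp
  have "integrable lborel (\<lambda>x. B x + M * indicator (cball w 1) x)"
    by (intro Bochner_Integration.integrable_add B integrable_mult_right integrable_real_indicator) (use emeasure_bounded_finite [OF bounded_cball, of w 1] in auto)
  then have "integrable lborel D"
  proof (rule Bochner_Integration.integrable_bound)
    show "D \<in> borel_measurable lborel"
      using borel_measurable_continuous_onI [OF cont] by simp
    show "AE x in lborel. norm (D x) \<le> norm (B x + M * indicator (cball w 1) x)"
    proof (intro always_eventually allI)
      fix x
      show "norm (D x) \<le> norm (B x + M * indicator (cball w 1) x)"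
      proof (cases "dist w x \<le> 1")
        case True
        then show ?thesis using M [OF True] B(2) [of x] \<open>0 \<le> M\<close> by simp
      next
        case False
        then have x: "1 \<le> \<bar>x - w\<bar>" "x \<noteq> w" by (auto simp: dist_real_def abs_minus_commute)
        have "norm (D x) = cmod (H (of_real x)) / \<bar>x - w\<bar>"
          using x \<open>H (of_real w) = 0\<close>
          by (simp add: D_def divided_difference_def norm_divide flip: of_real_diff)
        then show ?thesis using bound [OF x(1)] B(2) [of x] False by simp
      qed
    qed
  qed
  then show ?thesis unfolding D_def .
qed

definition fourier :: "(complex \<Rightarrow> complex) \<Rightarrow> real \<Rightarrow> complex" where
  "fourier F t = (\<integral>x. F (of_real x) * iexp (t * x) \<partial>lborel)"

text \<open>Left unevaluated, although it equals 1: inversion up to a positive constant already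
  detects F = 0.\<close>

definition sinc_square_mass :: real where
  "sinc_square_mass = (\<integral>x. (nsinc x)\<^sup>2 \<partial>lborel)"

lemma nsinc_square_le: "(nsinc x)\<^sup>2 \<le> 2 * inverse (1 + x\<^sup>2)"
proof (cases "\<bar>x\<bar> \<le> 1")
  case True
  have "(nsinc x)\<^sup>2 \<le> 1" using abs_nsinc_le_one [of x] by (simp add: abs_square_le_1)
  also have "x\<^sup>2 \<le> 1" using True by (simp add: abs_square_le_1)
  then have "1 \<le> 2 * inverse (1 + x\<^sup>2)" by (simp add: field_simps add_pos_nonneg)
  finally show ?thesis .
next
  case False
  then have x: "x \<noteq> 0" "1 \<le> x\<^sup>2" using power_mono [of 1 "\<bar>x\<bar>" 2] by auto
  have "(nsinc x)\<^sup>2 = (sin (pi * x))\<^sup>2 / (pi\<^sup>2 * x\<^sup>2)"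
    using x by (simp add: nsinc_def power_divide power_mult_distrib)
  also have "\<dots> \<le> 1 / (1 * x\<^sup>2)"
    using x pi_ge_two by (intro frac_le mult_right_mono) (auto simp: abs_square_le_1 one_le_power)
  also have "\<dots> \<le> 2 * inverse (1 + x\<^sup>2)" using x by (simp add: field_simps)
  finally show ?thesis .
qed

lemma nsinc_square_integrable: "integrable lborel (\<lambda>x. (nsinc x)\<^sup>2)"
  by (rule Bochner_Integration.integrable_bound [OF integrable_mult_right [OF integrable_inverse_one_plus_square, of 2]])
    (use nsinc_square_le in \<open>auto simp: add_pos_nonneg\<close>)

lemma sinc_square_mass_pos: "0 < sinc_square_mass"
proof -
  have nn: "0 \<le> sinc_square_mass" unfolding sinc_square_mass_def by simp
  have "sinc_square_mass \<noteq> 0"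
  proof
    assume "sinc_square_mass = 0"
    then have "AE x in lborel. (nsinc x)\<^sup>2 = 0"
      unfolding sinc_square_mass_def
      using integral_nonneg_eq_0_iff_AE [OF nsinc_square_integrable] by simp
    then have "AE x in lborel. x \<notin> {0<..<1::real}"
    proof eventually_elim
      case (elim x)
      show ?case
      proof
        assume x: "x \<in> {0<..<1}"
        then have "0 < sin (pi * x)" by (intro sin_gt_zero) auto
        then show False using elim x by (simp add: nsinc_def)
      qed
    qed
    then have "emeasure lborel {0<..<1::real} = 0"
      by (subst (asm) AE_iff_measurable [of "{0<..<1}"]) auto
    then show False by simp
  qed
  with nn show ?thesis by simp
qed

lemma integral_iexp_period: "(\<integral>t. indicator {- pi..pi} t *\<^sub>R iexp (t * u) \<partial>lborel) = of_real (2 * pi * nsinc u)"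
proof (cases "u = 0")
    case False
    define G where "G t = iexp (t * u) / (\<i> * of_real u)" for t
    have "(\<integral>t. indicator {- pi..pi} t *\<^sub>R iexp (t * u) \<partial>lborel) = G pi - G (- pi)"
    proof (rule integral_FTC_Icc)
      fix t
      show "(G has_vector_derivative iexp (t * u)) (at t within {- pi..pi})"
      proof -
        define h where "h z = exp (\<i> * (z * of_real u)) / (\<i> * of_real u)" for z
        have "(h has_field_derivative exp (\<i> * (complex_of_real t * complex_of_real u))) (at (complex_of_real t))"
          unfolding h_def using False by (auto intro!: derivative_eq_intros simp: field_simps)
        from has_vector_derivative_real_field [OF this, of "{- pi..pi}"] show ?thesis
          by (simp add: G_def [abs_def] h_def)
      qed
    qed (auto intro!: continuous_intros)
    also have "\<dots> = of_real (2 * pi * nsinc u)"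
      using False by (simp add: G_def nsinc_def exp_eq_polar complex_eq_iff Re_divide Im_divide power2_eq_square)
    finally show ?thesis .
  qed (simp add: nsinc_def scaleR_conv_of_real)

context
  fixes F :: "complex \<Rightarrow> complex"
  assumes F: "exp_type_le pi F" and L1: "integrable lborel (\<lambda>x. F (of_real x))"
begin

lemma F_measurable: "(\<lambda>x. F (complex_of_real x)) \<in> borel_measurable borel"
  using borel_measurable_integrable [OF L1] by simp

text \<open>The Fourier integral of the divided difference of \<open>F - F w * csinc (\<cdot> - w)\<close> at the two
  frequencies \<open>\<plusminus>\<pi>\<close> vanishes, which turns into a form of Fourier inversion.\<close>

lemma sinc_convolution: "(\<integral>x. F (of_real x) * of_real (nsinc (x - w)) \<partial>lborel) = F (of_real w) * of_real sinc_square_mass"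
proof -
  define H where "H z = F z + (- F (of_real w)) * csinc (z - of_real w)" for z
  have Hw: "H (of_real w) = 0" by (simp add: H_def csinc_def)
  have H: "exp_type_le pi H"
    unfolding H_def by (intro exp_type_le_add exp_type_le_cmult F exp_type_le_csinc_shift)
  define D where "D = divided_difference H (of_real w)"
  have D: "exp_type_le pi D"
    unfolding D_def by (rule exp_type_le_divided_difference [OF H Hw]) simp
  have "integrable lborel (\<lambda>x. D (of_real x))"
    unfolding D_def
  proof (rule integrable_divided_difference)
    show "H holomorphic_on UNIV" using H by (simp add: exp_type_le_def)
    \<comment> \<open>The correction term \<open>csinc\<close> is not integrable on the line.
      Divided by x - w it is of order 1/(x - w)^2, so the divided difference is integrable although
      H need not be.\<close>
    show "integrable lborel (\<lambda>x. norm (F (of_real x)) + cmod (F (of_real w)) * (2 * inverse (1 + (x - w)\<^sup>2)))"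
    proof (intro Bochner_Integration.integrable_add integrable_mult_right integrable_norm L1)
      show "integrable lborel (\<lambda>x. inverse (1 + (x - w)\<^sup>2))"
        using lborel_integrable_real_affine [OF integrable_inverse_one_plus_square, of 1 "- w"] by simp
    qed
    fix x :: real
    show "0 \<le> norm (F (of_real x)) + cmod (F (of_real w)) * (2 * inverse (1 + (x - w)\<^sup>2))"
      by (simp add: add_pos_nonneg less_imp_le)
    assume x: "1 \<le> \<bar>x - w\<bar>"
    have "cmod (H (of_real x)) \<le> cmod (F (of_real x)) + cmod (F (of_real w)) * \<bar>nsinc (x - w)\<bar>"
      unfolding H_def using csinc_of_real [of "x - w"]
      by (intro order.trans [OF norm_triangle_ineq]) (simp add: norm_mult)
    then have "cmod (H (of_real x)) / \<bar>x - w\<bar> \<le> (cmod (F (of_real x)) + cmod (F (of_real w)) * \<bar>nsinc (x - w)\<bar>) / \<bar>x - w\<bar>"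
      by (rule divide_right_mono) simp
    also have "\<dots> = cmod (F (of_real x)) / \<bar>x - w\<bar> + cmod (F (of_real w)) * (\<bar>nsinc (x - w)\<bar> / \<bar>x - w\<bar>)"
      by (simp add: add_divide_distrib)
    also have "\<dots> \<le> norm (F (of_real x)) + cmod (F (of_real w)) * (2 * inverse (1 + (x - w)\<^sup>2))"
    proof (intro add_mono mult_left_mono)
      show "cmod (F (of_real x)) / \<bar>x - w\<bar> \<le> norm (F (of_real x))"
        using x by (simp add: divide_le_eq mult_le_cancel_left1)
      define u where "u = x - w"
      have u: "1 \<le> \<bar>u\<bar>" "u \<noteq> 0" using x by (auto simp: u_def)
      have "1 \<le> u\<^sup>2" using u power_mono [of 1 "\<bar>u\<bar>" 2] by simp
      have "\<bar>nsinc u\<bar> / \<bar>u\<bar> = \<bar>sin (pi * u)\<bar> / (pi * u\<^sup>2)"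
        using u by (simp add: nsinc_def abs_mult power2_eq_square)
      also have "\<dots> \<le> 1 / (1 * u\<^sup>2)" using u pi_ge_two by (intro frac_le mult_right_mono) auto
      also have "\<dots> \<le> 2 * inverse (1 + u\<^sup>2)" using u \<open>1 \<le> u\<^sup>2\<close> by (simp add: field_simps)
      finally show "\<bar>nsinc (x - w)\<bar> / \<bar>x - w\<bar> \<le> 2 * inverse (1 + (x - w)\<^sup>2)" by (simp add: u_def)
    qed simp
    finally show "cmod (H (of_real x)) / \<bar>x - w\<bar> \<le> norm (F (of_real x)) + cmod (F (of_real w)) * (2 * inverse (1 + (x - w)\<^sup>2))" .
  qed (rule Hw)
  note iD = this
  have iDe: "integrable lborel (\<lambda>x. D (of_real x) * iexp (t * x))" for t
    by (rule Bochner_Integration.integrable_bound [OF iD])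
      (use borel_measurable_integrable [OF iD] in \<open>auto simp: norm_mult\<close>)
  have v: "(\<integral>x. D (of_real x) * iexp (pi * x) \<partial>lborel) = 0" "(\<integral>x. D (of_real x) * iexp ((- pi) * x) \<partial>lborel) = 0"
    by (intro fourier_vanish [OF D _ iD]; simp)+
  have eq: "D (of_real x) * of_real (sin (pi * (x - w))) =
      iexp (- pi * w) / (2 * \<i>) * (D (of_real x) * iexp (pi * x)) - iexp (pi * w) / (2 * \<i>) * (D (of_real x) * iexp ((- pi) * x))" for x
  proof -
    have s: "complex_of_real (sin u) = (iexp u - iexp (- u)) / (2 * \<i>)" for u
      by (simp add: complex_eq_iff exp_eq_polar)
    have "iexp (pi * (x - w)) = iexp (- pi * w) * iexp (pi * x)" "iexp (- (pi * (x - w))) = iexp (pi * w) * iexp ((- pi) * x)"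
      by (simp_all add: exp_add [symmetric] algebra_simps)
    moreover have "d * ((p * P - q * Q) / (2 * \<i>)) = p / (2 * \<i>) * (d * P) - q / (2 * \<i>) * (d * Q)"
      for d p P q Q :: complex
      by (simp add: field_simps)
    ultimately show ?thesis using s [of "pi * (x - w)"] by (simp only:)
  qed
  have "(\<integral>x. D (of_real x) * of_real (sin (pi * (x - w))) \<partial>lborel) = 0"
    unfolding eq
    by (subst Bochner_Integration.integral_diff) (intro integrable_mult_right iDe | simp only: integral_mult_right_zero v | simp)+
  \<comment> \<open>The sine equals (x - w) pi \<open>nsinc (x - w)\<close> and cancels the
    denominator of D. What is left compares the convolution with F(w) times the integral of the
    squared kernel.\<close>
  moreover have "D (of_real x) * of_real (sin (pi * (x - w))) =
      of_real pi * (F (of_real x) * of_real (nsinc (x - w)) - F (of_real w) * of_real ((nsinc (x - w))\<^sup>2))" for x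
  proof (cases "x = w")
    case False
    have "D (of_real x) = H (of_real x) / of_real (x - w)"
      using False by (simp add: D_def divided_difference_def Hw)
    moreover have "H (of_real x) = F (of_real x) - F (of_real w) * of_real (nsinc (x - w))"
      using csinc_of_real [of "x - w"] by (simp add: H_def)
    moreover have "of_real (sin (pi * (x - w))) = of_real (x - w) * (of_real pi * complex_of_real (nsinc (x - w)))"
    proof -
      have "sin (pi * (x - w)) = (x - w) * (pi * nsinc (x - w))" using False by (simp add: nsinc_def)
      then show ?thesis by (metis of_real_mult)
    qed
    moreover have "complex_of_real (x - w) \<noteq> 0" using False by simp
    moreover have "(f - g * s) / r * (r * (p * s)) = p * (f * s - g * s\<^sup>2)" if "r \<noteq> 0" for f g r p s :: complex
    proof -
      have "(f - g * s) / r * (r * (p * s)) = (f - g * s) * (p * s)" using that by simp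
      then show ?thesis by (simp add: power2_eq_square algebra_simps)
    qed
    ultimately show ?thesis by (simp only: of_real_power)
  qed (simp add: nsinc_def)
  ultimately have "(\<integral>x. F (of_real x) * of_real (nsinc (x - w)) - F (of_real w) * of_real ((nsinc (x - w))\<^sup>2) \<partial>lborel) = 0"
    by (simp add: integral_mult_right_zero del: of_real_power)
  moreover have "integrable lborel (\<lambda>x. (nsinc (x - w))\<^sup>2)"
    using lborel_integrable_real_affine [OF nsinc_square_integrable, of 1 "- w"] by simp
  moreover have "integrable lborel (\<lambda>x. F (of_real x) * of_real (nsinc (x - w)))"
    by (rule Bochner_Integration.integrable_bound [OF L1])
      (use F_measurable abs_nsinc_le_one in \<open>auto simp: norm_mult mult_left_le\<close>)
  moreover have "(\<integral>x. (nsinc (x - w))\<^sup>2 \<partial>lborel) = sinc_square_mass"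
    unfolding sinc_square_mass_def using lborel_integral_real_affine [of 1 "\<lambda>x. (nsinc x)\<^sup>2" "- w"] by simp
  ultimately show ?thesis
    by (simp add: Bochner_Integration.integral_diff integral_mult_right_zero integral_complex_of_real del: of_real_power)
qed

text \<open>Frequencies range over a bounded interval, so Fubini applies. The inner integral is 2 pi
  \<open>nsinc (x - w)\<close>, and inversion becomes the convolution identity.\<close>

lemma fourier_inversion:
  "(\<integral>t. indicator {- pi..pi} t *\<^sub>R (fourier F t * iexp (- (t * w))) \<partial>lborel) = 2 * pi * sinc_square_mass * F (of_real w)"
proof -
  have prod: "integrable (lborel \<Otimes>\<^sub>M lborel) (\<lambda>(t, x). indicator {- pi..pi} t *\<^sub>R (F (of_real x) * iexp (t * x) * iexp (- (t * w))))"
  proof -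
    have "integrable (lborel \<Otimes>\<^sub>M lborel) (\<lambda>(t, x). of_real (indicator {- pi..pi} t) * F (of_real x))"
    proof (rule lborel_pair.Fubini_integrable)
      show "(\<lambda>(t, x). complex_of_real (indicator {- pi..pi} t) * F (of_real x)) \<in> borel_measurable (lborel \<Otimes>\<^sub>M lborel)"
        using F_measurable by measurable
      show "integrable lborel (\<lambda>t. \<integral>x. norm (case (t, x) of (t, x) \<Rightarrow> complex_of_real (indicator {- pi..pi} t) * F (of_real x)) \<partial>lborel)"
        by (simp add: norm_mult integral_mult_right_zero)
    qed (use L1 in auto)
    then show ?thesis
      by (rule Bochner_Integration.integrable_bound)
        (use F_measurable in \<open>auto simp: norm_mult case_prod_unfold scaleR_conv_of_real\<close>)
  qed
  have "(\<integral>t. indicator {- pi..pi} t *\<^sub>R (fourier F t * iexp (- (t * w))) \<partial>lborel) =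
      (\<integral>t. (\<integral>x. indicator {- pi..pi} t *\<^sub>R (F (of_real x) * iexp (t * x) * iexp (- (t * w))) \<partial>lborel) \<partial>lborel)"
    by (simp add: fourier_def integral_mult_left_zero integral_scaleR_right)
  also have "\<dots> = (\<integral>x. (\<integral>t. indicator {- pi..pi} t *\<^sub>R (F (of_real x) * iexp (t * x) * iexp (- (t * w))) \<partial>lborel) \<partial>lborel)"
    by (rule lborel_pair.Fubini_integral [OF prod, symmetric])
  also have "\<dots> = (\<integral>x. F (of_real x) * (\<integral>t. indicator {- pi..pi} t *\<^sub>R iexp (t * (x - w)) \<partial>lborel) \<partial>lborel)"
  proof (rule Bochner_Integration.integral_cong [OF refl])
    fix x
    have "indicator {- pi..pi} t *\<^sub>R (F (of_real x) * iexp (t * x) * iexp (- (t * w))) =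
        F (of_real x) * (indicator {- pi..pi} t *\<^sub>R iexp (t * (x - w)))" for t
    proof -
      have "iexp (t * x) * iexp (- (t * w)) = iexp (t * (x - w))"
        by (simp add: exp_add [symmetric] algebra_simps)
      then show ?thesis by (simp add: mult.assoc)
    qed
    then show "(\<integral>t. indicator {- pi..pi} t *\<^sub>R (F (of_real x) * iexp (t * x) * iexp (- (t * w))) \<partial>lborel) =
        F (of_real x) * (\<integral>t. indicator {- pi..pi} t *\<^sub>R iexp (t * (x - w)) \<partial>lborel)"
      by (simp only: integral_mult_right_zero)
  qed
  also have "\<dots> = (\<integral>x. of_real (2 * pi) * (F (of_real x) * of_real (nsinc (x - w))) \<partial>lborel)"
    unfolding integral_iexp_period by (simp add: mult_ac)
  also have "\<dots> = of_real (2 * pi) * (F (of_real w) * of_real sinc_square_mass)"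
    by (simp only: integral_mult_right_zero sinc_convolution)
  finally show ?thesis by (simp add: mult_ac)
qed

lemma fourier_continuous: "continuous_on UNIV (fourier F)"
proof (rule continuous_on_sequentiallyI)
  fix X :: "nat \<Rightarrow> real" and t assume X: "X \<longlonglongrightarrow> t"
  show "(\<lambda>n. fourier F (X n)) \<longlonglongrightarrow> fourier F t"
    unfolding fourier_def
  proof (rule integral_dominated_convergence [where w = "\<lambda>x. norm (F (of_real x))"])
    show "AE x in lborel. (\<lambda>n. F (of_real x) * iexp (X n * x)) \<longlonglongrightarrow> F (of_real x) * iexp (t * x)"
      by (intro always_eventually allI tendsto_intros X)
  qed (use L1 F_measurable in \<open>auto simp: norm_mult\<close>)
qed

end

section \<open>Uniqueness of Fourier coefficients on one period\<close>

lemma integrable_on_period: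
  fixes g :: "real \<Rightarrow> 'a :: {banach, second_countable_topology}"
  assumes "continuous_on UNIV g"
  shows "integrable lborel (\<lambda>t. indicator {- pi..pi} t *\<^sub>R g t)"
  using borel_integrable_atLeastAtMost' [OF continuous_on_subset [OF assms, of "{- pi..pi}"]]
  by (simp add: set_integrable_def)

lemma cos_le_cos_gap:
  assumes "0 \<le> d" "d \<le> \<bar>s\<bar>" "\<bar>s\<bar> \<le> 2 * pi - d"
  shows "cos s \<le> cos d"
proof (cases "\<bar>s\<bar> \<le> pi")
  case True
  then have "cos \<bar>s\<bar> \<le> cos d" using assms by (intro cos_monotone_0_pi_le) auto
  then show ?thesis by simp
next
  case False
  have "cos (2 * pi - \<bar>s\<bar>) \<le> cos d" using False assms by (intro cos_monotone_0_pi_le) auto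
  then show ?thesis by (simp add: cos_diff)
qed

text \<open>Powers of \<open>1 + cos (t - a) - cos d\<close> are trigonometric polynomials concentrating at \<open>a\<close>.\<close>

lemma fourier_coefficients_unique:
  fixes h :: "real \<Rightarrow> complex"
  assumes cont: "continuous_on UNIV h"
    and coeff: "\<And>n::int. (\<integral>t. indicator {- pi..pi} t *\<^sub>R (h t * iexp (- (t * of_int n))) \<partial>lborel) = 0"
    and a: "- pi < a" "a < pi"
  shows "h a = 0"
proof (rule ccontr)
  assume "h a \<noteq> 0"
  define \<phi> where "\<phi> t = Re (cnj (h a) * h t)" for t
  define \<eta> where "\<eta> = (cmod (h a))\<^sup>2 / 2"
  have \<eta>: "0 < \<eta>" using \<open>h a \<noteq> 0\<close> by (simp add: \<eta>_def)
  have \<phi>a: "\<phi> a = 2 * \<eta>" by (simp add: \<phi>_def \<eta>_def cmod_power2) (simp add: power2_eq_square)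
  have cont\<phi>: "continuous_on UNIV \<phi>" unfolding \<phi>_def by (intro continuous_intros cont)
  have "\<exists>d>0. \<forall>t. dist t a < d \<longrightarrow> dist (\<phi> t) (\<phi> a) < \<eta>"
    using cont\<phi> \<eta> unfolding continuous_on_iff by blast
  then obtain d0 where d0: "0 < d0" "\<And>t. dist t a < d0 \<Longrightarrow> dist (\<phi> t) (\<phi> a) < \<eta>" by blast
  \<comment> \<open>Small enough for [a - d, a + d] to stay inside the period and inside the
    neighbourhood from continuity; d \<le> 1 keeps it where the cosine decreases.\<close>
  define d where "d = min (min (d0 / 2) (pi - a)) (min (a + pi) 1)"
  have d: "0 < d" "d \<le> d0 / 2" "d \<le> pi - a" "d \<le> a + pi" "d \<le> 1"
    using d0(1) a unfolding d_def by linarith+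
  have near: "\<eta> \<le> \<phi> t" if "\<bar>t - a\<bar> \<le> d" for t
    using d0(2) [of t] that d \<phi>a d0(1) by (auto simp: dist_real_def)
  \<comment> \<open>At distance at most d from a, \<open>T\<close> is at least 1; in the rest of the
    period its modulus is at most 1.\<close>
  define T where "T t = 1 + cos (t - a) - cos d" for t
  have contT: "continuous_on UNIV T" unfolding T_def by (intro continuous_intros)
  \<comment> \<open>A factor \<open>T\<close> only combines the coefficients of index n - 1, n and n
    + 1, so the induction must run over all n at once.\<close>
  have zero: "(\<integral>t. indicator {- pi..pi} t *\<^sub>R (h t * of_real (T t) ^ k * iexp (- (t * of_int n))) \<partial>lborel) = 0" for k and n :: int
  proof (induction k arbitrary: n)
    case 0
    then show ?case using coeff by simp
  next
    case (Suc k)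
    define g where "g n t = h t * of_real (T t) ^ k * iexp (- (t * of_int n))" for n :: int and t
    have gi: "integrable lborel (\<lambda>t. indicator {- pi..pi} t *\<^sub>R g n t)" for n
      unfolding g_def by (intro integrable_on_period continuous_intros cont contT)
    have "indicator {- pi..pi} t *\<^sub>R (h t * of_real (T t) ^ Suc k * iexp (- (t * of_int n))) =
        of_real (1 - cos d) * (indicator {- pi..pi} t *\<^sub>R g n t)
        + iexp (- a) / 2 * (indicator {- pi..pi} t *\<^sub>R g (n - 1) t)
        + iexp a / 2 * (indicator {- pi..pi} t *\<^sub>R g (n + 1) t)" for t
    proof -
      have c: "complex_of_real (cos u) = (iexp u + iexp (- u)) / 2" for u
        by (simp add: complex_eq_iff exp_eq_polar)
      have e: "iexp (t - a) * iexp (- (t * of_int n)) = iexp (- a) * iexp (- (t * of_int (n - 1)))"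
        "iexp (- (t - a)) * iexp (- (t * of_int n)) = iexp a * iexp (- (t * of_int (n + 1)))"
        by (simp_all add: exp_add [symmetric] algebra_simps)
      have "of_real (T t) * iexp (- (t * of_int n)) = of_real (1 - cos d) * iexp (- (t * of_int n))
          + (iexp (t - a) * iexp (- (t * of_int n)) + iexp (- (t - a)) * iexp (- (t * of_int n))) / 2"
        by (simp add: T_def c [of "t - a"] field_simps)
      then have eq: "of_real (T t) * iexp (- (t * of_int n)) = of_real (1 - cos d) * iexp (- (t * of_int n))
          + (iexp (- a) * iexp (- (t * of_int (n - 1))) + iexp a * iexp (- (t * of_int (n + 1)))) / 2"
        unfolding e .
      have "h t * of_real (T t) ^ Suc k * iexp (- (t * of_int n)) = h t * of_real (T t) ^ k * (of_real (T t) * iexp (- (t * of_int n)))"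
        by (simp add: mult_ac)
      also have "\<dots> = of_real (1 - cos d) * g n t + iexp (- a) / 2 * g (n - 1) t + iexp a / 2 * g (n + 1) t"
        unfolding eq g_def by (simp only: distrib_left distrib_right add_divide_distrib times_divide_eq_left times_divide_eq_right mult_ac add_ac)
      finally show ?thesis
        by (simp only: scaleR_add_right mult_scaleR_right)
    qed
    then show ?case
      using Suc.IH [folded g_def] gi
      by (simp only: Bochner_Integration.integral_add Bochner_Integration.integrable_add integrable_mult_right
          integral_mult_right_zero) simp
  qed
  obtain M where M: "\<And>t. t \<in> {- pi..pi} \<Longrightarrow> \<bar>\<phi> t\<bar> \<le> M"
  proof -
    have "compact (\<phi> ` {- pi..pi})"
      by (intro compact_continuous_image continuous_on_subset [OF cont\<phi>]) auto
    then show ?thesis using that by (force dest: compact_imp_bounded simp: bounded_iff)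
  qed
  have M0: "0 \<le> M" using M [of 0] by (auto intro: order.trans [OF abs_ge_zero])
  \<comment> \<open>The margin by which \<open>T\<close> exceeds 1 on the inner interval of half
    width d/2; there its powers grow geometrically.\<close>
  define \<kappa> where "\<kappa> = cos (d / 2) - cos d"
  have \<kappa>: "0 < \<kappa>"
    using cos_monotone_0_pi [of "d / 2" d] d pi_gt3 by (simp add: \<kappa>_def)
  have bound: "\<eta> * (1 + \<kappa>) ^ k * d \<le> 2 * pi * M" for k
  proof -
    \<comment> \<open>The integrand is large on the inner interval, nonnegative between d/2 and d,
      and at least -M elsewhere. Its integral is 0 for every k, which is impossible for large
      k.\<close>
    have pw: "\<eta> * (1 + \<kappa>) ^ k * indicator {a - d / 2..a + d / 2} t - M * indicator {- pi..pi} t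
        \<le> indicator {- pi..pi} t *\<^sub>R (\<phi> t * T t ^ k)" for t
    proof (cases "t \<in> {- pi..pi}")
      case False
      then have "t \<notin> {a - d / 2..a + d / 2}" using d by auto
      with False show ?thesis by simp
    next
      case True
      consider "\<bar>t - a\<bar> \<le> d / 2" | "d / 2 < \<bar>t - a\<bar>" "\<bar>t - a\<bar> \<le> d" | "d < \<bar>t - a\<bar>" by linarith
      then show ?thesis
      proof cases
        case 1
        have "cos (d / 2) \<le> cos \<bar>t - a\<bar>" using 1 d pi_gt3 by (intro cos_monotone_0_pi_le) auto
        then have "1 + \<kappa> \<le> T t" by (simp add: T_def \<kappa>_def)
        then have "\<eta> * (1 + \<kappa>) ^ k \<le> \<phi> t * T t ^ k"
          using near [of t] 1 d \<kappa> \<eta> by (intro mult_mono power_mono) auto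
        moreover have "t \<in> {a - d / 2..a + d / 2}" using 1 unfolding atLeastAtMost_iff by linarith
        ultimately show ?thesis using True M0 by simp
      next
        case 2
        have "cos d \<le> cos \<bar>t - a\<bar>" using 2 d pi_gt3 by (intro cos_monotone_0_pi_le) auto
        then have "0 \<le> T t" by (simp add: T_def)
        then have "0 \<le> \<phi> t * T t ^ k" using near [of t] 2 \<eta> by (intro mult_nonneg_nonneg) auto
        moreover have "t \<notin> {a - d / 2..a + d / 2}" using 2(1) unfolding atLeastAtMost_iff by linarith
        ultimately show ?thesis using True M0 by simp
      next
        case 3
        have "cos (t - a) \<le> cos d" using 3 d True by (intro cos_le_cos_gap) auto
        then have "\<bar>T t\<bar> \<le> 1"
          using cos_ge_minus_one [of "t - a"] cos_le_one [of d] unfolding T_def abs_le_iff by linarith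
        then have "\<bar>\<phi> t * T t ^ k\<bar> \<le> M * 1"
          unfolding abs_mult power_abs using M [OF True] by (intro mult_mono power_le_one) auto
        then have "- M \<le> \<phi> t * T t ^ k" by simp
        moreover have "t \<notin> {a - d / 2..a + d / 2}" using 3 d(1) unfolding atLeastAtMost_iff by linarith
        ultimately show ?thesis using True by simp
      qed
    qed
    have hi: "integrable lborel (\<lambda>t. indicator {- pi..pi} t *\<^sub>R (h t * of_real (T t) ^ k * iexp (- (t * of_int 0))))"
      by (intro integrable_on_period continuous_intros cont contT)
    have i1: "integrable lborel (\<lambda>t. indicator {- pi..pi} t *\<^sub>R (\<phi> t * T t ^ k))"
      by (intro integrable_on_period continuous_intros cont\<phi> contT)
    have "(\<integral>t. indicator {- pi..pi} t *\<^sub>R (\<phi> t * T t ^ k) \<partial>lborel) =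
        (\<integral>t. Re (cnj (h a) * (indicator {- pi..pi} t *\<^sub>R (h t * of_real (T t) ^ k * iexp (- (t * of_int 0))))) \<partial>lborel)"
      by (intro Bochner_Integration.integral_cong refl)
        (simp add: \<phi>_def mult.assoc [symmetric] flip: of_real_power)
    also have "\<dots> = Re (cnj (h a) * (\<integral>t. indicator {- pi..pi} t *\<^sub>R (h t * of_real (T t) ^ k * iexp (- (t * of_int 0))) \<partial>lborel))"
      by (subst integral_Re [OF integrable_mult_right [OF hi]]) (simp only: integral_mult_right_zero)
    also have "\<dots> = 0" by (simp only: zero) simp
    finally have I0: "(\<integral>t. indicator {- pi..pi} t *\<^sub>R (\<phi> t * T t ^ k) \<partial>lborel) = 0" .
    have ia: "integrable lborel (\<lambda>t. \<eta> * (1 + \<kappa>) ^ k * indicator {a - d / 2..a + d / 2} t)"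
      "integrable lborel (\<lambda>t. M * indicator {- pi..pi} t)"
      by (intro integrable_mult_right integrable_real_indicator; simp add: emeasure_lborel_Icc_eq)+
    have "(\<integral>t. \<eta> * (1 + \<kappa>) ^ k * indicator {a - d / 2..a + d / 2} t - M * indicator {- pi..pi} t \<partial>lborel) \<le>
        (\<integral>t. indicator {- pi..pi} t *\<^sub>R (\<phi> t * T t ^ k) \<partial>lborel)"
      by (intro integral_mono Bochner_Integration.integrable_diff ia i1 pw)
    then show ?thesis
      unfolding I0 using d ia by (simp add: Bochner_Integration.integral_diff mult.commute [of M])
  qed
  obtain k where "2 * pi * M / (\<eta> * d) < (1 + \<kappa>) ^ k"
    using real_arch_pow [of "1 + \<kappa>"] \<kappa> by auto
  then have "2 * pi * M < \<eta> * (1 + \<kappa>) ^ k * d"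
    using \<eta> d by (simp add: field_simps)
  with bound [of k] show False by simp
qed

theorem exp_type_pi_L1_unique:
  assumes F: "exp_type_le pi F" and L1: "integrable lborel (\<lambda>x. F (of_real x))"
    and zeros: "\<And>n::int. n \<noteq> 0 \<Longrightarrow> F (of_int n) = 0"
  shows "F z = 0"
proof -
  note cont = fourier_continuous [OF F L1]
  note inv = fourier_inversion [OF F L1]
  \<comment> \<open>The mean of the transform over the band: index 0 is the one coefficient that
    interpolation leaves free.\<close>
  define c where "c = (\<integral>t. indicator {- pi..pi} t *\<^sub>R fourier F t \<partial>lborel) / (2 * pi)"
  have ker: "(\<integral>t. indicator {- pi..pi} t *\<^sub>R (c * iexp (- (t * of_int n))) \<partial>lborel) = c * of_real (2 * pi * nsinc (- of_int n))" for n :: int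
    using integral_iexp_period [of "- of_int n"] by (simp add: integral_mult_right_zero flip: mult_scaleR_right)
  have const: "fourier F a - c = 0" if a: "- pi < a" "a < pi" for a
  proof (rule fourier_coefficients_unique [of "\<lambda>t. fourier F t - c", OF _ _ a])
    show "continuous_on UNIV (\<lambda>t. fourier F t - c)" by (intro continuous_intros cont)
    fix n :: int
    have "(\<integral>t. indicator {- pi..pi} t *\<^sub>R ((fourier F t - c) * iexp (- (t * of_int n))) \<partial>lborel) =
      (\<integral>t. indicator {- pi..pi} t *\<^sub>R (fourier F t * iexp (- (t * of_int n))) - indicator {- pi..pi} t *\<^sub>R (c * iexp (- (t * of_int n))) \<partial>lborel)"
      by (simp add: left_diff_distrib scaleR_diff_right)
    also have "\<dots> = (\<integral>t. indicator {- pi..pi} t *\<^sub>R (fourier F t * iexp (- (t * of_int n))) \<partial>lborel) -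
        (\<integral>t. indicator {- pi..pi} t *\<^sub>R (c * iexp (- (t * of_int n))) \<partial>lborel)"
      by (intro Bochner_Integration.integral_diff integrable_on_period continuous_intros cont)
    also have "\<dots> = 0"
    proof (cases "n = 0")
      case True
      then show ?thesis using ker [of 0] by (simp add: c_def nsinc_def)
    next
      case False
      have "sin (pi * - of_int n) = 0" using sin_zero_iff_int2 by (metis mult.commute of_int_minus)
      then show ?thesis using ker [of n] inv [of "of_int n"] zeros [OF False] False
        by (simp add: nsinc_def)
    qed
    finally show "(\<integral>t. indicator {- pi..pi} t *\<^sub>R ((fourier F t - c) * iexp (- (t * of_int n))) \<partial>lborel) = 0" .
  qed
  \<comment> \<open>Constant inside the band, zero at the edge frequency and continuous there: the
    constant must be 0.\<close>
  have edge: "fourier F pi = 0" unfolding fourier_def by (rule fourier_vanish [OF F _ L1]) auto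
  have "c = 0"
  proof -
    have X: "(\<lambda>n. pi - 1 / real (Suc n)) \<longlonglongrightarrow> pi"
      using tendsto_diff [OF tendsto_const LIMSEQ_Suc [OF lim_1_over_n], of pi] by simp
    have "isCont (fourier F) pi" using cont by (simp add: continuous_on_eq_continuous_at)
    then have "(\<lambda>n. fourier F (pi - 1 / real (Suc n))) \<longlonglongrightarrow> fourier F pi"
      using X by (rule isCont_tendsto_compose)
    moreover have "fourier F (pi - 1 / real (Suc n)) = c" for n
    proof -
      define e where "e = 1 / real (Suc n)"
      have "0 < e" "e \<le> 1" by (auto simp: e_def)
      then have "fourier F (pi - e) - c = 0" using pi_gt3 by (intro const) linarith+
      then show ?thesis by (simp add: e_def)
    qed
    ultimately have "(\<lambda>n. c) \<longlonglongrightarrow> 0" using edge by simp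
    then show ?thesis by (simp add: LIMSEQ_const_iff)
  qed
  have F0: "F (of_real w) = 0" for w
  proof -
    have "AE t in lborel. t \<noteq> pi \<and> t \<noteq> - pi"
      using AE_lborel_singleton [of pi] AE_lborel_singleton [of "- pi"] by eventually_elim auto
    then have "AE t in lborel. indicator {- pi..pi} t *\<^sub>R (fourier F t * iexp (- (t * w))) = 0"
      by eventually_elim (use const \<open>c = 0\<close> in \<open>auto simp: indicator_def\<close>)
    then have "(\<integral>t. indicator {- pi..pi} t *\<^sub>R (fourier F t * iexp (- (t * w))) \<partial>lborel) = 0"
      by (rule integral_eq_zero_AE)
    then show ?thesis using inv [of w] sinc_square_mass_pos by simp
  qed
  have "F holomorphic_on UNIV" using F by (simp add: exp_type_le_def)
  then show ?thesis
  proof (rule analytic_continuation [of F UNIV "range of_real" 0])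
    show "(0 :: complex) islimpt range of_real"
      unfolding islimpt_approachable
    proof (intro allI impI)
      fix e :: real assume "0 < e"
      then show "\<exists>x'\<in>range of_real. x' \<noteq> (0::complex) \<and> dist x' 0 < e"
        by (intro bexI [OF _ rangeI [of of_real "e / 2"]]) auto
    qed
  qed (use F0 in auto)
qed

section \<open>The minimal distance for one Gaussian\<close>

text \<open>A Wallis type recursion, obtained from the primitive y (1 - y^2)^(k+1), which vanishes
  at both ends.\<close>

lemma integral_one_minus_square_power:
  "(\<integral>y. indicator {0..1} y * (1 - y\<^sup>2) ^ k \<partial>lborel) = (4 ^ k * (fact k)\<^sup>2 / fact (2 * k + 1) :: real)"
proof (induction k)
  case 0
  then show ?case by simp
next
  case (Suc k)
  have i: "integrable lborel (\<lambda>y::real. indicator {0..1} y * (1 - y\<^sup>2) ^ j)" for j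
    using borel_integrable_atLeastAtMost' [of 0 1 "\<lambda>y::real. (1 - y\<^sup>2) ^ j"]
    by (simp add: set_integrable_def continuous_intros)
  have "(\<integral>y. (real (2 * k + 3) * (1 - y\<^sup>2) ^ Suc k - real (2 * k + 2) * (1 - y\<^sup>2) ^ k) * indicator {0..1} y \<partial>lborel) =
      (1::real) * (1 - 1\<^sup>2) ^ Suc k - 0 * (1 - 0\<^sup>2) ^ Suc k"
  proof (rule integral_FTC_Icc_real [of 0 1 "\<lambda>y. y * (1 - y\<^sup>2) ^ Suc k"])
    fix y :: real
    have "((\<lambda>y. y * (1 - y\<^sup>2) ^ Suc k) has_real_derivative (1 - y\<^sup>2) ^ Suc k + y * (real (Suc k) * (1 - y\<^sup>2) ^ k * (- (2 * y)))) (at y)"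
    proof -
      have "((\<lambda>y. 1 - y\<^sup>2) has_real_derivative - (2 * y)) (at y)" by (auto intro!: derivative_eq_intros)
      from DERIV_mult [OF DERIV_ident DERIV_power_Suc [OF this, of k]] show ?thesis
        by (rule DERIV_cong) (simp add: mult_ac add_ac)
    qed
    moreover have "(1 - y\<^sup>2) ^ Suc k + y * (real (Suc k) * (1 - y\<^sup>2) ^ k * (- (2 * y))) =
        real (2 * k + 3) * (1 - y\<^sup>2) ^ Suc k - real (2 * k + 2) * (1 - y\<^sup>2) ^ k"
      by (simp add: algebra_simps power2_eq_square)
    ultimately show "((\<lambda>y. y * (1 - y\<^sup>2) ^ Suc k) has_real_derivative real (2 * k + 3) * (1 - y\<^sup>2) ^ Suc k - real (2 * k + 2) * (1 - y\<^sup>2) ^ k) (at y)"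
      by simp
    show "isCont (\<lambda>y. real (2 * k + 3) * (1 - y\<^sup>2) ^ Suc k - real (2 * k + 2) * (1 - y\<^sup>2) ^ k) y"
      by (intro continuous_intros)
  qed simp
  then have "(\<integral>y. real (2 * k + 3) * (indicator {0..1} y * (1 - y\<^sup>2) ^ Suc k) - real (2 * k + 2) * (indicator {0..1} y * (1 - y\<^sup>2) ^ k) \<partial>lborel) = 0"
    by (simp add: algebra_simps)
  then have "real (2 * k + 3) * (\<integral>y. indicator {0..1} y * (1 - y\<^sup>2) ^ Suc k \<partial>lborel) = real (2 * k + 2) * (\<integral>y. indicator {0..1} y * (1 - y\<^sup>2) ^ k \<partial>lborel)"
    by (subst (asm) Bochner_Integration.integral_diff) (intro integrable_mult_right i | simp only: integral_mult_right_zero)+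
  then have "(\<integral>y. indicator {0..1} y * (1 - y\<^sup>2) ^ Suc k \<partial>lborel) = real (2 * k + 2) / real (2 * k + 3) * (4 ^ k * (fact k)\<^sup>2 / fact (2 * k + 1))"
  proof -
    have "A = q / p * B" if "p * A = q * B" "0 < p" for A B p q :: real
      using that by (simp add: field_simps)
    from this [OF \<open>real (2 * k + 3) * _ = _\<close>] show ?thesis unfolding Suc.IH by simp
  qed
  also have "\<dots> = 4 ^ Suc k * (fact (Suc k))\<^sup>2 / fact (2 * Suc k + 1)"
  proof -
    have f: "fact (2 * Suc k + 1) = real (2 * k + 3) * (real (2 * k + 2) * fact (2 * k + 1))"
      by (simp add: eval_nat_numeral algebra_simps)
    have e: "(4::real) ^ Suc k * (fact (Suc k))\<^sup>2 = 4 ^ k * (fact k)\<^sup>2 * (real (2 * k + 2) * real (2 * k + 2))"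
      by (simp add: power2_eq_square algebra_simps)
    show ?thesis unfolding f e by (simp add: divide_simps)
  qed
  finally show ?case .
qed

text \<open>Both sides of the next identity have the expansion
  \<open>\<Sum>k. (- 1) ^ k * k! / (2 k + 1)! * b ^ (2 k + 1) / 2\<close>.\<close>

lemma gauss_sine_integral_unit:
  fixes b :: real
  shows "(\<integral>x. indicator {0..} x * (exp (- x\<^sup>2) * sin (b * x)) \<partial>lborel) =
    b / 2 * (\<integral>y. indicator {0..1} y * exp (- (b\<^sup>2 / 4 * (1 - y\<^sup>2))) \<partial>lborel)"
proof -
  define t where "t k = (- 1) ^ k * (fact k / fact (2 * k + 1)) * b ^ (2 * k + 1) / 2" for k
  have t_sum: "summable (\<lambda>k. \<bar>t k\<bar>)"
  proof (rule summable_comparison_test')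
    show "summable (\<lambda>k. \<bar>b\<bar> * (inverse (fact k) * (b\<^sup>2) ^ k))"
      by (intro summable_mult summable_exp)
    fix k
    \<comment> \<open>So k!/(2 k + 1)! is at most 1/k!, and an exponential series dominates.\<close>
    have "fact k * fact k \<le> (fact (2 * k + 1) :: real)"
    proof -
      have "(fact k * fact k :: nat) dvd fact (k + k)" by (rule fact_fact_dvd_fact)
      then have "(fact k * fact k :: nat) \<le> fact (2 * k)" by (intro dvd_imp_le) (auto simp: mult_2)
      also have "\<dots> \<le> fact (2 * k + 1)" by (rule fact_mono_nat) simp
      finally have "real (fact k * fact k) \<le> real (fact (2 * k + 1))" by (simp only: of_nat_le_iff)
      then show ?thesis by (simp only: of_nat_mult of_nat_fact)
    qed
    moreover have "A / B \<le> inverse A" if "0 < A" "A * A \<le> B" for A B :: real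
    proof -
      have "A / B \<le> A / (A * A)" using that by (intro divide_left_mono) (auto intro: mult_pos_pos less_le_trans)
      then show ?thesis using that by (simp add: inverse_eq_divide)
    qed
    ultimately have "fact k / fact (2 * k + 1) \<le> (inverse (fact k) :: real)" by (meson fact_gt_zero)
    then have "fact k / fact (2 * k + 1) * (\<bar>b\<bar> * (b\<^sup>2) ^ k) \<le> inverse (fact k) * (\<bar>b\<bar> * (b\<^sup>2) ^ k)"
      by (rule mult_right_mono) simp
    moreover have "\<bar>t k\<bar> = fact k / fact (2 * k + 1) * (\<bar>b\<bar> * (b\<^sup>2) ^ k) / 2"
      by (simp add: t_def abs_mult power_abs power_mult)
    moreover have "0 \<le> fact k / fact (2 * k + 1) * (\<bar>b\<bar> * (b\<^sup>2) ^ k)" by simp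
    moreover have "u \<le> X" if "A \<le> X" "u = A / 2" "0 \<le> A" for A X u :: real using that by linarith
    ultimately have "\<bar>t k\<bar> \<le> inverse (fact k) * (\<bar>b\<bar> * (b\<^sup>2) ^ k)" by blast
    then show "norm \<bar>t k\<bar> \<le> \<bar>b\<bar> * (inverse (fact k) * (b\<^sup>2) ^ k)" by (simp add: mult_ac)
  qed
  define f where "f k x = (- 1) ^ k * b ^ (2 * k + 1) / fact (2 * k + 1) * (indicator {0..} x *\<^sub>R (exp (- x\<^sup>2) * x ^ (2 * k + 1)))" for k and x :: real
  have hf: "has_bochner_integral lborel (f k) (t k)" for k
    using has_bochner_integral_mult_right [OF gaussian_moment_odd_pos [of k], of "(- 1) ^ k * b ^ (2 * k + 1) / fact (2 * k + 1)"]
    by (simp add: f_def [abs_def] t_def mult_ac)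
  have hnf: "has_bochner_integral lborel (\<lambda>x. norm (f k x)) \<bar>t k\<bar>" for k
  proof -
    have "(\<lambda>x. norm (f k x)) = (\<lambda>x. \<bar>b\<bar> ^ (2 * k + 1) / fact (2 * k + 1) * (indicator {0..} x *\<^sub>R (exp (- x\<^sup>2) * x ^ (2 * k + 1))))"
      by (intro ext) (auto simp: f_def abs_mult power_abs indicator_def)
    moreover have "\<bar>b\<bar> ^ (2 * k + 1) / fact (2 * k + 1) * (fact k / 2) = \<bar>t k\<bar>"
      by (simp add: t_def abs_mult power_abs)
    ultimately show ?thesis
      using has_bochner_integral_mult_right [OF gaussian_moment_odd_pos [of k], of "\<bar>b\<bar> ^ (2 * k + 1) / fact (2 * k + 1)"] by simp
  qed
  have sin_sums: "(\<lambda>k. (- 1) ^ k / fact (2 * k + 1) * u ^ (2 * k + 1)) sums sin u" for u :: real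
    using sin_paired [of u] by simp
  have f_sums: "(\<lambda>k. f k x) sums (indicator {0..} x * (exp (- x\<^sup>2) * sin (b * x)))" for x
    using sums_mult [OF sin_sums [of "b * x"], of "indicator {0..} x * exp (- x\<^sup>2)"]
    by (simp add: f_def power_mult_distrib mult_ac)
  have f_abs: "summable (\<lambda>k. norm (f k x))" for x
  proof -
    have "summable (\<lambda>k. norm (sin_coeff k *\<^sub>R (b * x) ^ k))" by (rule summable_norm_sin)
    then have "summable (\<lambda>k. norm (sin_coeff (2 * k + 1) *\<^sub>R (b * x) ^ (2 * k + 1)))"
      by (rule summable_reindex [of _ "\<lambda>k. 2 * k + 1", unfolded o_def]) (auto simp: inj_def)
    from summable_mult [OF this, of "indicator {0..} x * exp (- x\<^sup>2)"]
    show ?thesis by (simp add: f_def sin_coeff_def abs_mult power_mult_distrib power_abs indicator_def mult_ac split: if_splits)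
  qed
  have 1: "t sums (\<integral>x. indicator {0..} x * (exp (- x\<^sup>2) * sin (b * x)) \<partial>lborel)"
  proof -
    have "(\<lambda>k. integral\<^sup>L lborel (f k)) sums (\<integral>x. (\<Sum>k. f k x) \<partial>lborel)"
      by (rule sums_integral) (use hf hnf f_abs t_sum in \<open>auto simp: has_bochner_integral_iff\<close>)
    moreover have "integral\<^sup>L lborel (f k) = t k" for k using hf by (simp add: has_bochner_integral_iff)
    moreover have "(\<Sum>k. f k x) = indicator {0..} x * (exp (- x\<^sup>2) * sin (b * x))" for x
      using f_sums by (simp add: sums_iff)
    ultimately show ?thesis by simp
  qed
  define g where "g k y = b / 2 * ((- (b\<^sup>2 / 4)) ^ k / fact k) * (indicator {0..1} y * (1 - y\<^sup>2) ^ k)" for k and y :: real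
  have gi: "integrable lborel (g k)" for k
    unfolding g_def [abs_def]
    using borel_integrable_atLeastAtMost' [of 0 1 "\<lambda>y::real. (1 - y\<^sup>2) ^ k"]
    by (intro integrable_mult_right) (simp add: set_integrable_def continuous_intros)
  have gt: "integral\<^sup>L lborel (g k) = t k" for k
  proof -
    have "integral\<^sup>L lborel (g k) = b / 2 * ((- (b\<^sup>2 / 4)) ^ k / fact k) * (4 ^ k * (fact k)\<^sup>2 / fact (2 * k + 1))"
      unfolding g_def [abs_def] by (simp only: integral_mult_right_zero integral_one_minus_square_power)
    also have "(- (b\<^sup>2 / 4)) ^ k = (- 1) ^ k * b ^ (2 * k) / 4 ^ k"
      by (simp add: power_minus [of "b\<^sup>2 / 4"] power_divide power_mult)
    finally show ?thesis by (simp add: t_def power2_eq_square) (simp add: mult_ac)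
  qed
  have gnt: "(\<integral>y. norm (g k y) \<partial>lborel) = \<bar>t k\<bar>" for k
  proof -
    have "norm (g k y) = \<bar>b / 2 * ((- (b\<^sup>2 / 4)) ^ k / fact k)\<bar> * (indicator {0..1} y * (1 - y\<^sup>2) ^ k)" for y
      by (auto simp: g_def abs_mult indicator_def power_le_one)
    then have "(\<integral>y. norm (g k y) \<partial>lborel) = \<bar>b / 2 * ((- (b\<^sup>2 / 4)) ^ k / fact k)\<bar> * (4 ^ k * (fact k)\<^sup>2 / fact (2 * k + 1))"
      by (simp only: integral_mult_right_zero integral_one_minus_square_power)
    also have "\<dots> = \<bar>b / 2 * ((- (b\<^sup>2 / 4)) ^ k / fact k) * (4 ^ k * (fact k)\<^sup>2 / fact (2 * k + 1))\<bar>"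
      by (simp add: abs_mult)
    also have "b / 2 * ((- (b\<^sup>2 / 4)) ^ k / fact k) * (4 ^ k * (fact k)\<^sup>2 / fact (2 * k + 1)) = t k"
      using gt [of k] unfolding g_def [abs_def] by (simp only: integral_mult_right_zero integral_one_minus_square_power)
    finally show ?thesis .
  qed
  have g_eq: "g k y = b / 2 * indicator {0..1} y * (inverse (fact k) *\<^sub>R (- (b\<^sup>2 / 4 * (1 - y\<^sup>2))) ^ k)" for k y
  proof -
    have "(- (p * q)) ^ k = (- p) ^ k * q ^ k" for p q :: real by (simp flip: power_mult_distrib)
    moreover have "u * (v / w) * (i * z) = u * i * (inverse w *\<^sub>R (v * z))" for u v w i z :: real
      by (simp add: divide_inverse)
    ultimately show ?thesis unfolding g_def by (simp only:)
  qed
  have g_sums: "(\<lambda>k. g k y) sums (b / 2 * (indicator {0..1} y * exp (- (b\<^sup>2 / 4 * (1 - y\<^sup>2)))))" for y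
  proof -
    have "(\<lambda>k. inverse (fact k) *\<^sub>R (- (b\<^sup>2 / 4 * (1 - y\<^sup>2))) ^ k) sums exp (- (b\<^sup>2 / 4 * (1 - y\<^sup>2)))"
      by (rule exp_converges)
    from sums_mult [OF this, of "b / 2 * indicator {0..1} y"] show ?thesis
      unfolding g_eq by (simp only: mult.assoc)
  qed
  have g_abs: "summable (\<lambda>k. norm (g k y))" for y
  proof -
    have "summable (\<lambda>k. norm (inverse (fact k) *\<^sub>R (- (b\<^sup>2 / 4 * (1 - y\<^sup>2))) ^ k))"
      by (rule summable_norm_exp)
    from summable_mult [OF this, of "norm (b / 2 * indicator {0..1} y)"] show ?thesis
      unfolding g_eq by (simp only: norm_mult)
  qed
  have "(\<lambda>k. integral\<^sup>L lborel (g k)) sums (\<integral>y. (\<Sum>k. g k y) \<partial>lborel)"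
    by (rule sums_integral [OF gi]) (use gnt g_abs t_sum in auto)
  moreover have "(\<Sum>k. g k y) = b / 2 * (indicator {0..1} y * exp (- (b\<^sup>2 / 4 * (1 - y\<^sup>2))))" for y
    using g_sums by (simp add: sums_iff)
  ultimately have "t sums (b / 2 * (\<integral>y. indicator {0..1} y * exp (- (b\<^sup>2 / 4 * (1 - y\<^sup>2))) \<partial>lborel))"
    by (simp add: gt)
  from sums_unique2 [OF 1 this] show ?thesis .
qed

text \<open>Scaling by sqrt c. This representation of the half-line sine transform is the origin of
  the mean over y and of the factor 1 - y^2 in the statement.\<close>

lemma gauss_sine_integral:
  fixes b c :: real
  assumes c: "0 < c"
  shows "(\<integral>x. indicator {0..} x * (exp (- (c * x\<^sup>2)) * sin (b * x)) \<partial>lborel) =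
    b / (2 * c) * (\<integral>y. indicator {0..1} y * exp (- (b\<^sup>2 / (4 * c) * (1 - y\<^sup>2))) \<partial>lborel)"
proof -
  define s where "s = sqrt c"
  have s: "0 < s" "s\<^sup>2 = c" using c by (auto simp: s_def)
  have "(\<integral>x. indicator {0..} x * (exp (- (c * x\<^sup>2)) * sin (b * x)) \<partial>lborel) =
      \<bar>1 / s\<bar> *\<^sub>R (\<integral>x. indicator {0..} (0 + 1 / s * x) * (exp (- (c * (0 + 1 / s * x)\<^sup>2)) * sin (b * (0 + 1 / s * x))) \<partial>lborel)"
    using s by (intro lborel_integral_real_affine) simp
  also have "(\<lambda>x. indicator {0..} (0 + 1 / s * x) * (exp (- (c * (0 + 1 / s * x)\<^sup>2)) * sin (b * (0 + 1 / s * x)))) =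
      (\<lambda>x. indicator {0..} x * (exp (- x\<^sup>2) * sin (b / s * x)))"
  proof
    fix x
    have "c * (0 + 1 / s * x)\<^sup>2 = x\<^sup>2"
      using s c by (simp add: power_divide)
    moreover have "indicator {0..} (0 + 1 / s * x) = (indicator {0..} x :: real)"
      using s by (simp add: indicator_def zero_le_divide_iff)
    ultimately show "indicator {0..} (0 + 1 / s * x) * (exp (- (c * (0 + 1 / s * x)\<^sup>2)) * sin (b * (0 + 1 / s * x))) =
      indicator {0..} x * (exp (- x\<^sup>2) * sin (b / s * x))" by simp
  qed
  also have "\<bar>1 / s\<bar> *\<^sub>R (\<integral>x. indicator {0..} x * (exp (- x\<^sup>2) * sin (b / s * x)) \<partial>lborel) =
      1 / s * (b / s / 2 * (\<integral>y. indicator {0..1} y * exp (- ((b / s)\<^sup>2 / 4 * (1 - y\<^sup>2))) \<partial>lborel))"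
    unfolding gauss_sine_integral_unit using s by simp
  also have "(b / s)\<^sup>2 / 4 = b\<^sup>2 / (4 * c)" using s by (simp add: power_divide)
  also have "1 / s * (b / s / 2 * (\<integral>y. indicator {0..1} y * exp (- (b\<^sup>2 / (4 * c) * (1 - y\<^sup>2))) \<partial>lborel)) =
      b / (2 * c) * (\<integral>y. indicator {0..1} y * exp (- (b\<^sup>2 / (4 * c) * (1 - y\<^sup>2))) \<partial>lborel)"
    using s by (simp add: power2_eq_square flip: s(2))
  finally show ?thesis .
qed

text \<open>For a > 0 this is D(sqrt a)/sqrt a, where D is Dawson's integral.\<close>

definition exp_mean :: "real \<Rightarrow> real" where
  "exp_mean a = (\<integral>y. indicator {0..1} y * exp (- (a * (1 - y\<^sup>2))) \<partial>lborel)"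

lemma exp_mean_integrable: "integrable lborel (\<lambda>y::real. indicator {0..1} y * exp (- (a * (1 - y\<^sup>2))))"
  using borel_integrable_atLeastAtMost' [of 0 1 "\<lambda>y::real. exp (- (a * (1 - y\<^sup>2)))"]
  by (simp add: set_integrable_def continuous_intros)

lemma exp_mean_nonneg: "0 \<le> exp_mean a"
  unfolding exp_mean_def by (rule Bochner_Integration.integral_nonneg) simp

text \<open>On [0, 1] one has y^2 \<le> y, and the exponent becomes linear. The decay 1/a makes the
  series over frequencies converge absolutely.\<close>

lemma exp_mean_le:
  assumes "0 < a"
  shows "exp_mean a \<le> 1 / a"
proof -
  have "exp_mean a \<le> (\<integral>y. exp (- (a * (1 - y))) * indicator {0..1} y \<partial>lborel)"
    unfolding exp_mean_def
  proof (rule integral_mono)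
    show "integrable lborel (\<lambda>y. exp (- (a * (1 - y))) * indicator {0..1} y)"
      using borel_integrable_atLeastAtMost' [of 0 1 "\<lambda>y::real. exp (- (a * (1 - y)))"]
      by (simp add: set_integrable_def continuous_intros mult.commute)
    fix y :: real
    show "indicator {0..1} y * exp (- (a * (1 - y\<^sup>2))) \<le> exp (- (a * (1 - y))) * indicator {0..1} y"
    proof (cases "y \<in> {0..1}")
      case True
      then have "y\<^sup>2 \<le> y" by (auto simp: power2_eq_square mult_left_le)
      then show ?thesis using True assms by simp
    qed simp
  qed (rule exp_mean_integrable)
  also have "\<dots> = exp (- (a * (1 - 1))) / a - exp (- (a * (1 - 0))) / a"
    by (rule integral_FTC_Icc_real [of 0 1 "\<lambda>y. exp (- (a * (1 - y))) / a"])
      (use assms in \<open>auto intro!: derivative_eq_intros continuous_intros\<close>)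
  also have "\<dots> \<le> 1 / a" using assms by simp
  finally show ?thesis .
qed

text \<open>The minimal distance for parameter c > 0: the approximating function has disappeared by
  orthogonality.\<close>

definition gauss_square_wave :: "real \<Rightarrow> real" where
  "gauss_square_wave c = (\<integral>x. indicator {0..} x * exp (- (c * x\<^sup>2)) * sgn (sin (pi * x)) \<partial>lborel)"

lemma gauss_half_line:
  assumes "0 < c"
  shows "has_bochner_integral lborel (\<lambda>x. indicator {0..} x * exp (- (c * x\<^sup>2))) (sqrt pi / (2 * sqrt c))"
proof -
  have s: "0 < sqrt c" using assms by simp
  have "has_bochner_integral lborel (\<lambda>x. indicator {0..} (0 + sqrt c * x) *\<^sub>R exp (- (0 + sqrt c * x)\<^sup>2)) ((sqrt pi / 2) /\<^sub>R \<bar>sqrt c\<bar>)"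
    using s by (intro lborel_has_bochner_integral_real_affine_iff [THEN iffD1, OF _ gaussian_moment_0]) simp
  moreover have "indicator {0..} (0 + sqrt c * x) *\<^sub>R exp (- (0 + sqrt c * x)\<^sup>2) = indicator {0..} x * exp (- (c * x\<^sup>2))" for x :: real
    using assms by (simp add: indicator_def zero_le_mult_iff power_mult_distrib)
  moreover have "(sqrt pi / 2) /\<^sub>R \<bar>sqrt c\<bar> = sqrt pi / (2 * sqrt c)"
    using s by (simp add: field_simps)
  ultimately show ?thesis by (simp only:)
qed

text \<open>The square wave is replaced by its Abel means, these are integrated termwise, and r
  tends to 1 on both sides. Only odd n = 2 j + 1 contribute, which yields the half-integers j + 1/2
  of the theta series.\<close>

lemma gauss_square_wave_sums:
  assumes l: "0 < l"
  shows "(\<lambda>j. 2 / (pi * l) * exp_mean (pi * (real j + 1 / 2)\<^sup>2 / l)) sums gauss_square_wave (pi * l)"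
proof -
  define c where "c = pi * l"
  have c: "0 < c" using l by (simp add: c_def)
  define f where "f x = complex_of_real (indicator {0..} x * exp (- (c * x\<^sup>2)))" for x
  have f: "integrable lborel f"
    unfolding f_def using gauss_half_line [OF c] by (intro integrable_of_real) (simp add: has_bochner_integral_iff)
  define a where "a n = odd_coeff n * (real n / (2 * l) * exp_mean ((real n)\<^sup>2 * pi / (4 * l)))" for n
  have s: "(\<integral>x. f x * of_real (sin (real n * (pi * x))) \<partial>lborel) = of_real (real n / (2 * l) * exp_mean ((real n)\<^sup>2 * pi / (4 * l)))" for n
  proof -
    have "(\<integral>x. f x * of_real (sin (real n * (pi * x))) \<partial>lborel) =
        (\<integral>x. of_real (indicator {0..} x * (exp (- (c * x\<^sup>2)) * sin ((real n * pi) * x))) \<partial>lborel)"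
      by (simp add: f_def mult_ac)
    also have "\<dots> = of_real (\<integral>x. indicator {0..} x * (exp (- (c * x\<^sup>2)) * sin ((real n * pi) * x)) \<partial>lborel)"
      by (rule integral_complex_of_real)
    also have "(\<integral>x. indicator {0..} x * (exp (- (c * x\<^sup>2)) * sin ((real n * pi) * x)) \<partial>lborel) =
        real n * pi / (2 * c) * exp_mean ((real n * pi)\<^sup>2 / (4 * c))"
      unfolding exp_mean_def by (rule gauss_sine_integral [OF c])
    also have "(real n * pi)\<^sup>2 / (4 * c) = (real n)\<^sup>2 * pi / (4 * l)"
      using l by (simp add: c_def power2_eq_square)
    also have "real n * pi / (2 * c) = real n / (2 * l)" by (simp add: c_def)
    finally show ?thesis .
  qed
  \<comment> \<open>The sine integral brings a factor n that cancels the coefficient 1/n; all decay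
    comes from \<open>exp_mean\<close>.\<close>
  have bound: "\<bar>a n\<bar> \<le> 2 / pi * (1 / (real n)\<^sup>2)" for n
  proof (cases "odd n")
    case True
    then have n: "0 < real n" by (cases n) auto
    have "exp_mean ((real n)\<^sup>2 * pi / (4 * l)) \<le> 1 / ((real n)\<^sup>2 * pi / (4 * l))"
      using n l by (intro exp_mean_le) simp
    then have "1 / real n * (real n / (2 * l) * exp_mean ((real n)\<^sup>2 * pi / (4 * l))) \<le>
        1 / real n * (real n / (2 * l) * (1 / ((real n)\<^sup>2 * pi / (4 * l))))"
      using n l by (intro mult_left_mono) auto
    also have "\<dots> = 2 / pi * (1 / (real n)\<^sup>2)" using n l by (simp add: field_simps)
    finally show ?thesis
      using True n l exp_mean_nonneg [of "(real n)\<^sup>2 * pi / (4 * l)"] by (simp add: a_def odd_coeff_def abs_mult)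
  qed (simp add: a_def odd_coeff_def)
  have sb: "summable (\<lambda>n. 2 / pi * (1 / (real n)\<^sup>2))"
    using inverse_power_summable [of 2, where 'a = real] by (intro summable_mult) (simp add: inverse_eq_divide)
  have sa: "summable a" by (rule summable_comparison_test' [OF sb]) (use bound in auto)
  define R where "R k = 1 - 1 / real (Suc k)" for k
  have R: "R \<longlonglongrightarrow> 1" "\<And>k. 0 \<le> R k" "\<And>k. R k < 1"
    using radii_tendsto_1 by (auto simp: R_def [abs_def])
  \<comment> \<open>Absolute summability at r = 1 makes the power series uniformly convergent on the
    closed interval, hence continuous up to 1.\<close>
  have lim1: "(\<lambda>k. \<Sum>n. a n * R k ^ n) \<longlonglongrightarrow> (\<Sum>n. a n)"
  proof -
    have "uniform_limit {0..1::real} (\<lambda>N r. \<Sum>n<N. a n * r ^ n) (\<lambda>r. \<Sum>n. a n * r ^ n) sequentially"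
    proof (rule Weierstrass_m_test [OF _ sb])
      fix n and r :: real assume "r \<in> {0..1}"
      then have "\<bar>a n\<bar> * \<bar>r ^ n\<bar> \<le> 2 / pi * (1 / (real n)\<^sup>2) * 1"
        using bound [of n] by (intro mult_mono) (auto simp: power_le_one)
      then show "norm (a n * r ^ n) \<le> 2 / pi * (1 / (real n)\<^sup>2)" by (simp add: abs_mult)
    qed
    then have "continuous_on {0..1} (\<lambda>r. \<Sum>n. a n * r ^ n)"
      by (rule uniform_limit_theorem [rotated]) (auto intro!: always_eventually continuous_intros)
    moreover have "R k \<in> {0..1}" for k using R(2,3) [of k] by simp
    ultimately have "(\<lambda>k. \<Sum>n. a n * R k ^ n) \<longlonglongrightarrow> (\<Sum>n. a n * 1 ^ n)"
      by (intro continuous_on_tendsto_compose [OF _ R(1)]) auto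
    then show ?thesis by simp
  qed
  have lim2: "(\<lambda>k. complex_of_real (\<Sum>n. a n * R k ^ n)) \<longlonglongrightarrow> of_real (pi / 4) * (\<integral>x. f x * of_real (sgn (sin (pi * x))) \<partial>lborel)"
  proof -
    have "complex_of_real (\<Sum>n. a n * R k ^ n) = (\<integral>x. f x * of_real (smooth_square_wave (R k) (pi * x)) \<partial>lborel)" for k
    proof -
      have "(\<lambda>n. complex_of_real (a n * R k ^ n)) sums (\<integral>x. f x * of_real (smooth_square_wave (R k) (pi * x)) \<partial>lborel)"
        using integral_smooth_square_wave_sums [OF f R(2,3), of k] unfolding s
        by (simp add: a_def mult_ac)
      moreover have "(\<lambda>n. a n * R k ^ n) sums (\<Sum>n. a n * R k ^ n)"
      proof (intro summable_sums summable_comparison_test' [OF sb])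
        fix n
        have "\<bar>a n\<bar> * \<bar>R k ^ n\<bar> \<le> 2 / pi * (1 / (real n)\<^sup>2) * 1"
          using bound [of n] R(2,3) [of k] by (intro mult_mono) (auto simp: power_le_one)
        then show "norm (a n * R k ^ n) \<le> 2 / pi * (1 / (real n)\<^sup>2)" by (simp add: abs_mult)
      qed
      then have "(\<lambda>n. complex_of_real (a n * R k ^ n)) sums of_real (\<Sum>n. a n * R k ^ n)"
        by (rule sums_of_real)
      ultimately show ?thesis by (rule sums_unique2 [rotated])
    qed
    then show ?thesis using integral_smooth_square_wave_tendsto [OF f R] by simp
  qed
  have "(\<integral>x. f x * of_real (sgn (sin (pi * x))) \<partial>lborel) = of_real (gauss_square_wave c)"
    unfolding gauss_square_wave_def f_def of_real_mult [symmetric] by (rule integral_complex_of_real)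
  with LIMSEQ_unique [OF lim2 tendsto_of_real [OF lim1]]
  have "complex_of_real (pi / 4 * gauss_square_wave c) = of_real (\<Sum>n. a n)" by simp
  then have "pi / 4 * gauss_square_wave c = (\<Sum>n. a n)" by (simp only: of_real_eq_iff)
  then have "a sums (pi / 4 * gauss_square_wave c)" using sa by (simp add: sums_iff)
  then have "(\<lambda>j. a (2 * j + 1)) sums (pi / 4 * gauss_square_wave c)"
  proof (subst sums_mono_reindex)
    show "strict_mono (\<lambda>j::nat. 2 * j + 1)" by (simp add: strict_mono_def)
    fix n :: nat assume "n \<notin> range (\<lambda>j. 2 * j + 1)"
    have "even n"
    proof (rule ccontr)
      assume "odd n"
      then obtain j where "n = 2 * j + 1" by (rule oddE)
      with \<open>n \<notin> range (\<lambda>j. 2 * j + 1)\<close> show False by blast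
    qed
    then show "a n = 0" by (simp add: a_def odd_coeff_def)
  qed
  then have "(\<lambda>j. 4 / pi * a (2 * j + 1)) sums (4 / pi * (pi / 4 * gauss_square_wave c))"
    by (rule sums_mult)
  moreover have "4 / pi * a (2 * j + 1) = 2 / (pi * l) * exp_mean (pi * (real j + 1 / 2)\<^sup>2 / l)" for j
  proof -
    have "(real (2 * j + 1))\<^sup>2 * pi / (4 * l) = pi * (real j + 1 / 2)\<^sup>2 / l"
      by (simp add: power2_eq_square field_simps)
    then show ?thesis by (simp add: a_def odd_coeff_def)
  qed
  ultimately show ?thesis by (simp add: c_def)
qed

text \<open>The first bound is uniform in l and serves small l; the second is the mass of the half
  Gaussian and serves large l. Together they match the weight 1/(1 + sqrt l).\<close>

lemma gauss_square_wave_bounds: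
  assumes l: "0 < l"
  shows "gauss_square_wave (pi * l) \<le> (\<Sum>j. 2 / pi\<^sup>2 * (1 / (real j + 1 / 2)\<^sup>2))"
    and "gauss_square_wave (pi * l) \<le> 1 / (2 * sqrt l)"
proof -
  have s: "summable (\<lambda>j. 2 / pi\<^sup>2 * (1 / (real j + 1 / 2)\<^sup>2))"
  proof (intro summable_mult)
    have "summable (\<lambda>n. 1 / (real n)\<^sup>2)"
      using inverse_power_summable [of 2, where 'a = real] by (simp add: inverse_eq_divide)
    then have "summable (\<lambda>j. 4 * (1 / (real (Suc j))\<^sup>2))" by (intro summable_mult) (subst summable_Suc_iff)
    then show "summable (\<lambda>j. 1 / (real j + 1 / 2)\<^sup>2)"
    proof (rule summable_comparison_test')
      fix j
      have "(real (Suc j) / 2)\<^sup>2 \<le> (real j + 1 / 2)\<^sup>2" by (intro power_mono) auto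
      then have "1 / (real j + 1 / 2)\<^sup>2 \<le> 1 / (real (Suc j) / 2)\<^sup>2" by (intro divide_left_mono) (auto intro!: mult_pos_pos)
      then show "norm (1 / (real j + 1 / 2)\<^sup>2) \<le> 4 * (1 / (real (Suc j))\<^sup>2)" by (simp add: power_divide)
    qed
  qed
  show "gauss_square_wave (pi * l) \<le> (\<Sum>j. 2 / pi\<^sup>2 * (1 / (real j + 1 / 2)\<^sup>2))"
  proof (rule sums_le [OF _ gauss_square_wave_sums [OF l] summable_sums [OF s]])
    fix j
    have "0 < real j + 1 / 2" by simp
    then have "exp_mean (pi * (real j + 1 / 2)\<^sup>2 / l) \<le> 1 / (pi * (real j + 1 / 2)\<^sup>2 / l)"
      using l by (intro exp_mean_le) simp
    then have "2 / (pi * l) * exp_mean (pi * (real j + 1 / 2)\<^sup>2 / l) \<le> 2 / (pi * l) * (1 / (pi * (real j + 1 / 2)\<^sup>2 / l))"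
      using l by (intro mult_left_mono) auto
    also have "\<dots> = 2 / pi\<^sup>2 * (1 / (real j + 1 / 2)\<^sup>2)" using l by (simp add: power2_eq_square)
    finally show "2 / (pi * l) * exp_mean (pi * (real j + 1 / 2)\<^sup>2 / l) \<le> 2 / pi\<^sup>2 * (1 / (real j + 1 / 2)\<^sup>2)" .
  qed
  have c: "0 < pi * l" using l by simp
  have i: "integrable lborel (\<lambda>x. indicator {0..} x * exp (- (pi * l * x\<^sup>2)))"
    using gauss_half_line [OF c] by (simp add: has_bochner_integral_iff)
  have "gauss_square_wave (pi * l) \<le> (\<integral>x. indicator {0..} x * exp (- (pi * l * x\<^sup>2)) \<partial>lborel)"
    unfolding gauss_square_wave_def
  proof (rule integral_mono [OF _ i])
    show "integrable lborel (\<lambda>x. indicator {0..} x * exp (- (pi * l * x\<^sup>2)) * sgn (sin (pi * x)))"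
      by (rule Bochner_Integration.integrable_bound [OF i]) (auto simp: abs_mult abs_sgn_eq)
    show "indicator {0..} x * exp (- (pi * l * x\<^sup>2)) * sgn (sin (pi * x)) \<le> indicator {0..} x * exp (- (pi * l * x\<^sup>2))" for x :: real
      by (rule mult_left_le) (auto simp: sgn_if)
  qed
  also have "\<dots> = sqrt pi / (2 * sqrt (pi * l))"
    using gauss_half_line [OF c] by (simp add: has_bochner_integral_iff)
  also have "\<dots> = 1 / (2 * sqrt l)" using l by (simp add: real_sqrt_mult)
  finally show "gauss_square_wave (pi * l) \<le> 1 / (2 * sqrt l)" .
qed

section \<open>The theta mean of the statement\<close>

lemma theta1_null:
  assumes u: "0 < u"
  shows "summable (\<lambda>j. exp (- (pi * u * (real j + 1 / 2)\<^sup>2)))"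
    and "theta1 0 (\<i> * of_real u) = of_real (2 * (\<Sum>j. exp (- (pi * u * (real j + 1 / 2)\<^sup>2))))"
proof -
  have c: "0 < pi * u" using u by simp
  show s: "summable (\<lambda>j. exp (- (pi * u * (real j + 1 / 2)\<^sup>2)))"
  proof (rule summable_comparison_test')
    show "summable (\<lambda>j. real j ^ 0 * exp (- (pi * u * (real j)\<^sup>2)) * 1 ^ j)"
      by (rule summable_gauss [OF c])
    show "norm (exp (- (pi * u * (real j + 1 / 2)\<^sup>2))) \<le> real j ^ 0 * exp (- (pi * u * (real j)\<^sup>2)) * 1 ^ j" for j
      using u by (simp add: power_mono)
  qed
  define f where "f n = complex_of_real (exp (- (pi * u * (of_int n + 1 / 2)\<^sup>2)))" for n :: int
  have p: "f (int j) = of_real (exp (- (pi * u * (real j + 1 / 2)\<^sup>2)))" for j by (simp add: f_def)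
  have m: "f (- 1 - int j) = of_real (exp (- (pi * u * (real j + 1 / 2)\<^sup>2)))" for j
  proof -
    have "(of_int (- 1 - int j) + 1 / 2)\<^sup>2 = (real j + 1 / 2)\<^sup>2"
      by (simp add: power2_eq_square algebra_simps)
    then show ?thesis by (simp only: f_def)
  qed
  have "exp (pi * \<i> * (\<i> * of_real u) * (of_int n + 1 / 2)\<^sup>2) * exp ((2 * of_int n + 1) * pi * \<i> * 0) = f n" for n
  proof -
    have "pi * \<i> * (\<i> * of_real u) * (of_int n + 1 / 2)\<^sup>2 = complex_of_real (- (pi * u * (of_int n + 1 / 2)\<^sup>2))"
      by (simp add: algebra_simps)
    then show ?thesis by (simp only: f_def exp_of_real [symmetric]) simp
  qed
  then have "theta1 0 (\<i> * of_real u) = infsum f UNIV"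
    by (simp only: theta1_def)
  also have "\<dots> = (\<Sum>j. f (int j)) + (\<Sum>j. f (- 1 - int j))"
    by (rule infsumI, rule has_sum_int_split) (use s in \<open>simp_all add: p m\<close>)
  also have "\<dots> = of_real (2 * (\<Sum>j. exp (- (pi * u * (real j + 1 / 2)\<^sup>2))))"
    unfolding p m by (simp add: suminf_of_real [OF s, symmetric])
  finally show "theta1 0 (\<i> * of_real u) = of_real (2 * (\<Sum>j. exp (- (pi * u * (real j + 1 / 2)\<^sup>2))))" .
qed

text \<open>Integrating the theta series over y term by term gives the values
  \<open>exp_mean\<close> at pi (j + 1/2)^2/l, which is the Fourier expansion of the distance just
  found.\<close>

lemma theta_mean_eq:
  assumes l: "0 < l"
  shows "theta_mean l = of_real (gauss_square_wave (pi * l))"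
proof -
  define h where "h j y = indicator {0..1} y * exp (- (pi * (real j + 1 / 2)\<^sup>2 / l * (1 - y\<^sup>2)))" for j and y :: real
  have hi: "integrable lborel (h j)" for j unfolding h_def by (rule exp_mean_integrable)
  have AE: "AE y in lborel. y \<noteq> (1::real)" by (rule AE_lborel_singleton)
  have h_eq: "h j y = exp (- (pi * (inverse l * (1 - y\<^sup>2)) * (real j + 1 / 2)\<^sup>2))" if "y \<in> {0..1}" for j y
  proof -
    have "pi * (real j + 1 / 2)\<^sup>2 / l * (1 - y\<^sup>2) = pi * (inverse l * (1 - y\<^sup>2)) * (real j + 1 / 2)\<^sup>2"
      by (simp only: divide_inverse mult_ac)
    then show ?thesis using that unfolding h_def by (simp only: indicator_simps mult_1_left)
  qed
  have sm: "summable (\<lambda>j. h j y)" if "y \<noteq> 1" for y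
  proof (cases "y \<in> {0..1}")
    case True
    then have "y\<^sup>2 < 1" using that by (simp add: abs_square_less_1)
    then have "0 < inverse l * (1 - y\<^sup>2)" using l by simp
    from theta1_null(1) [OF this] show ?thesis by (simp only: h_eq [OF True])
  qed (simp add: h_def)
  have sums: "(\<lambda>j. integral\<^sup>L lborel (h j)) sums (\<integral>y. (\<Sum>j. h j y) \<partial>lborel)"
  proof (rule sums_integral [OF hi])
    show "AE y in lborel. summable (\<lambda>j. norm (h j y))"
      using AE by eventually_elim (use sm in \<open>simp add: h_def\<close>)
    have "(\<lambda>j. pi * l / 2 * (2 / (pi * l) * exp_mean (pi * (real j + 1 / 2)\<^sup>2 / l))) sums (pi * l / 2 * gauss_square_wave (pi * l))"
      by (rule sums_mult [OF gauss_square_wave_sums [OF l]])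
    then have "summable (\<lambda>j. exp_mean (pi * (real j + 1 / 2)\<^sup>2 / l))"
      using l by (simp add: sums_iff)
    then show "summable (\<lambda>j. \<integral>y. norm (h j y) \<partial>lborel)"
      by (simp add: h_def exp_mean_def abs_mult)
  qed
  have "(LINT y:{0..1}|lborel. theta1 0 (\<i> * complex_of_real (inverse l * (1 - y\<^sup>2)))) =
      (\<integral>y. of_real (2 * (\<Sum>j. h j y)) \<partial>lborel)"
    unfolding set_lebesgue_integral_def
  proof (rule integral_cong_AE)
    have eq: "indicator {0..1} y *\<^sub>R theta1 0 (\<i> * complex_of_real (inverse l * (1 - y\<^sup>2))) = of_real (2 * (\<Sum>j. h j y))"
      if "y \<noteq> 1" for y
    proof (cases "y \<in> {0..1}")
      case True
      then have "y\<^sup>2 < 1" using that by (simp add: abs_square_less_1)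
      then have "0 < inverse l * (1 - y\<^sup>2)" using l by simp
      from theta1_null(2) [OF this] show ?thesis
        using True by (simp only: h_eq [OF True] indicator_simps scaleR_one)
    qed (simp add: h_def)
    show "AE y in lborel. indicator {0..1} y *\<^sub>R theta1 0 (\<i> * complex_of_real (inverse l * (1 - y\<^sup>2))) = of_real (2 * (\<Sum>j. h j y))"
      using AE by eventually_elim (rule eq)
    \<comment> \<open>Measurability is read off from the series over j. At the single point y = 1
      that series diverges, and the value there is patched by hand.\<close>
    have "(\<lambda>y. indicator {0..1} y *\<^sub>R theta1 0 (\<i> * complex_of_real (inverse l * (1 - y\<^sup>2)))) =
        (\<lambda>y. if y = 1 then theta1 0 0 else of_real (2 * (\<Sum>j. h j y)))"
      using eq by (intro ext) auto
    moreover have [measurable]: "h j \<in> borel_measurable borel" for j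
      unfolding h_def by measurable
    ultimately show "(\<lambda>y. indicator {0..1} y *\<^sub>R theta1 0 (\<i> * complex_of_real (inverse l * (1 - y\<^sup>2)))) \<in> borel_measurable lborel"
      "(\<lambda>y. complex_of_real (2 * (\<Sum>j. h j y))) \<in> borel_measurable lborel"
      by simp_all
  qed
  also have "\<dots> = of_real (2 * (\<integral>y. (\<Sum>j. h j y) \<partial>lborel))"
    by (simp only: integral_complex_of_real integral_mult_right_zero)
  finally have "theta_mean l = of_real (2 / (pi * l) * (\<integral>y. (\<Sum>j. h j y) \<partial>lborel))"
    using l by (simp add: theta_mean_def)
  moreover have "(\<lambda>j. 2 / (pi * l) * integral\<^sup>L lborel (h j)) sums (2 / (pi * l) * (\<integral>y. (\<Sum>j. h j y) \<partial>lborel))"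
    by (rule sums_mult [OF sums])
  then have "2 / (pi * l) * (\<integral>y. (\<Sum>j. h j y) \<partial>lborel) = gauss_square_wave (pi * l)"
    using gauss_square_wave_sums [OF l] unfolding h_def exp_mean_def by (rule sums_unique2)
  ultimately show ?thesis by (simp only:)
qed

section \<open>The distance for l = 0\<close>

lemma alt_harmonic_reflect:
  assumes x: "0 < x" "x < 1"
  shows "alt_harmonic x + alt_harmonic (1 - x) = pi / sin (pi * x)"
proof -
  have s: "sin (pi * x) \<noteq> 0" using x sin_gt_zero [of "pi * x"] by simp
  have "(- 1) ^ n * exp (- (0 * (real (Suc n))\<^sup>2)) / (x - real (Suc n)) = - ((- 1) ^ n / (1 - x + real n))" for n
    by (simp add: minus_divide_right)
  then have "kern_quot 0 x = 1 / (2 * x) - (\<Sum>n. - ((- 1) ^ n / (1 - x + real n)))"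
    by (simp add: kern_quot_def alt_gauss_def)
  also have "(\<Sum>n. - ((- 1) ^ n / (1 - x + real n))) = - alt_harmonic (1 - x)"
    unfolding alt_harmonic_def using x by (intro suminf_minus alt_harmonic_summable) simp
  finally show ?thesis using kern_quot_0 [OF s x(1)] by simp
qed

lemma alt_harmonic_nonneg:
  assumes x: "0 < x"
  shows "0 \<le> alt_harmonic x"
proof -
  have "0 \<le> 1 / (2 * x)" using x by simp
  then show ?thesis using alt_harmonic_ge [OF x] by linarith
qed

lemma alt_harmonic_le:
  assumes x: "0 < x"
  shows "alt_harmonic x \<le> 1 / x"
proof -
  have "0 \<le> 1 / (2 * (x + 1))" using x by simp
  then show ?thesis using alt_harmonic_shift [OF x] alt_harmonic_ge [of "x + 1"] x by linarith
qed

text \<open>By the functional equation each gap is half the difference of the values at x + j and x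
  + j + 1, so the sum telescopes.\<close>

lemma alt_harmonic_gap_sums:
  assumes x: "0 < x"
  shows "(\<lambda>j. alt_harmonic (x + real j) - 1 / (2 * (x + real j))) sums (alt_harmonic x / 2)"
proof -
  have lim: "(\<lambda>j. alt_harmonic (x + real j) / 2) \<longlonglongrightarrow> 0"
  proof (rule tendsto_sandwich)
    show "\<forall>\<^sub>F j in sequentially. 0 \<le> alt_harmonic (x + real j) / 2"
    proof (intro always_eventually allI)
      fix j
      show "0 \<le> alt_harmonic (x + real j) / 2" using alt_harmonic_nonneg [of "x + real j"] x by simp
    qed
    show "\<forall>\<^sub>F j in sequentially. alt_harmonic (x + real j) / 2 \<le> 1 / (x + real j)"
    proof (intro always_eventually allI)
      fix j
      have "h / 2 \<le> u" if "h \<le> u" "0 \<le> h" for h u :: real using that by simp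
      then show "alt_harmonic (x + real j) / 2 \<le> 1 / (x + real j)"
        using alt_harmonic_le [of "x + real j"] alt_harmonic_nonneg [of "x + real j"] x by simp
    qed
    show "(\<lambda>j. 1 / (x + real j)) \<longlonglongrightarrow> 0" by real_asymp
  qed auto
  have "(\<lambda>j. alt_harmonic (x + real j) / 2 - alt_harmonic (x + real (Suc j)) / 2) sums (alt_harmonic (x + real 0) / 2 - 0)"
    by (rule telescope_sums' [OF lim])
  moreover have "alt_harmonic (x + real j) / 2 - alt_harmonic (x + real (Suc j)) / 2 =
      alt_harmonic (x + real j) - 1 / (2 * (x + real j))" for j
  proof -
    define y where "y = x + real j"
    have y: "0 < y" "x + real (Suc j) = y + 1" using x by (auto simp: y_def)
    have "1 / y = 2 * (1 / (2 * y))" by simp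
    then have "alt_harmonic y / 2 - alt_harmonic (y + 1) / 2 = alt_harmonic y - 1 / (2 * y)"
      using alt_harmonic_shift [OF y(1)] by linarith
    then show ?thesis unfolding y_def [symmetric] y(2) .
  qed
  ultimately show ?thesis by simp
qed

lemma alt_harmonic_measurable [measurable]: "alt_harmonic \<in> borel_measurable borel"
  unfolding alt_harmonic_def by measurable

lemma nn_integral_periodize:
  fixes w :: "real \<Rightarrow> ennreal"
  assumes [measurable]: "w \<in> borel_measurable borel"
  shows "(\<integral>\<^sup>+x. indicator {0<..} x * w x \<partial>lborel) = (\<integral>\<^sup>+x. indicator {0<..1} x * (\<Sum>j. w (x + real j)) \<partial>lborel)"
proof -
  have "(\<Sum>j. indicator {0<..1} (x - real j)) = (indicator {0<..} x :: ennreal)" for x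
  proof (cases "0 < x")
    case True
    \<comment> \<open>The index of the cell (m, m + 1] that contains x; half-open cells tile the
      half-line without overlap.\<close>
    define m where "m = nat (\<lceil>x\<rceil> - 1)"
    have m: "0 < x - real m" "x - real m \<le> 1" using True by (auto simp: m_def; linarith)+
    have "indicator {0<..1} (x - real j) = (if j = m then 1 else 0 :: ennreal)" for j
      using m by (auto simp: indicator_def; linarith)
    then have "(\<Sum>j. indicator {0<..1} (x - real j)) = (\<Sum>j. if j = m then 1 else 0 :: ennreal)" by simp
    also have "\<dots> = 1" using sums_single [of m "\<lambda>_. 1 :: ennreal"] by (simp add: sums_iff)
    finally show ?thesis using True by simp
  qed (simp add: indicator_def)
  then have "(\<integral>\<^sup>+x. indicator {0<..} x * w x \<partial>lborel) = (\<integral>\<^sup>+x. (\<Sum>j. indicator {0<..1} (x - real j) * w x) \<partial>lborel)"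
    by (simp add: ennreal_suminf_multc)
  also have "\<dots> = (\<Sum>j. \<integral>\<^sup>+x. indicator {0<..1} (x - real j) * w x \<partial>lborel)"
    by (rule nn_integral_suminf) simp
  also have "(\<lambda>j. \<integral>\<^sup>+x. indicator {0<..1} (x - real j) * w x \<partial>lborel) =
      (\<lambda>j. \<integral>\<^sup>+x. indicator {0<..1} x * w (x + real j) \<partial>lborel)"
  proof
    fix j
    show "(\<integral>\<^sup>+x. indicator {0<..1} (x - real j) * w x \<partial>lborel) = (\<integral>\<^sup>+x. indicator {0<..1} x * w (x + real j) \<partial>lborel)"
      using nn_integral_real_affine [of "\<lambda>x. indicator {0<..1} (x - real j) * w x" 1 "real j"]
      by (simp add: add.commute)
  qed
  also have "(\<Sum>j. \<integral>\<^sup>+x. indicator {0<..1} x * w (x + real j) \<partial>lborel) =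
      (\<integral>\<^sup>+x. (\<Sum>j. indicator {0<..1} x * w (x + real j)) \<partial>lborel)"
    by (rule nn_integral_suminf [symmetric]) simp
  finally show ?thesis by simp
qed

lemma nn_integral_even:
  fixes w :: "real \<Rightarrow> ennreal"
  assumes [measurable]: "w \<in> borel_measurable borel"
  shows "(\<integral>\<^sup>+x. w \<bar>x\<bar> \<partial>lborel) = 2 * (\<integral>\<^sup>+x. indicator {0<..} x * w x \<partial>lborel)"
proof -
  have "(\<integral>\<^sup>+x. w \<bar>x\<bar> \<partial>lborel) = (\<integral>\<^sup>+x. indicator {0<..} x * w x + indicator {0<..} (- x) * w (- x) \<partial>lborel)"
    by (rule nn_integral_cong_AE, rule eventually_mono [OF AE_lborel_singleton [of 0]])
      (auto simp: indicator_def)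
  also have "\<dots> = (\<integral>\<^sup>+x. indicator {0<..} x * w x \<partial>lborel) + (\<integral>\<^sup>+x. indicator {0<..} (- x) * w (- x) \<partial>lborel)"
    by (rule nn_integral_add) auto
  also have "(\<integral>\<^sup>+x. indicator {0<..} (- x) * w (- x) \<partial>lborel) = (\<integral>\<^sup>+x. indicator {0<..} x * w x \<partial>lborel)"
    using nn_integral_real_affine [of "\<lambda>x. indicator {0<..} x * w x" "- 1" 0] by simp
  finally show ?thesis by (simp add: mult_2)
qed

text \<open>Averaging with the reflection x -> 1 - x makes the integrand constant: the sine is
  symmetric and cancels the denominator in the reflection formula.\<close>

lemma nn_integral_sin_alt_harmonic:
  "(\<integral>\<^sup>+x. indicator {0<..1} x * ennreal (\<bar>sin (pi * x)\<bar> * alt_harmonic x) \<partial>lborel) = ennreal (pi / 2)"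
proof -
  define h where "h x = indicator {0<..<1} x * ennreal (\<bar>sin (pi * x)\<bar> * alt_harmonic x)" for x :: real
  have [measurable]: "h \<in> borel_measurable borel" unfolding h_def by measurable
  note pos = alt_harmonic_nonneg
  have eq: "(\<integral>\<^sup>+x. indicator {0<..1} x * ennreal (\<bar>sin (pi * x)\<bar> * alt_harmonic x) \<partial>lborel) = (\<integral>\<^sup>+x. h x \<partial>lborel)"
    by (rule nn_integral_cong_AE, rule eventually_mono [OF AE_lborel_singleton [of 1]])
      (auto simp: h_def indicator_def)
  have "(\<integral>\<^sup>+x. h x \<partial>lborel) = (\<integral>\<^sup>+x. h (1 - x) \<partial>lborel)"
    using nn_integral_real_affine [of h "- 1" 1] by simp
  then have "2 * (\<integral>\<^sup>+x. h x \<partial>lborel) = (\<integral>\<^sup>+x. h x \<partial>lborel) + (\<integral>\<^sup>+x. h (1 - x) \<partial>lborel)"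
    by (simp add: mult_2)
  also have "\<dots> = (\<integral>\<^sup>+x. h x + h (1 - x) \<partial>lborel)"
    by (rule nn_integral_add [symmetric]) auto
  also have "\<dots> = (\<integral>\<^sup>+x. ennreal pi * indicator {0<..<1::real} x \<partial>lborel)"
  proof (rule nn_integral_cong)
    fix x :: real
    show "h x + h (1 - x) = ennreal pi * indicator {0<..<1} x"
    proof (cases "0 < x \<and> x < 1")
      case True
      then have s: "0 < sin (pi * x)" using sin_gt_zero [of "pi * x"] by simp
      have "sin (pi * (1 - x)) = sin (pi * x)"
        using sin_pi_minus [of "pi * x"] by (simp add: right_diff_distrib)
      then have "h x + h (1 - x) = ennreal (sin (pi * x) * alt_harmonic x + sin (pi * x) * alt_harmonic (1 - x))"
        using True s pos by (simp add: h_def ennreal_plus)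
      also have "sin (pi * x) * alt_harmonic x + sin (pi * x) * alt_harmonic (1 - x) = pi"
        using s alt_harmonic_reflect [of x] True by (simp flip: distrib_left)
      finally show ?thesis using True by simp
    qed (auto simp: h_def indicator_def)
  qed
  also have "\<dots> = ennreal pi" by (subst nn_integral_cmult_indicator) simp_all
  finally have "2 * (\<integral>\<^sup>+x. h x \<partial>lborel) = 2 * ennreal (pi / 2)"
    by (simp add: ennreal_mult' [symmetric] flip: ennreal_numeral)
  then show ?thesis unfolding eq by (simp add: ennreal_mult_cancel_left)
qed

text \<open>The even error is folded onto the half-line and summed over integer translates, where
  the gaps telescope; |sin(pi x)| has period 1 and factors out. The result 2 * 1/(2 pi) * pi/2 is
  the limiting value assigned to \<open>theta_mean\<close> at 0.\<close>

lemma nn_integral_kern_0_error: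
  "(\<integral>\<^sup>+x. ennreal \<bar>(if 0 < x then 1 else 0) - kern 0 x\<bar> \<partial>lborel) = ennreal (1 / 2)"
proof -
  define w where "w x = ennreal (\<bar>sin (pi * x)\<bar> / pi * (alt_harmonic x - 1 / (2 * x)))" for x
  have [measurable]: "w \<in> borel_measurable borel" unfolding w_def by measurable
  have "(\<integral>\<^sup>+x. ennreal \<bar>(if 0 < x then 1 else 0) - kern 0 x\<bar> \<partial>lborel) = (\<integral>\<^sup>+x. w \<bar>x\<bar> \<partial>lborel)"
  proof (rule nn_integral_cong_AE, rule eventually_mono [OF AE_sin_nonzero])
    fix x :: real assume x: "sin (pi * x) \<noteq> 0"
    have "\<bar>sin (pi * \<bar>x\<bar>)\<bar> = \<bar>sin (pi * x)\<bar>" by (cases "0 \<le> x") auto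
    then show "ennreal \<bar>(if 0 < x then 1 else 0) - kern 0 x\<bar> = w \<bar>x\<bar>"
      unfolding kern_0_error [OF x] by (simp add: w_def)
  qed
  also have "\<dots> = 2 * (\<integral>\<^sup>+x. indicator {0<..1} x * (\<Sum>j. w (x + real j)) \<partial>lborel)"
    by (simp add: nn_integral_even nn_integral_periodize)
  also have "(\<integral>\<^sup>+x. indicator {0<..1} x * (\<Sum>j. w (x + real j)) \<partial>lborel) =
      (\<integral>\<^sup>+x. ennreal (1 / (2 * pi)) * (indicator {0<..1} x * ennreal (\<bar>sin (pi * x)\<bar> * alt_harmonic x)) \<partial>lborel)"
  proof (rule nn_integral_cong)
    fix x :: real
    have "(\<Sum>j. w (x + real j)) = ennreal (1 / (2 * pi)) * ennreal (\<bar>sin (pi * x)\<bar> * alt_harmonic x)" if x: "0 < x"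
    proof -
      have "\<bar>sin (pi * (x + real j))\<bar> = \<bar>sin (pi * x)\<bar>" for j
        by (simp add: distrib_left sin_add abs_mult mult.commute [of pi "real j"])
      then have "w (x + real j) = ennreal (\<bar>sin (pi * x)\<bar> / pi * (alt_harmonic (x + real j) - 1 / (2 * (x + real j))))" for j
        by (simp only: w_def)
      moreover have "(\<lambda>j. \<bar>sin (pi * x)\<bar> / pi * (alt_harmonic (x + real j) - 1 / (2 * (x + real j)))) sums (\<bar>sin (pi * x)\<bar> / pi * (alt_harmonic x / 2))"
        by (rule sums_mult [OF alt_harmonic_gap_sums [OF x]])
      moreover have "0 \<le> \<bar>sin (pi * x)\<bar> / pi * (alt_harmonic (x + real j) - 1 / (2 * (x + real j)))" for j
        using alt_harmonic_ge [of "x + real j"] x by (intro mult_nonneg_nonneg) auto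
      ultimately have "(\<Sum>j. w (x + real j)) = ennreal (\<bar>sin (pi * x)\<bar> / pi * (alt_harmonic x / 2))"
        by (simp add: suminf_ennreal2 sums_iff)
      also have "\<bar>sin (pi * x)\<bar> / pi * (alt_harmonic x / 2) = 1 / (2 * pi) * (\<bar>sin (pi * x)\<bar> * alt_harmonic x)"
        by simp
      also have "ennreal \<dots> = ennreal (1 / (2 * pi)) * ennreal (\<bar>sin (pi * x)\<bar> * alt_harmonic x)"
        by (rule ennreal_mult') simp
      finally show ?thesis .
    qed
    then show "indicator {0<..1} x * (\<Sum>j. w (x + real j)) =
        ennreal (1 / (2 * pi)) * (indicator {0<..1} x * ennreal (\<bar>sin (pi * x)\<bar> * alt_harmonic x))"
      by (cases "0 < x") (auto simp: indicator_def)
  qed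
  also have "\<dots> = ennreal (1 / (2 * pi)) * ennreal (pi / 2)"
    by (simp add: nn_integral_cmult nn_integral_sin_alt_harmonic)
  also have "2 * \<dots> = ennreal (1 / 2)"
    by (simp add: ennreal_mult [symmetric] flip: ennreal_numeral)
  finally show ?thesis .
qed

section \<open>Interpolation, decay and distance for one kernel\<close>

lemma cardinal_series_of_real_sums:
  assumes "decreasing_sequence a"
  shows "(\<lambda>n. a (Suc n) * nsinc (x - real (Suc n))) sums Re (cardinal_series a (of_real x))"
    and "cardinal_series a (of_real x) = of_real (Re (cardinal_series a (of_real x)))"
proof -
  interpret decreasing_sequence a by fact
  have eq: "complex_of_real (a (Suc n)) * csinc (of_real x - of_nat (Suc n)) =
      of_real (a (Suc n) * nsinc (x - real (Suc n)))" for n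
    using csinc_of_real [of "x - real (Suc n)"] by simp
  note sums = cardinal_sums [of "of_real x", unfolded eq]
  show re: "(\<lambda>n. a (Suc n) * nsinc (x - real (Suc n))) sums Re (cardinal_series a (of_real x))"
    using sums_Re [OF sums] by simp
  show "cardinal_series a (of_real x) = of_real (Re (cardinal_series a (of_real x)))"
    by (rule sums_unique2 [OF sums]) (rule sums_of_real [OF re])
qed

lemma cardinal_series_of_int:
  assumes "decreasing_sequence a"
  shows "cardinal_series a (of_int n) = (if 0 < n then of_real (a (nat n)) else 0)"
proof -
  interpret decreasing_sequence a by fact
  have csinc: "csinc (of_int n - of_nat (Suc m)) = (if n = int (Suc m) then 1 else 0)" for m
    using csinc_of_int [of "n - int (Suc m)"] by simp
  show ?thesis
  proof (cases "0 < n")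
    case True
    then have "n = int (Suc (nat n - 1))" by simp
    then have "complex_of_real (a (Suc m)) * csinc (of_int n - of_nat (Suc m)) =
        (if m = nat n - 1 then of_real (a (Suc m)) else 0)" for m
      unfolding csinc by auto
    then have "(\<lambda>m. if m = nat n - 1 then complex_of_real (a (Suc m)) else 0) sums cardinal_series a (of_int n)"
      using cardinal_sums [of "of_int n"] by simp
    from sums_unique2 [OF this sums_single] show ?thesis using True by simp
  next
    case False
    then have "n \<noteq> int (Suc m)" for m by auto
    then show ?thesis using sums_unique [OF cardinal_sums [of "of_int n"]] False
      by (simp add: csinc del: of_nat_Suc)
  qed
qed

lemma nsinc_decay: "\<bar>nsinc y\<bar> * \<bar>y\<bar> \<le> 1"
proof (cases "y = 0")
  case False
  have "\<bar>nsinc y\<bar> * \<bar>y\<bar> = \<bar>sin (pi * y)\<bar> / pi"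
    using False by (simp add: nsinc_def abs_mult)
  also have "\<dots> \<le> 1 / pi" by (intro divide_right_mono) auto
  also have "\<dots> \<le> 1" using pi_gt3 by simp
  finally show ?thesis .
qed simp

text \<open>Supplies the integrability that orthogonality requires. Boundedness is immediate from
  the Gaussian coefficients; the quadratic decay is due to the coefficient at 0, through
  \<open>kern_quot_eq\<close>. The exceptional points, zeros of the sine, form a null set.\<close>

lemma kern_le_inverse_square:
  assumes c: "0 < c"
  obtains C where "\<And>x. sin (pi * x) \<noteq> 0 \<Longrightarrow> \<bar>kern c x\<bar> \<le> C * inverse (1 + x\<^sup>2)"
proof -
  define f where "f m = exp (- (c * (real m)\<^sup>2))" for m
  have f: "0 \<le> f m" for m by (simp add: f_def)
  define A where "A = (\<Sum>n. f (Suc n))"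
  define B where "B = (\<Sum>n. real (Suc n) * (1 + real (Suc n)) * f (Suc n))"
  have sA: "summable (\<lambda>n. f (Suc n))"
    using summable_gauss_Suc [OF c, of 0] by (simp add: f_def)
  have sB: "summable (\<lambda>n. real (Suc n) * (1 + real (Suc n)) * f (Suc n))"
    using summable_add [OF summable_gauss_Suc [OF c, of 1] summable_gauss_Suc [OF c, of 2]]
    by (simp add: f_def algebra_simps power2_eq_square)
  have "0 \<le> A" "0 \<le> B" unfolding A_def B_def using f by (intro suminf_nonneg sA sB; simp)+
  have near: "\<bar>kern c x\<bar> \<le> 1 / 2 + A" for x
  proof -
    have s: "summable (\<lambda>n. \<bar>f (Suc n) * nsinc (x - real (Suc n))\<bar>)"
    proof (rule summable_comparison_test' [OF sA])
      show "norm \<bar>f (Suc n) * nsinc (x - real (Suc n))\<bar> \<le> f (Suc n)" for n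
        using mult_left_mono [OF abs_nsinc_le_one f] by (simp add: abs_mult f)
    qed
    have "\<bar>kern c x\<bar> \<le> \<bar>alt_gauss c * nsinc x\<bar> + \<bar>\<Sum>n. f (Suc n) * nsinc (x - real (Suc n))\<bar>"
      unfolding kern_def f_def by (rule abs_triangle_ineq)
    also have "\<bar>alt_gauss c * nsinc x\<bar> \<le> 1 / 2 * 1"
      unfolding abs_mult using alt_gauss_nonneg [of c] alt_gauss_le_half [of c] c abs_nsinc_le_one
      by (intro mult_mono) auto
    also have "\<bar>\<Sum>n. f (Suc n) * nsinc (x - real (Suc n))\<bar> \<le> (\<Sum>n. \<bar>f (Suc n) * nsinc (x - real (Suc n))\<bar>)"
      by (rule summable_rabs [OF s])
    also have "\<dots> \<le> A"
      unfolding A_def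
    proof (rule suminf_le [OF _ s sA])
      show "\<bar>f (Suc n) * nsinc (x - real (Suc n))\<bar> \<le> f (Suc n)" for n
        using mult_left_mono [OF abs_nsinc_le_one f] by (simp add: abs_mult f)
    qed
    finally show ?thesis by simp
  qed
  have far: "\<bar>kern c x\<bar> * (\<bar>x\<bar> * (1 + \<bar>x\<bar>)) \<le> 2 * B" if x: "sin (pi * x) \<noteq> 0" for x
  proof -
    \<comment> \<open>The terms of x times the kernel: the bracket -m/(x (x - m)) has lost its
      factor 1/x. A further factor 1 + |x| is absorbed by \<open>nsinc (x - m)\<close> at the price
      2 (1 + m), which the Gaussian can pay.\<close>
    define t where "t n = f (Suc n) * (real (Suc n) * nsinc (x - real (Suc n)))" for n
    have "x \<noteq> 0" using x by auto
    have le: "\<bar>t n\<bar> * (1 + \<bar>x\<bar>) \<le> 2 * (real (Suc n) * (1 + real (Suc n)) * f (Suc n))" for n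
    proof -
      define m where "m = real (Suc n)"
      have m: "1 \<le> m" by (simp add: m_def)
      have "\<bar>nsinc (x - m)\<bar> * (1 + \<bar>x\<bar>) \<le> \<bar>nsinc (x - m)\<bar> * ((1 + \<bar>x - m\<bar>) * (1 + m))"
      proof (rule mult_left_mono)
        have "1 + \<bar>x\<bar> \<le> 1 + \<bar>x - m\<bar> + m" using m by linarith
        also have "\<dots> \<le> 1 + \<bar>x - m\<bar> + m + \<bar>x - m\<bar> * m" using m by simp
        finally show "1 + \<bar>x\<bar> \<le> (1 + \<bar>x - m\<bar>) * (1 + m)" by (simp add: algebra_simps)
      qed simp
      also have "\<dots> = (\<bar>nsinc (x - m)\<bar> + \<bar>nsinc (x - m)\<bar> * \<bar>x - m\<bar>) * (1 + m)"
        by (simp add: algebra_simps)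
      also have "\<dots> \<le> (1 + 1) * (1 + m)"
        using m by (intro mult_right_mono add_mono abs_nsinc_le_one nsinc_decay) auto
      finally have "f (Suc n) * m * (\<bar>nsinc (x - m)\<bar> * (1 + \<bar>x\<bar>)) \<le> f (Suc n) * m * (2 * (1 + m))"
        using m f [of "Suc n"] by (intro mult_left_mono) auto
      then show ?thesis using f [of "Suc n"] m
        unfolding t_def m_def [symmetric] by (simp add: abs_mult algebra_simps)
    qed
    have t: "(\<lambda>n. t n) sums (x * kern c x)"
    proof -
      have "sin (pi * x) / pi * ((- 1) ^ n * (1 / x - 1 / (x - real (Suc n))) * exp (- (c * (real (Suc n))\<^sup>2))) * x = t n" for n
      proof -
        define m where "m = real (Suc n)"
        have m: "x - m \<noteq> 0" using sin_pi_nz_imp [OF x, of "Suc n"] by (simp add: m_def)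
        have "1 / x - 1 / (x - m) = - m / (x * (x - m))"
          using m \<open>x \<noteq> 0\<close> by (simp add: divide_simps)
        then have "s * (e * (1 / x - 1 / (x - m)) * g) * x = g * (m * (s * (- e / (x - m))))" for s e g
          using \<open>x \<noteq> 0\<close> m by simp
        then show ?thesis
          unfolding t_def f_def nsinc_diff_of_nat [OF sin_pi_nz_imp [OF x]] m_def by (simp only: power_Suc mult_minus1)
      qed
      moreover have "sin (pi * x) / pi * kern_quot c x * x = x * kern c x"
        using kern_eq_quot [of c x] c x by simp
      ultimately show ?thesis
        using sums_mult2 [OF sums_mult [OF kern_quot_eq [OF c x], of "sin (pi * x) / pi"], of x] by simp
    qed
    have s: "summable (\<lambda>n. \<bar>t n\<bar> * (1 + \<bar>x\<bar>))"
      by (rule summable_comparison_test' [OF summable_mult [OF sB, of 2]]) (use le in simp)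
    then have s': "summable (\<lambda>n. \<bar>t n\<bar>)"
      using summable_mult_D [of "1 + \<bar>x\<bar>" "\<lambda>n. \<bar>t n\<bar>"] by (simp add: mult.commute)
    have "\<bar>kern c x\<bar> * (\<bar>x\<bar> * (1 + \<bar>x\<bar>)) = \<bar>\<Sum>n. t n\<bar> * (1 + \<bar>x\<bar>)"
      unfolding sums_unique [OF t, symmetric] by (simp add: abs_mult)
    also have "\<dots> \<le> (\<Sum>n. \<bar>t n\<bar>) * (1 + \<bar>x\<bar>)"
      by (intro mult_right_mono summable_rabs s') simp
    also have "\<dots> = (\<Sum>n. \<bar>t n\<bar> * (1 + \<bar>x\<bar>))" by (rule suminf_mult2 [OF s'])
    also have "\<dots> \<le> (\<Sum>n. 2 * (real (Suc n) * (1 + real (Suc n)) * f (Suc n)))"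
      by (intro suminf_le le s summable_mult sB)
    also have "\<dots> = 2 * B" unfolding B_def by (rule suminf_mult [OF sB])
    finally show ?thesis .
  qed
  show thesis
  proof (rule that)
    fix x assume x: "sin (pi * x) \<noteq> 0"
    show "\<bar>kern c x\<bar> \<le> (2 * (1 / 2 + A) + 4 * B) * inverse (1 + x\<^sup>2)"
    proof (cases "\<bar>x\<bar> \<le> 1")
      case True
      then have "x\<^sup>2 \<le> 1" by (simp add: abs_square_le_1)
      then have "\<bar>kern c x\<bar> * (1 + x\<^sup>2) \<le> (1 / 2 + A) * 2"
        using near [of x] \<open>0 \<le> A\<close> by (intro mult_mono) auto
      then have "\<bar>kern c x\<bar> * (1 + x\<^sup>2) \<le> 2 * (1 / 2 + A) + 4 * B" using \<open>0 \<le> B\<close> by linarith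
      then show ?thesis by (simp add: field_simps add_pos_nonneg)
    next
      case False
      have "1 + x\<^sup>2 \<le> \<bar>x\<bar> * (1 + \<bar>x\<bar>)"
        using False by (simp add: algebra_simps power2_eq_square abs_mult [symmetric])
      then have "\<bar>kern c x\<bar> * (1 + x\<^sup>2) \<le> \<bar>kern c x\<bar> * (\<bar>x\<bar> * (1 + \<bar>x\<bar>))"
        by (intro mult_left_mono) auto
      also note far [OF x]
      also have "2 * B \<le> 2 * (1 / 2 + A) + 4 * B" using \<open>0 \<le> A\<close> \<open>0 \<le> B\<close> by simp
      finally have "\<bar>kern c x\<bar> * (1 + x\<^sup>2) \<le> 2 * (1 / 2 + A) + 4 * B" .
      then show ?thesis by (simp add: field_simps add_pos_nonneg)
    qed
  qed
qed

definition kern_error :: "real \<Rightarrow> real \<Rightarrow> real" where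
  "kern_error c x = (if 0 < x then exp (- (c * x\<^sup>2)) else 0) - kern c x"

lemma kern_measurable [measurable]: "kern c \<in> borel_measurable borel"
  unfolding kern_def by measurable

lemma kern_error_measurable [measurable]: "kern_error c \<in> borel_measurable borel"
  unfolding kern_error_def by measurable

text \<open>For c > 0 the half Gaussian and the kernel are integrable separately. The modulus of the
  error is the error times the square wave, and against this wave the kernel integrates to
  0.\<close>

lemma nn_integral_kern_error:
  assumes c: "0 < c"
  shows "(\<integral>\<^sup>+x. ennreal \<bar>kern_error c x\<bar> \<partial>lborel) = ennreal (gauss_square_wave c)"
proof -
  define f where "f n = exp (- (c * (real n)\<^sup>2))" for n
  have f: "decreasing_sequence f" unfolding f_def using c by (intro decreasing_gauss) simp
  define F where "F z = complex_of_real (alt_gauss c) * csinc z + cardinal_series f z" for z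
  have F: "exp_type_le pi F"
    unfolding F_def by (intro exp_type_le_add exp_type_le_cmult exp_type_le_csinc exp_type_le_cardinal_series f)
  have F_real: "F (of_real x) = of_real (kern c x)" for x
    using c kern_eq_cardinal_series [of c x] cardinal_series_of_real_sums(2) [OF f, of x]
    unfolding f_def [symmetric] by (simp add: F_def csinc_of_real)
  have kern_int: "integrable lborel (kern c)"
  proof -
    obtain C where C: "\<And>x. sin (pi * x) \<noteq> 0 \<Longrightarrow> \<bar>kern c x\<bar> \<le> C * inverse (1 + x\<^sup>2)"
      using kern_le_inverse_square [OF c] by blast
    show ?thesis
    proof (rule Bochner_Integration.integrable_bound)
      show "integrable lborel (\<lambda>x. C * inverse (1 + x\<^sup>2))"
        by (intro integrable_mult_right integrable_inverse_one_plus_square)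
      show "AE x in lborel. norm (kern c x) \<le> norm (C * inverse (1 + x\<^sup>2))"
        using AE_sin_nonzero by eventually_elim (use C in \<open>auto intro: order.trans [OF _ abs_ge_self]\<close>)
    qed simp
  qed
  define g where "g x = indicator {0..} x * exp (- (c * x\<^sup>2))" for x
  have g: "integrable lborel g" unfolding g_def
    by (rule integrable.intros [OF gauss_half_line [OF c]])
  define s where "s x = sgn (sin (pi * x))" for x :: real
  have [measurable]: "s \<in> borel_measurable borel" unfolding s_def by measurable
  have bound: "integrable lborel (\<lambda>x. h x * s x)" if h: "integrable lborel h" for h
    by (rule Bochner_Integration.integrable_bound [OF h])
      (use borel_measurable_integrable [OF h] in \<open>auto simp: s_def abs_mult abs_sgn_eq\<close>)
  have "complex_of_real (\<integral>x. kern c x * s x \<partial>lborel) = 0"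
    using square_wave_orthogonal [OF F] kern_int unfolding F_real s_def
    by (simp flip: of_real_mult)
  then have 0: "(\<integral>x. kern c x * s x \<partial>lborel) = 0" by simp
  have i: "integrable lborel (\<lambda>x. g x * s x - kern c x * s x)"
    by (intro Bochner_Integration.integrable_diff bound g kern_int)
  have abs_eq: "\<bar>kern_error c x\<bar> = g x * s x - kern c x * s x" if x: "sin (pi * x) \<noteq> 0" for x
  proof -
    have "x \<noteq> 0" using x by auto
    then have "kern_error c x = g x - kern c x" by (auto simp: kern_error_def g_def)
    moreover have "0 \<le> sin (pi * x) * kern_error c x"
      unfolding kern_error_def using c \<open>x \<noteq> 0\<close> by (intro kern_sign) auto
    ultimately show ?thesis
      using x unfolding s_def
      by (auto simp: sgn_real_def abs_if zero_le_mult_iff split: if_splits)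
  qed
  have AE: "AE x in lborel. \<bar>kern_error c x\<bar> = g x * s x - kern c x * s x"
    using AE_sin_nonzero by eventually_elim (rule abs_eq)
  have "(\<integral>\<^sup>+x. ennreal \<bar>kern_error c x\<bar> \<partial>lborel) = (\<integral>\<^sup>+x. ennreal (g x * s x - kern c x * s x) \<partial>lborel)"
    by (rule nn_integral_cong_AE) (use AE in \<open>eventually_elim, simp\<close>)
  also have "\<dots> = ennreal (\<integral>x. g x * s x - kern c x * s x \<partial>lborel)"
    by (rule nn_integral_eq_integral [OF i]) (use AE in \<open>eventually_elim, use abs_ge_zero in metis\<close>)
  also have "(\<integral>x. g x * s x - kern c x * s x \<partial>lborel) = (\<integral>x. g x * s x \<partial>lborel) - (\<integral>x. kern c x * s x \<partial>lborel)"
    by (rule Bochner_Integration.integral_diff) (intro bound g kern_int)+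
  also have "\<dots> = gauss_square_wave c"
    unfolding 0 by (simp add: gauss_square_wave_def g_def s_def)
  finally show ?thesis .
qed

section \<open>Extremality from the sign of the error\<close>

lemma exp_type_le_diff:
  assumes "exp_type_le \<sigma> F" "exp_type_le \<sigma> G"
  shows "exp_type_le \<sigma> (\<lambda>z. F z - G z)"
  using exp_type_le_add [OF assms(1) exp_type_le_cmult [OF assms(2), of "- 1"]] by simp

lemma exp_type_le_continuous:
  assumes "exp_type_le \<sigma> F"
  shows "continuous_on UNIV (\<lambda>x::real. F (of_real x))"
proof -
  have "continuous_on UNIV F"
    using assms by (auto simp: exp_type_le_def intro: holomorphic_on_imp_continuous_on)
  then show ?thesis
    by (rule continuous_on_compose2) (auto intro: continuous_intros)
qed

text \<open>Supplies points of a set of full measure arbitrarily close to an integer on a prescribed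
  side.\<close>

lemma AE_lborel_interval:
  fixes a b :: real
  assumes "AE x in lborel. P x" "a < b"
  obtains x where "a < x" "x < b" "P x"
proof (rule ccontr)
  assume "\<not> thesis"
  then have "\<And>x. a < x \<Longrightarrow> x < b \<Longrightarrow> \<not> P x" using that by blast
  then have "AE x in lborel. x \<notin> {a<..<b}"
    using assms(1) by (auto elim!: eventually_mono)
  then have "emeasure lborel {a<..<b} = 0"
    by (subst (asm) AE_iff_measurable [of "{a<..<b}"]) auto
  then show False using assms(2) by simp
qed

text \<open>The sign pattern of \<open>g - k\<close> together with the orthogonality of functions of type \<open>\<pi>\<close> to
  \<open>sgn (sin (\<pi> x))\<close> gives extremality. In the case of equality the competitor must change sign with
  \<open>g\<close> at the nonzero integers, so it interpolates as well.\<close>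

lemma best_approx_of_sign:
  fixes g :: "real \<Rightarrow> real"
  assumes k: "exp_type_le pi k"
    and [measurable]: "g \<in> borel_measurable borel"
    and int: "integrable lborel (\<lambda>x. of_real (g x) - k (of_real x))"
    and real: "\<And>x. k (of_real x) \<in> \<real>"
    and sign: "\<And>x. 0 \<le> sin (pi * x) * (g x - Re (k (of_real x)))"
    and cont: "\<And>n::int. n \<noteq> 0 \<Longrightarrow> isCont g (of_int n)"
    and interp: "\<And>n::int. n \<noteq> 0 \<Longrightarrow> k (of_int n) = of_real (g (of_int n))"
  shows "best_approx pi g k" and "best_approx pi g K \<Longrightarrow> K = k"
proof -
  define s where "s x = sgn (sin (pi * x))" for x :: real
  have [measurable]: "s \<in> borel_measurable borel" unfolding s_def by measurable
  define D where "D K x = complex_of_real (g x) - K (complex_of_real x)" for K x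
  have meas: "D K \<in> borel_measurable borel" if "exp_type_le pi K" for K
    using borel_measurable_continuous_onI [OF exp_type_le_continuous [OF that]] unfolding D_def by measurable
  have Dk: "integrable lborel (D k)" using int by (simp add: D_def [abs_def])
  have bound: "integrable lborel (\<lambda>x. h x * of_real (s x))" if h: "integrable lborel h" for h :: "real \<Rightarrow> complex"
    by (rule Bochner_Integration.integrable_bound [OF h])
      (use borel_measurable_integrable [OF h] in \<open>auto simp: s_def norm_mult abs_sgn_eq\<close>)
  have le: "Re (D K x * of_real (s x)) \<le> cmod (D K x)" for K x
  proof -
    have "Re (D K x * of_real (s x)) \<le> cmod (D K x * of_real (s x))" by (rule complex_Re_le_cmod)
    also have "\<dots> \<le> cmod (D K x) * 1"
      unfolding norm_mult by (intro mult_left_mono) (auto simp: s_def abs_sgn_eq)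
    finally show ?thesis by simp
  qed
  have eq: "cmod (D k x) = Re (D k x * of_real (s x))" if x: "sin (pi * x) \<noteq> 0" for x
  proof -
    define d where "d = g x - Re (k (of_real x))"
    have "D k x = of_real d" using real [of x] by (simp add: D_def d_def complex_is_Real_iff complex_eq_iff)
    then show ?thesis
      using sign [of x] x unfolding d_def [symmetric]
      by (auto simp: s_def sgn_real_def abs_if zero_le_mult_iff split: if_splits)
  qed
  \<comment> \<open>The left side does not involve K: changing k into a competitor at finite
    distance adds an integrable function of type pi, which the square wave annihilates.\<close>
  have int_eq: "(\<integral>x. cmod (D k x) \<partial>lborel) = (\<integral>x. Re (D K x * of_real (s x)) \<partial>lborel)"
    if K: "exp_type_le pi K" and DK: "integrable lborel (D K)" for K
  proof -
    define F where "F z = K z - k z" for z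
    have F: "exp_type_le pi F" unfolding F_def by (rule exp_type_le_diff [OF K k])
    have FD: "F (of_real x) = D k x - D K x" for x by (simp add: F_def D_def)
    have L1: "integrable lborel (\<lambda>x. F (of_real x))"
      unfolding FD by (rule Bochner_Integration.integrable_diff [OF Dk DK])
    have "(\<integral>x. cmod (D k x) \<partial>lborel) = (\<integral>x. Re (D k x * of_real (s x)) \<partial>lborel)"
    proof (rule integral_cong_AE)
      show "AE x in lborel. cmod (D k x) = Re (D k x * of_real (s x))"
        using AE_sin_nonzero by eventually_elim (rule eq)
    qed (use meas [OF k] in measurable)
    also have "\<dots> = Re (\<integral>x. D k x * of_real (s x) \<partial>lborel)"
      by (rule integral_Re [OF bound [OF Dk]])
    also have "(\<integral>x. D k x * of_real (s x) \<partial>lborel) =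
        (\<integral>x. F (of_real x) * of_real (s x) + D K x * of_real (s x) \<partial>lborel)"
      by (simp add: FD algebra_simps)
    also have "\<dots> = (\<integral>x. F (of_real x) * of_real (s x) \<partial>lborel) + (\<integral>x. D K x * of_real (s x) \<partial>lborel)"
      by (rule Bochner_Integration.integral_add) (intro bound L1 DK)+
    also have "(\<integral>x. F (of_real x) * of_real (s x) \<partial>lborel) = 0"
      unfolding s_def by (rule square_wave_orthogonal [OF F L1])
    also have "Re (0 + (\<integral>x. D K x * of_real (s x) \<partial>lborel)) = (\<integral>x. Re (D K x * of_real (s x)) \<partial>lborel)"
      using integral_Re [OF bound [OF DK]] by simp
    finally show ?thesis .
  qed
  have dist: "L1_dist g K = ennreal (\<integral>x. cmod (D K x) \<partial>lborel)" if "integrable lborel (D K)" for K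
    unfolding L1_dist_def D_def [symmetric] by (rule nn_integral_eq_integral) (use that in auto)
  have fin: "integrable lborel (D K)" if "exp_type_le pi K" "L1_dist g K < \<infinity>" for K
    by (rule integrableI_bounded) (use that meas [OF that(1)] in \<open>auto simp: L1_dist_def D_def\<close>)
  show best: "best_approx pi g k"
    unfolding best_approx_def
  proof (intro conjI k allI impI)
    fix K assume K: "exp_type_le pi K"
    show "L1_dist g k \<le> L1_dist g K"
    proof (cases "L1_dist g K < \<infinity>")
      case True
      note DK = fin [OF K this]
      have "(\<integral>x. cmod (D k x) \<partial>lborel) \<le> (\<integral>x. cmod (D K x) \<partial>lborel)"
        unfolding int_eq [OF K DK]
        by (intro Bochner_Integration.integral_mono le Bochner_Integration.integrable_Re bound DK integrable_norm)
      then show ?thesis unfolding dist [OF DK] dist [OF Dk] by (rule ennreal_leI)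
    qed (simp add: not_less top_unique)
  qed
  assume bK: "best_approx pi g K"
  then have K: "exp_type_le pi K" and leK: "L1_dist g K \<le> L1_dist g k"
    using k by (auto simp: best_approx_def)
  have DK: "integrable lborel (D K)"
    using leK le_less_trans [OF _ ennreal_less_top] unfolding dist [OF Dk]
    by (intro fin [OF K]) (simp add: infinity_ennreal_def)
  have Re_int: "integrable lborel (\<lambda>x. Re (D K x * of_real (s x)))"
    by (intro Bochner_Integration.integrable_Re bound DK)
  have "(\<integral>x. cmod (D K x) \<partial>lborel) \<le> (\<integral>x. cmod (D k x) \<partial>lborel)"
    using leK unfolding dist [OF DK] dist [OF Dk] by (subst (asm) ennreal_le_iff) auto
  then have "(\<integral>x. cmod (D K x) - Re (D K x * of_real (s x)) \<partial>lborel) \<le> 0"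
    using int_eq [OF K DK]
    by (subst Bochner_Integration.integral_diff [OF integrable_norm [OF DK] Re_int]) simp
  moreover have nn: "0 \<le> cmod (D K x) - Re (D K x * of_real (s x))" for x using le [of K x] by simp
  ultimately have "(\<integral>x. cmod (D K x) - Re (D K x * of_real (s x)) \<partial>lborel) = 0"
    by (intro antisym Bochner_Integration.integral_nonneg)
  then have "AE x in lborel. cmod (D K x) - Re (D K x * of_real (s x)) = 0"
    using integral_nonneg_eq_0_iff_AE [OF Bochner_Integration.integrable_diff [OF integrable_norm [OF DK] Re_int]] nn
    by simp
  then have AE: "AE x in lborel. cmod (D K x) = Re (D K x) * s x" by eventually_elim simp
  have zero: "D K (of_int n) = 0" if n: "n \<noteq> 0" for n :: int
  proof -
    define c where "c = cos (pi * of_int n)"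
    have sin_n: "sin (pi * of_int n) = 0" by (simp add: sin_zero_iff_int2 mult.commute)
    then have c: "c \<noteq> 0" using sin_cos_squared_add [of "pi * of_int n"] by (auto simp: c_def)
    have sin_eq: "sin (pi * x) = c * sin (pi * (x - of_int n))" for x
      using sin_add [of "pi * (x - of_int n)" "pi * of_int n"] sin_n by (simp add: c_def algebra_simps)
    have "isCont (D K) (of_int n)"
      using cont [OF n] exp_type_le_continuous [OF K] unfolding D_def [abs_def]
      by (auto intro!: continuous_intros simp: continuous_on_eq_continuous_at)
    \<comment> \<open>The window has width 1/(j + 1); t = 1 places it to the right of n and t = 0 to
      the left.\<close>
    have limit: "(\<lambda>j. D K (X j)) \<longlonglongrightarrow> D K (of_int n)"
      if "\<And>j. of_int n + t / real (Suc j) - 1 / real (Suc j) < X j" "\<And>j. X j < of_int n + t / real (Suc j)"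
      for X t
    proof (rule isCont_tendsto_compose [OF \<open>isCont (D K) (of_int n)\<close>], rule tendsto_sandwich)
      show "(\<lambda>j. of_int n + t / real (Suc j) - 1 / real (Suc j)) \<longlonglongrightarrow> of_int n" by real_asymp
      show "(\<lambda>j. of_int n + t / real (Suc j)) \<longlonglongrightarrow> of_int n" by real_asymp
    qed (use that in \<open>auto intro!: always_eventually less_imp_le\<close>)
    have "\<exists>x. of_int n < x \<and> x < of_int n + 1 / real (Suc j) \<and> cmod (D K x) = Re (D K x) * s x" for j
      by (rule AE_lborel_interval [OF AE, of "of_int n" "of_int n + 1 / real (Suc j)"]) auto
    then obtain X where X: "\<And>j. of_int n < X j" "\<And>j. X j < of_int n + 1 / real (Suc j)"
      "\<And>j. cmod (D K (X j)) = Re (D K (X j)) * s (X j)" by metis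
    have "\<exists>x. of_int n - 1 / real (Suc j) < x \<and> x < of_int n \<and> cmod (D K x) = Re (D K x) * s x" for j
      by (rule AE_lborel_interval [OF AE, of "of_int n - 1 / real (Suc j)" "of_int n"]) auto
    then obtain Y where Y: "\<And>j. of_int n - 1 / real (Suc j) < Y j" "\<And>j. Y j < of_int n"
      "\<And>j. cmod (D K (Y j)) = Re (D K (Y j)) * s (Y j)" by metis
    have le1: "1 / real (Suc j) \<le> 1" for j by simp
    have sX: "s (X j) = sgn c" for j
    proof -
      have "0 < sin (pi * (X j - of_int n))" using X(1) [of j] order.strict_trans2 [OF X(2) add_left_mono [OF le1], of j] by (intro sin_gt_zero) auto
      then show ?thesis unfolding s_def sin_eq [of "X j"] by (simp add: sgn_mult)
    qed
    have sY: "s (Y j) = - sgn c" for j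
    proof -
      have "0 < sin (pi * (of_int n - Y j))" using Y(2) [of j] order.strict_trans1 [OF diff_left_mono [OF le1] Y(1), of j] by (intro sin_gt_zero) auto
      moreover have "sin (pi * (Y j - of_int n)) = - sin (pi * (of_int n - Y j))"
        using sin_minus [of "pi * (of_int n - Y j)"] by (simp only: mult_minus_right [symmetric] minus_diff_eq)
      ultimately show ?thesis unfolding s_def sin_eq [of "Y j"] by (simp add: sgn_mult)
    qed
    have limX: "(\<lambda>j. D K (X j)) \<longlonglongrightarrow> D K (of_int n)" by (rule limit [of 1]) (use X in auto)
    have limY: "(\<lambda>j. D K (Y j)) \<longlonglongrightarrow> D K (of_int n)" by (rule limit [of 0]) (use Y in auto)
    \<comment> \<open>The identity for the modulus is known only almost everywhere, so it is
      transported to n by limits. The square wave has opposite signs on the two sides while D K is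
      continuous, so the modulus equals its own negative.\<close>
    have "cmod (D K (of_int n)) = Re (D K (of_int n)) * sgn c"
    proof (rule LIMSEQ_unique)
      show "(\<lambda>j. cmod (D K (X j))) \<longlonglongrightarrow> cmod (D K (of_int n))" by (intro tendsto_intros limX)
      show "(\<lambda>j. cmod (D K (X j))) \<longlonglongrightarrow> Re (D K (of_int n)) * sgn c"
        unfolding X(3) sX by (intro tendsto_intros limX)
    qed
    moreover have "cmod (D K (of_int n)) = Re (D K (of_int n)) * - sgn c"
    proof (rule LIMSEQ_unique)
      show "(\<lambda>j. cmod (D K (Y j))) \<longlonglongrightarrow> cmod (D K (of_int n))" by (intro tendsto_intros limY)
      show "(\<lambda>j. cmod (D K (Y j))) \<longlonglongrightarrow> Re (D K (of_int n)) * - sgn c"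
        unfolding Y(3) sY by (intro tendsto_intros limY)
    qed
    ultimately show ?thesis by auto
  qed
  have "K z - k z = 0" for z
  proof (rule exp_type_pi_L1_unique [where F = "\<lambda>z. K z - k z"])
    show "exp_type_le pi (\<lambda>z. K z - k z)" by (rule exp_type_le_diff [OF K k])
    have "integrable lborel (\<lambda>x. D k x - D K x)" by (rule Bochner_Integration.integrable_diff [OF Dk DK])
    then show "integrable lborel (\<lambda>x. K (of_real x) - k (of_real x))" by (simp add: D_def)
    show "K (of_int n) - k (of_int n) = 0" if "n \<noteq> 0" for n :: int
      using zero [OF that] interp [OF that] by (simp add: D_def)
  qed
  then show "K = k" by (intro ext) simp
qed

section \<open>Superposition of Gaussians\<close>

text \<open>Exponential decay in l is dominated by the weight of the hypothesis, so every Gaussian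
  at a point x with x^2 > 0 is \<nu>-integrable. The constant comes from 2 + l \<le> (2 + 1/d) (1 +
  d l).\<close>

lemma exp_le_inverse_one_plus_sqrt:
  assumes d: "0 < d" and l: "0 \<le> l"
  shows "exp (- (d * l)) \<le> (2 + 1 / d) * (1 / (1 + sqrt l))"
proof -
  have "sqrt l \<le> 1 + l"
    by (rule real_le_lsqrt) (use l in \<open>auto simp: power2_eq_square algebra_simps\<close>)
  then have "1 + sqrt l \<le> 2 + l" by simp
  also have "\<dots> \<le> (2 + 1 / d) * (1 + d * l)"
    using d l by (simp add: algebra_simps)
  also have "\<dots> \<le> (2 + 1 / d) * exp (d * l)"
    using d exp_ge_add_one_self [of "d * l"] by (intro mult_left_mono) auto
  finally have "(1 + sqrt l) * exp (- (d * l)) \<le> (2 + 1 / d) * exp (d * l) * exp (- (d * l))"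
    by (rule mult_right_mono) simp
  also have "\<dots> = 2 + 1 / d" by (simp add: mult.assoc flip: exp_add)
  finally have "exp (- (d * l)) * (1 + sqrt l) \<le> 2 + 1 / d" by (simp only: mult.commute)
  moreover have "0 < 1 + sqrt l" using l by (simp add: add_pos_nonneg)
  ultimately show ?thesis by (simp add: pos_le_divide_eq)
qed

locale half_line_measure =
  fixes \<nu> :: "real measure"
  assumes sets_nu: "sets \<nu> = sets (restrict_space borel {0..})"
    and finite_nu: "(\<integral>\<^sup>+ l. ennreal (1 / (1 + sqrt l)) \<partial>\<nu>) < \<infinity>"
begin

lemma space_nu: "space \<nu> = {0..}"
  using sets_eq_imp_space_eq [OF sets_nu] by (simp add: space_restrict_space)

lemma measurable_nu:
  assumes "f \<in> borel_measurable borel"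
  shows "f \<in> borel_measurable \<nu>"
  using measurable_restrict_space1 [OF assms, of "{0..}"] measurable_cong_sets [OF sets_nu refl] by blast

lemma measurable_ident_nu: "(\<lambda>l. l) \<in> borel_measurable \<nu>"
  by (rule measurable_nu) simp

lemma integrable_nu_bound:
  fixes f :: "real \<Rightarrow> 'b :: {banach, second_countable_topology}"
  assumes "f \<in> borel_measurable \<nu>" "\<And>l. 0 \<le> l \<Longrightarrow> norm (f l) \<le> C * (1 / (1 + sqrt l))"
  shows "integrable \<nu> f"
proof (rule Bochner_Integration.integrable_bound)
  have [measurable]: "(\<lambda>l. 1 / (1 + sqrt l)) \<in> borel_measurable \<nu>" by (rule measurable_nu) measurable
  have "(\<integral>\<^sup>+ l. ennreal (norm (1 / (1 + sqrt l))) \<partial>\<nu>) = (\<integral>\<^sup>+ l. ennreal (1 / (1 + sqrt l)) \<partial>\<nu>)"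
    by (rule nn_integral_cong) (simp add: space_nu)
  then have "integrable \<nu> (\<lambda>l. 1 / (1 + sqrt l))"
    using finite_nu by (intro integrableI_bounded) auto
  then show "integrable \<nu> (\<lambda>l. C * (1 / (1 + sqrt l)))" by (rule integrable_mult_right)
  show "AE l in \<nu>. norm (f l) \<le> norm (C * (1 / (1 + sqrt l)))"
    by (rule AE_I2) (simp add: space_nu order.trans [OF assms(2) abs_ge_self] del: times_divide_eq_right)
qed (rule assms(1))

text \<open>The measure may be infinite, but on [0, n] the weight is bounded below, so these
  intervals have finite mass. The exchange of integrals relies on this.\<close>

lemma sigma_finite_nu: "sigma_finite_measure \<nu>"
proof
  have in_sets: "{0..real n} \<in> sets \<nu>" for n
    unfolding sets_nu by (auto simp: sets_restrict_space image_iff intro!: bexI [of _ "{0..real n}"])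
  show "\<exists>A. countable A \<and> A \<subseteq> sets \<nu> \<and> \<Union> A = space \<nu> \<and> (\<forall>a\<in>A. emeasure \<nu> a \<noteq> \<infinity>)"
  proof (intro exI [of _ "range (\<lambda>n. {0..real n})"] conjI ballI)
    show "\<Union> (range (\<lambda>n. {0..real n})) = space \<nu>"
      using real_arch_simple by (auto simp: space_nu)
    fix A assume "A \<in> range (\<lambda>n. {0..real n})"
    then obtain n where A: "A = {0..real n}" by blast
    have "integrable \<nu> (indicator A :: real \<Rightarrow> real)"
    proof (rule integrable_nu_bound)
      show "indicator A \<in> borel_measurable \<nu>"
        unfolding A by (rule borel_measurable_indicator) (rule in_sets)
      fix l :: real assume "0 \<le> l"
      show "norm (indicator A l :: real) \<le> (1 + sqrt (real n)) * (1 / (1 + sqrt l))"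
        using \<open>0 \<le> l\<close> by (auto simp: A indicator_def add_pos_nonneg)
    qed
    then show "emeasure \<nu> A \<noteq> \<infinity>"
      using in_sets [of n] by (simp add: A integrable_indicator_iff space_nu Int_absorb2)
  qed (use in_sets in auto)
qed

lemma integrable_exp_nu:
  assumes "0 < d"
  shows "integrable \<nu> (\<lambda>l. exp (- (d * l)))"
  by (rule integrable_nu_bound [of _ "2 + 1 / d"])
    (use exp_le_inverse_one_plus_sqrt [OF assms] in \<open>auto intro: measurable_nu\<close>)

lemma integrable_gauss_nu:
  assumes "x \<noteq> 0"
  shows "integrable \<nu> (\<lambda>l. exp (- (pi * l * x\<^sup>2)))"
  using integrable_exp_nu [of "pi * x\<^sup>2"] assms by (simp add: mult_ac)

definition node :: "nat \<Rightarrow> real" where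
  "node n = (\<integral>l. exp (- (pi * l * (real n)\<^sup>2)) \<partial>\<nu>)"

lemma decreasing_node: "decreasing_sequence node"
proof
  show "0 \<le> node n" for n unfolding node_def by simp
  show "node (Suc n) \<le> node n" if "1 \<le> n" for n
    unfolding node_def
  proof (rule Bochner_Integration.integral_mono)
    show "integrable \<nu> (\<lambda>l. exp (- (pi * l * (real (Suc n))\<^sup>2)))" "integrable \<nu> (\<lambda>l. exp (- (pi * l * (real n)\<^sup>2)))"
      using that by (intro integrable_gauss_nu; simp)+
    show "exp (- (pi * l * (real (Suc n))\<^sup>2)) \<le> exp (- (pi * l * (real n)\<^sup>2))" if "l \<in> space \<nu>" for l
      using that by (simp add: space_nu mult_left_mono power_mono)
  qed
qed

lemma alt_gauss_measurable [measurable]: "alt_gauss \<in> borel_measurable borel"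
  unfolding alt_gauss_def by measurable

lemma integrable_alt_gauss_nu: "integrable \<nu> (\<lambda>l. alt_gauss (pi * l))"
proof (rule Bochner_Integration.integrable_bound [OF integrable_exp_nu [OF pi_gt_zero]])
  show "AE l in \<nu>. norm (alt_gauss (pi * l)) \<le> norm (exp (- (pi * l)))"
    by (rule AE_I2) (use alt_gauss_nonneg alt_gauss_le_exp in \<open>simp add: space_nu\<close>)
qed (rule measurable_nu, measurable)

text \<open>The superposition is carried out on the coefficients, so type and interpolation are
  inherited from the cardinal series of \<open>node\<close>. That its real values are the
  \<nu>-integrals of the kernels is a separate fact.\<close>

definition extremal :: "complex \<Rightarrow> complex" where
  "extremal z = of_real (\<integral>l. alt_gauss (pi * l) \<partial>\<nu>) * csinc z + cardinal_series node z"

lemma exp_type_extremal: "exp_type_le pi extremal"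
  unfolding extremal_def
  by (intro exp_type_le_add exp_type_le_cmult exp_type_le_csinc exp_type_le_cardinal_series decreasing_node)

lemma extremal_real: "extremal (of_real x) \<in> \<real>"
proof -
  have "cardinal_series node (of_real x) \<in> \<real>"
    by (subst cardinal_series_of_real_sums(2) [OF decreasing_node]) (rule Reals_of_real)
  then show ?thesis unfolding extremal_def csinc_of_real by simp
qed

text \<open>The point 0 is left out because the integral may diverge there and the step has the
  value 1/2.\<close>

lemma trunc_gauss_eq:
  "x \<noteq> 0 \<Longrightarrow> trunc_gauss \<nu> x = (\<integral>l. (if 0 < x then exp (- (pi * l * x\<^sup>2)) else 0) \<partial>\<nu>)"
  by (cases "0 < x") (simp_all add: trunc_gauss_def x_plus_0_def sgn_if)

lemma extremal_of_int:
  assumes "n \<noteq> 0"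
  shows "extremal (of_int n) = of_real (trunc_gauss \<nu> (of_int n))"
  using assms by (simp add: extremal_def csinc_of_int cardinal_series_of_int [OF decreasing_node]
      trunc_gauss_eq node_def)

lemma kern_pi_measurable [measurable]: "(\<lambda>(l, x). kern_error (pi * l) x) \<in> borel_measurable (\<nu> \<Otimes>\<^sub>M lborel)"
proof -
  note [measurable] = measurable_ident_nu
  have 1: "(\<lambda>(l, x). kern_error (pi * l) x) \<in> borel_measurable (borel \<Otimes>\<^sub>M borel)"
    unfolding kern_error_def kern_def by measurable
  have 2: "(\<lambda>p. (fst p, snd p)) \<in> measurable (\<nu> \<Otimes>\<^sub>M lborel) (borel \<Otimes>\<^sub>M borel)"
    by measurable
  show ?thesis using measurable_compose [OF 2 1] by (simp only: prod.collapse)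
qed

text \<open>Here the \<nu>-integral is exchanged with a series that need not converge absolutely,
  for instance when \<nu> has mass at 0. Dominated convergence is therefore applied to partial sums,
  not to single terms.\<close>

lemma kern_error_has_integral:
  assumes x: "x \<noteq> 0"
  shows "has_bochner_integral \<nu> (\<lambda>l. kern_error (pi * l) x) (trunc_gauss \<nu> x - Re (extremal (of_real x)))"
proof -
  define f where "f n l = exp (- (pi * l * (real (Suc n))\<^sup>2))" for n l
  define S where "S N l = (\<Sum>n<N. f n l * nsinc (x - real (Suc n)))" for N l
  define c where "c l = Re (cardinal_series (\<lambda>n. exp (- (pi * l * (real n)\<^sup>2))) (of_real x))" for l
  have [measurable]: "S N \<in> borel_measurable borel" for N unfolding S_def f_def by measurable
  have conv: "(\<lambda>N. S N l) \<longlonglongrightarrow> c l" if "0 \<le> l" for l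
    using kern_sums [of "pi * l" x] that unfolding sums_def S_def f_def c_def by simp
  have fi: "integrable \<nu> (f n)" for n unfolding f_def by (rule integrable_gauss_nu) simp
  have Si: "(\<integral>l. S N l \<partial>\<nu>) = (\<Sum>n<N. node (Suc n) * nsinc (x - real (Suc n)))" for N
    unfolding S_def by (simp add: Bochner_Integration.integral_sum fi f_def [symmetric] node_def del: of_nat_Suc)
  obtain B where B: "\<And>a (z :: complex) N. decreasing_sequence a \<Longrightarrow>
     cmod (\<Sum>n<N. of_real (a (Suc n)) * csinc (z - of_nat (Suc n))) \<le> a 1 * (B * (1 + cmod z) * exp (pi * cmod z))"
    using cardinal_partial_sum_bound by blast
  \<comment> \<open>In the uniform bound l enters only through the first coefficient exp(-pi l), so
    this constant times exp(-pi l) dominates all partial sums.\<close>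
  define M where "M = B * (1 + \<bar>x\<bar>) * exp (pi * \<bar>x\<bar>)"
  have bound: "norm (S N l) \<le> exp (- (pi * l)) * M" if "0 \<le> l" for N l
  proof -
    have "complex_of_real (exp (- (pi * l * (real (Suc n))\<^sup>2))) * csinc (of_real x - of_nat (Suc n)) =
        of_real (f n l * nsinc (x - real (Suc n)))" for n
      using csinc_of_real [of "x - real (Suc n)"] by (simp add: f_def)
    then have "(\<Sum>n<N. complex_of_real (exp (- (pi * l * (real (Suc n))\<^sup>2))) * csinc (of_real x - of_nat (Suc n))) =
        of_real (S N l)" by (simp add: S_def)
    then show ?thesis
      using B [OF decreasing_gauss [of "pi * l"], where N = N and z = "of_real x"] that by (simp add: M_def)
  qed
  have m: "S N \<in> borel_measurable \<nu>" for N by (rule measurable_nu) simp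
  have "c \<in> borel_measurable \<nu>"
    by (rule borel_measurable_LIMSEQ_real [of _ S]) (simp_all add: space_nu conv m)
  have dom: "integrable \<nu> c" "(\<lambda>N. \<integral>l. S N l \<partial>\<nu>) \<longlonglongrightarrow> (\<integral>l. c l \<partial>\<nu>)"
  proof -
    have w: "integrable \<nu> (\<lambda>l. exp (- (pi * l)) * M)"
      by (intro integrable_mult_left integrable_exp_nu) simp
    have lim: "AE l in \<nu>. (\<lambda>N. S N l) \<longlonglongrightarrow> c l" by (rule AE_I2) (simp add: conv space_nu)
    have le: "AE l in \<nu>. norm (S N l) \<le> exp (- (pi * l)) * M" for N
      by (rule AE_I2) (use bound in \<open>simp add: space_nu\<close>)
    show "integrable \<nu> c"
      by (rule integrable_dominated_convergence [OF \<open>c \<in> borel_measurable \<nu>\<close> m w lim le])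
    show "(\<lambda>N. \<integral>l. S N l \<partial>\<nu>) \<longlonglongrightarrow> (\<integral>l. c l \<partial>\<nu>)"
      by (rule integral_dominated_convergence [OF \<open>c \<in> borel_measurable \<nu>\<close> m w lim le])
  qed
  have "(\<integral>l. c l \<partial>\<nu>) = Re (cardinal_series node (of_real x))"
  proof (rule LIMSEQ_unique [OF dom(2)])
    show "(\<lambda>N. \<integral>l. S N l \<partial>\<nu>) \<longlonglongrightarrow> Re (cardinal_series node (of_real x))"
      unfolding Si using cardinal_series_of_real_sums(1) [OF decreasing_node, of x] by (simp add: sums_def)
  qed
  then have ci: "has_bochner_integral \<nu> c (Re (cardinal_series node (of_real x)))"
    using dom(1) by (simp add: has_bochner_integral_iff)
  have gi: "has_bochner_integral \<nu> (\<lambda>l. if 0 < x then exp (- (pi * l * x\<^sup>2)) else 0) (trunc_gauss \<nu> x)"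
    using integrable_gauss_nu [OF x] by (cases "0 < x") (simp_all add: has_bochner_integral_iff trunc_gauss_eq [OF x])
  have ai: "has_bochner_integral \<nu> (\<lambda>l. alt_gauss (pi * l) * nsinc x) ((\<integral>l. alt_gauss (pi * l) \<partial>\<nu>) * nsinc x)"
    using integrable_alt_gauss_nu by (simp add: has_bochner_integral_iff)
  have "Re (extremal (of_real x)) = (\<integral>l. alt_gauss (pi * l) \<partial>\<nu>) * nsinc x + Re (cardinal_series node (of_real x))"
    by (simp add: extremal_def csinc_of_real)
  moreover have "has_bochner_integral \<nu> (\<lambda>l. (if 0 < x then exp (- (pi * l * x\<^sup>2)) else 0) - (alt_gauss (pi * l) * nsinc x + c l))
      (trunc_gauss \<nu> x - ((\<integral>l. alt_gauss (pi * l) \<partial>\<nu>) * nsinc x + Re (cardinal_series node (of_real x))))"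
    by (intro has_bochner_integral_diff has_bochner_integral_add gi ai ci)
  moreover have "(if 0 < x then exp (- (pi * l * x\<^sup>2)) else 0) - (alt_gauss (pi * l) * nsinc x + c l) = kern_error (pi * l) x"
    if "l \<in> space \<nu>" for l
    using that by (simp add: kern_error_def kern_eq_cardinal_series space_nu c_def)
  ultimately show ?thesis
    using has_bochner_integral_cong [of \<nu> \<nu>] by (metis (no_types, lifting))
qed

text \<open>At x = 0 the sine vanishes, so the default value of the truncated Gaussian is harmless;
  elsewhere the sign of the kernel error is integrated over \<nu>.\<close>

lemma extremal_sign:
  "0 \<le> sin (pi * x) * (trunc_gauss \<nu> x - Re (extremal (of_real x)))"
proof (cases "x = 0")
  case False
  have "sin (pi * x) * (trunc_gauss \<nu> x - Re (extremal (of_real x))) = (\<integral>l. sin (pi * x) * kern_error (pi * l) x \<partial>\<nu>)"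
    using has_bochner_integral_integral_eq [OF kern_error_has_integral [OF False]] by simp
  also have "0 \<le> \<dots>"
    unfolding kern_error_def using False
    by (intro integral_nonneg_AE AE_I2 kern_sign) (auto simp: space_nu)
  finally show ?thesis .
qed simp

text \<open>For fixed x all kernel errors have the same sign, that of the sine, so the modulus
  passes through the \<nu>-integral without loss. This is why superposition preserves the exact
  distance.\<close>

lemma abs_extremal_error:
  assumes x: "sin (pi * x) \<noteq> 0"
  shows "ennreal \<bar>trunc_gauss \<nu> x - Re (extremal (of_real x))\<bar> = (\<integral>\<^sup>+l. ennreal \<bar>kern_error (pi * l) x\<bar> \<partial>\<nu>)"
proof -
  have "x \<noteq> 0" using x by auto
  note hb = kern_error_has_integral [OF this]
  have abs_eq: "\<bar>d\<bar> = sgn s * d" if "0 \<le> s * d" "s \<noteq> 0" for s d :: real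
    using that by (auto simp: sgn_real_def abs_if zero_le_mult_iff split: if_splits)
  have "\<bar>kern_error (pi * l) x\<bar> = sgn (sin (pi * x)) * kern_error (pi * l) x" if "0 \<le> l" for l
    using that \<open>x \<noteq> 0\<close> x unfolding kern_error_def by (intro abs_eq kern_sign) auto
  then have "(\<integral>l. \<bar>kern_error (pi * l) x\<bar> \<partial>\<nu>) = (\<integral>l. sgn (sin (pi * x)) * kern_error (pi * l) x \<partial>\<nu>)"
    by (intro Bochner_Integration.integral_cong) (auto simp: space_nu)
  also have "\<dots> = sgn (sin (pi * x)) * (trunc_gauss \<nu> x - Re (extremal (of_real x)))"
    using has_bochner_integral_integral_eq [OF hb] by simp
  also have "\<dots> = \<bar>trunc_gauss \<nu> x - Re (extremal (of_real x))\<bar>"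
    by (rule abs_eq [symmetric, OF extremal_sign x])
  finally show ?thesis
    using nn_integral_eq_integral [of \<nu> "\<lambda>l. \<bar>kern_error (pi * l) x\<bar>"] integrable.intros [OF hb]
    by simp
qed

lemma kern_error_mass:
  assumes "0 \<le> l"
  shows "theta_mean l = of_real (Re (theta_mean l))" "0 \<le> Re (theta_mean l)"
    "(\<integral>\<^sup>+x. ennreal \<bar>kern_error (pi * l) x\<bar> \<partial>lborel) = ennreal (Re (theta_mean l))"
proof -
  have "theta_mean l = of_real (Re (theta_mean l)) \<and> 0 \<le> Re (theta_mean l) \<and>
    (\<integral>\<^sup>+x. ennreal \<bar>kern_error (pi * l) x\<bar> \<partial>lborel) = ennreal (Re (theta_mean l))"
  proof (cases "l = 0")
    case True
    have "kern_error 0 x = (if 0 < x then 1 else 0) - kern 0 x" for x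
      by (cases "0 < x") (simp_all add: kern_error_def)
    with True show ?thesis using nn_integral_kern_0_error
      by (simp add: theta_mean_def complex_eq_iff)
  next
    case False
    then have l: "0 < l" using assms by simp
    have "0 \<le> gauss_square_wave (pi * l)"
      unfolding sums_unique [OF gauss_square_wave_sums [OF l]]
      using l by (intro suminf_nonneg sums_summable [OF gauss_square_wave_sums [OF l]] mult_nonneg_nonneg exp_mean_nonneg) auto
    then show ?thesis using nn_integral_kern_error [of "pi * l"] l by (simp add: theta_mean_eq)
  qed
  then show "theta_mean l = of_real (Re (theta_mean l))" "0 \<le> Re (theta_mean l)"
    "(\<integral>\<^sup>+x. ennreal \<bar>kern_error (pi * l) x\<bar> \<partial>lborel) = ennreal (Re (theta_mean l))"
    by blast+
qed

text \<open>Measurability in l comes from Tonelli, by which the mass of a jointly measurable kernel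
  error is measurable; the theta series is not consulted.\<close>

lemma theta_mean_measurable [measurable]: "theta_mean \<in> borel_measurable \<nu>"
proof -
  have "(\<lambda>(l, x). ennreal \<bar>kern_error (pi * l) x\<bar>) \<in> borel_measurable (\<nu> \<Otimes>\<^sub>M lborel)"
    by measurable
  then have "(\<lambda>l. \<integral>\<^sup>+x. ennreal \<bar>kern_error (pi * l) x\<bar> \<partial>lborel) \<in> borel_measurable \<nu>"
    by (rule lborel.borel_measurable_nn_integral)
  then have "(\<lambda>l. complex_of_real (enn2real (\<integral>\<^sup>+x. ennreal \<bar>kern_error (pi * l) x\<bar> \<partial>lborel))) \<in> borel_measurable \<nu>"
    by measurable
  also have "?this \<longleftrightarrow> theta_mean \<in> borel_measurable \<nu>"
  proof (rule measurable_cong)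
    fix l assume "l \<in> space \<nu>"
    then have "0 \<le> l" by (simp add: space_nu)
    then show "complex_of_real (enn2real (\<integral>\<^sup>+x. ennreal \<bar>kern_error (pi * l) x\<bar> \<partial>lborel)) = theta_mean l"
      using kern_error_mass [of l] by simp
  qed
  finally show ?thesis .
qed

text \<open>The two bounds on \<open>gauss_square_wave\<close> are added, one of them multiplied by
  sqrt l; at l = 0 the assigned value 1/2 fits the same constant.\<close>

lemma integrable_theta_mean: "integrable \<nu> theta_mean"
proof -
  define A where "A = (\<Sum>j. 2 / pi\<^sup>2 * (1 / (real j + 1 / 2)\<^sup>2))"
  have bound: "Re (theta_mean l) * (1 + sqrt l) \<le> \<bar>A\<bar> + 1 / 2" if l: "0 \<le> l" for l
  proof (cases "l = 0")
    case False
    then have l: "0 < l" using l by simp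
    have "gauss_square_wave (pi * l) * sqrt l \<le> 1 / (2 * sqrt l) * sqrt l"
      by (rule mult_right_mono [OF gauss_square_wave_bounds(2) [OF l]]) (use l in simp)
    then have "gauss_square_wave (pi * l) * sqrt l \<le> 1 / 2" using l by simp
    moreover have "gauss_square_wave (pi * l) \<le> \<bar>A\<bar>"
      using gauss_square_wave_bounds(1) [OF l] unfolding A_def [symmetric] by simp
    ultimately show ?thesis using l by (simp add: theta_mean_eq distrib_left)
  qed (simp add: theta_mean_def)
  show ?thesis
  proof (rule integrable_nu_bound)
    fix l :: real assume l: "0 \<le> l"
    have "norm (theta_mean l) = Re (theta_mean l)"
      using kern_error_mass [OF l] by (metis abs_of_nonneg norm_of_real)
    moreover have "0 < 1 + sqrt l" using l by (simp add: add_pos_nonneg)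
    ultimately show "norm (theta_mean l) \<le> (\<bar>A\<bar> + 1 / 2) * (1 / (1 + sqrt l))"
      using bound [OF l] by (simp add: pos_le_divide_eq)
  qed measurable
qed

lemma trunc_gauss_measurable [measurable]: "trunc_gauss \<nu> \<in> borel_measurable borel"
proof -
  note [measurable] = measurable_ident_nu
  have "(\<lambda>(x, l). exp (- pi * l * x\<^sup>2)) \<in> borel_measurable (borel \<Otimes>\<^sub>M \<nu>)"
    by measurable
  then have "(\<lambda>x. \<integral>l. exp (- pi * l * x\<^sup>2) \<partial>\<nu>) \<in> borel_measurable borel"
    by (rule sigma_finite_measure.borel_measurable_lebesgue_integral [OF sigma_finite_nu])
  then show ?thesis unfolding trunc_gauss_def x_plus_0_def by measurable
qed

text \<open>Serves uniqueness, where one-sided limits at the nonzero integers are compared.\<close>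

lemma isCont_trunc_gauss:
  assumes "x \<noteq> 0"
  shows "isCont (trunc_gauss \<nu>) x"
  unfolding continuous_at_sequentially
proof (intro allI impI)
  fix X assume X: "X \<longlonglongrightarrow> x"
  have "eventually (\<lambda>j. dist (X j) x < \<bar>x\<bar> / 2) sequentially"
    using assms by (intro tendstoD [OF X]) simp
  then obtain J where J: "\<And>j. J \<le> j \<Longrightarrow> \<bar>X j - x\<bar> < \<bar>x\<bar> / 2"
    by (auto simp: eventually_sequentially dist_real_def)
  \<comment> \<open>After dropping finitely many members all points have the sign of x and modulus
    at least |x|/2, so one Gaussian is a majorant for the whole sequence.\<close>
  define Y where "Y j = X (j + J)" for j
  have Y: "Y \<longlonglongrightarrow> x" unfolding Y_def by (rule LIMSEQ_ignore_initial_segment [OF X])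
  have near: "\<bar>Y j - x\<bar> < \<bar>x\<bar> / 2" for j unfolding Y_def by (rule J) simp
  have sgn: "x_plus_0 (Y j) = x_plus_0 x" for j
  proof -
    have "0 < Y j \<longleftrightarrow> 0 < x" "Y j = 0 \<longleftrightarrow> x = 0" using near [of j] assms by arith+
    then show ?thesis by (simp add: x_plus_0_def sgn_real_def)
  qed
  have "(\<lambda>j. \<integral>l. exp (- pi * l * (Y j)\<^sup>2) \<partial>\<nu>) \<longlonglongrightarrow> (\<integral>l. exp (- pi * l * x\<^sup>2) \<partial>\<nu>)"
  proof (rule integral_dominated_convergence)
    show "integrable \<nu> (\<lambda>l. exp (- (pi * l * (x / 2)\<^sup>2)))"
      by (rule integrable_gauss_nu) (use assms in simp)
    show "AE l in \<nu>. (\<lambda>j. exp (- pi * l * (Y j)\<^sup>2)) \<longlonglongrightarrow> exp (- pi * l * x\<^sup>2)"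
      by (intro AE_I2 tendsto_intros Y)
    show "AE l in \<nu>. norm (exp (- pi * l * (Y j)\<^sup>2)) \<le> exp (- (pi * l * (x / 2)\<^sup>2))" for j
    proof (rule AE_I2)
      fix l assume "l \<in> space \<nu>"
      then have "0 \<le> pi * l" by (simp add: space_nu)
      moreover have "\<bar>x / 2\<bar> \<le> \<bar>Y j\<bar>" using near [of j] by (auto simp: abs_if split: if_splits)
      ultimately have "pi * l * (x / 2)\<^sup>2 \<le> pi * l * (Y j)\<^sup>2"
        by (intro mult_left_mono) (simp_all only: abs_le_square_iff)
      then show "norm (exp (- pi * l * (Y j)\<^sup>2)) \<le> exp (- (pi * l * (x / 2)\<^sup>2))" by simp
    qed
  qed (rule measurable_nu, measurable)+
  then have "(\<lambda>j. x_plus_0 x * (\<integral>l. exp (- pi * l * (Y j)\<^sup>2) \<partial>\<nu>)) \<longlonglongrightarrow> trunc_gauss \<nu> x"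
    unfolding trunc_gauss_def by (intro tendsto_intros)
  then have "(\<lambda>j. trunc_gauss \<nu> (X (j + J))) \<longlonglongrightarrow> trunc_gauss \<nu> x"
    by (simp add: trunc_gauss_def sgn flip: Y_def)
  then show "(trunc_gauss \<nu> \<circ> X) \<longlonglongrightarrow> trunc_gauss \<nu> x"
    unfolding comp_def by (rule LIMSEQ_offset)
qed

text \<open>Tonelli for the kernel errors: integrating over x first gives \<open>theta_mean\<close>,
  over l first the error of the superposition. Off the zeros of the sine there is no cancellation
  between different l.\<close>

lemma nn_integral_extremal_error:
  "(\<integral>\<^sup>+x. ennreal (cmod (of_real (trunc_gauss \<nu> x) - extremal (of_real x))) \<partial>lborel) =
     ennreal (\<integral>l. Re (theta_mean l) \<partial>\<nu>)"
proof -
  interpret pair_sigma_finite \<nu> lborel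
    by (intro pair_sigma_finite.intro sigma_finite_nu lborel.sigma_finite_measure_axioms)
  have norm_eq: "cmod (of_real (trunc_gauss \<nu> x) - extremal (of_real x)) = \<bar>trunc_gauss \<nu> x - Re (extremal (of_real x))\<bar>" for x
  proof -
    have "of_real (trunc_gauss \<nu> x) - extremal (of_real x) = of_real (trunc_gauss \<nu> x - Re (extremal (of_real x)))"
      using extremal_real [of x] by (simp add: complex_is_Real_iff complex_eq_iff)
    then show ?thesis by (simp only: norm_of_real)
  qed
  have "(\<integral>\<^sup>+x. ennreal (cmod (of_real (trunc_gauss \<nu> x) - extremal (of_real x))) \<partial>lborel) =
      (\<integral>\<^sup>+x. (\<integral>\<^sup>+l. ennreal \<bar>kern_error (pi * l) x\<bar> \<partial>\<nu>) \<partial>lborel)"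
    by (rule nn_integral_cong_AE, rule eventually_mono [OF AE_sin_nonzero])
      (subst norm_eq, rule abs_extremal_error)
  also have "\<dots> = (\<integral>\<^sup>+l. (\<integral>\<^sup>+x. ennreal \<bar>kern_error (pi * l) x\<bar> \<partial>lborel) \<partial>\<nu>)"
    by (rule Fubini') measurable
  also have "\<dots> = (\<integral>\<^sup>+l. ennreal (Re (theta_mean l)) \<partial>\<nu>)"
    by (rule nn_integral_cong) (simp add: space_nu kern_error_mass(3))
  also have "\<dots> = ennreal (\<integral>l. Re (theta_mean l) \<partial>\<nu>)"
    by (rule nn_integral_eq_integral)
      (auto simp: space_nu integrable_theta_mean intro!: AE_I2 kern_error_mass(2))
  finally show ?thesis .
qed

text \<open>A by-product of the distance computation, whose value is finite. It concerns the
  difference only: the truncated Gaussian itself need not be integrable.\<close>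

lemma integrable_extremal_error:
  "integrable lborel (\<lambda>x. of_real (trunc_gauss \<nu> x) - extremal (of_real x))"
proof (rule integrableI_bounded)
  have [measurable]: "(\<lambda>x. extremal (of_real x)) \<in> borel_measurable borel"
    by (rule borel_measurable_continuous_onI [OF exp_type_le_continuous [OF exp_type_extremal]])
  show "(\<lambda>x. of_real (trunc_gauss \<nu> x) - extremal (of_real x)) \<in> borel_measurable lborel" by measurable
qed (simp add: nn_integral_extremal_error)

end

theorem theorem3:
  fixes \<nu> :: "real measure"
  assumes "sets \<nu> = sets (restrict_space borel {0..})"
    and "(\<integral>\<^sup>+ l. ennreal (1 / (1 + sqrt l)) \<partial>\<nu>) < \<infinity>"
  shows "\<exists>k. best_approx pi (trunc_gauss \<nu>) k
    \<and> (\<forall>K. best_approx pi (trunc_gauss \<nu>) K \<longrightarrow> K = k)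
    \<and> (\<forall>n::int. n \<noteq> 0 \<longrightarrow> k (of_int n) = complex_of_real (trunc_gauss \<nu> (of_int n)))
    \<and> (\<forall>x::real. k (complex_of_real x) \<in> \<real>
          \<and> sin (pi * x) * (trunc_gauss \<nu> x - Re (k (complex_of_real x))) \<ge> 0)
    \<and> integrable lborel (\<lambda>x. complex_of_real (trunc_gauss \<nu> x) - k (complex_of_real x))
    \<and> integrable \<nu> theta_mean
    \<and> complex_of_real
          (\<integral>x. cmod (complex_of_real (trunc_gauss \<nu> x) - k (complex_of_real x)) \<partial>lborel)
        = (\<integral>l. theta_mean l \<partial>\<nu>)"
proof -
  interpret half_line_measure \<nu> by unfold_locales (rule assms)+
  have cont: "isCont (trunc_gauss \<nu>) (of_int n)" if "n \<noteq> 0" for n :: int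
    using that by (intro isCont_trunc_gauss) simp
  note best = best_approx_of_sign [OF exp_type_extremal trunc_gauss_measurable integrable_extremal_error
      extremal_real extremal_sign cont extremal_of_int]
  have "ennreal (\<integral>x. cmod (of_real (trunc_gauss \<nu> x) - extremal (of_real x)) \<partial>lborel) =
      ennreal (\<integral>l. Re (theta_mean l) \<partial>\<nu>)"
    using nn_integral_extremal_error
      nn_integral_eq_integral [OF integrable_norm [OF integrable_extremal_error]] by simp
  then have "(\<integral>x. cmod (of_real (trunc_gauss \<nu> x) - extremal (of_real x)) \<partial>lborel) = (\<integral>l. Re (theta_mean l) \<partial>\<nu>)"
    by (rule ennreal_inj [THEN iffD1, rotated 2])
      (auto intro!: integral_nonneg_AE AE_I2 simp: space_nu kern_error_mass(2))
  also have "complex_of_real \<dots> = (\<integral>l. of_real (Re (theta_mean l)) \<partial>\<nu>)"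
    by (rule integral_complex_of_real [symmetric])
  also have "\<dots> = (\<integral>l. theta_mean l \<partial>\<nu>)"
    by (rule Bochner_Integration.integral_cong) (simp_all add: space_nu kern_error_mass(1) [symmetric])
  finally show ?thesis
    by (intro exI [of _ extremal] conjI allI impI best extremal_of_int extremal_real extremal_sign
        integrable_extremal_error integrable_theta_mean)
qed

end
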